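(* Let $\overline{N}(s,m,n)$ denote the number of overpartitions of $n$ whose rank is congruent to $s$ modulo $m$ (with the convention that $\overline{N}(s,m,0)=0$ for all $s,m$), and for $\ell=5$ set $$R_{st}(d)=\sum_{n\ge 0}\left(\overline{N}(s,5,5n+d)-\overline{N}(t,5,5n+d)\right)q^n.$$ Then, for $|q|<1$: $$R_{12}(0)=\frac{2q(q^{10};q^{10})_\infty}{(q^3,q^4,q^6,q^7;q^{10})_\infty},\qquad R_{12}(1)=\frac{-2q(-q^5;q^5)_\infty}{(q^5;q^5)_\infty}\sum_{n\in\mathbb{Z}}\frac{(-1)^nq^{5n^2+5n}}{1-q^{5n+2}},$$ $$R_{12}(2)=\frac{2(q^{10};q^{10})_\infty}{(q,q^4;q^5)_\infty},\qquad R_{12}(3)=\frac{-2(q^{10};q^{10})_\infty}{(q^2,q^3;q^5)_\infty},$$ $$R_{12}(4)=\frac{6(-q^5;q^5)_\infty}{(q^5;q^5)_\infty}\sum_{n\in\mathbb{Z}}\frac{(-1)^nq^{5n^2+5n}}{1-q^{5n+1}}-\frac{4(q^2,q^8,q^{10};q^{10})_\infty}{(q^4,q^6;q^{10})_\infty^2(q,q^9;q^{10})_\infty},$$ $$R_{02}(0)=-1+\frac{(-q^2,-q^3;q^5)_\infty(q^5;q^5)_\infty}{(q^2,q^3;q^5)_\infty(-q^5;q^5)_\infty},$$ $$R_{02}(1)=\frac{2(q^4,q^6,q^{10};q^{10})_\infty}{(q^2,q^8;q^{10})_\infty^2(q^3,q^7;q^{10})_\infty}+\frac{4q(-q^5;q^5)_\infty}{(q^5;q^5)_\infty}\sum_{n\in\mathbb{Z}}\frac{(-1)^nq^{5n^2+5n}}{1-q^{5n+2}},$$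 $$R_{02}(2)=0,\qquad R_{02}(3)=\frac{2(q^{10};q^{10})_\infty}{(q^2,q^3;q^5)_\infty},$$ $$R_{02}(4)=\frac{2(q^2,q^8,q^{10};q^{10})_\infty}{(q^4,q^6;q^{10})_\infty^2(q,q^9;q^{10})_\infty}-\frac{2(-q^5;q^5)_\infty}{(q^5;q^5)_\infty}\sum_{n\in\mathbb{Z}}\frac{(-1)^nq^{5n^2+5n}}{1-q^{5n+1}}.$$
   Context: An overpartition of $n$ is a partition of $n$ in which the first occurrence of each distinct part may be overlined. The rank of an overpartition is its largest part minus its number of parts. $\overline{N}(s,m,n)$ is the number of overpartitions of $n$ with rank congruent to $s$ modulo $m$; the empty overpartition of $0$ is not counted, i.e. $\overline{N}(s,m,0)=0$. Notation: $(a_1,\dots,a_j;q)_\infty=\prod_{k\ge0}(1-a_1q^k)\cdots(1-a_jq^k)$. *)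

theory Defs
  imports "HOL-Analysis.Analysis" "HOL-Library.Multiset" "HOL-Number_Theory.Cong"
begin

text \<open>
  An overpartition of \<open>n\<close> is a pair \<open>(M, S)\<close>: the multiset \<open>M\<close> of its parts together with the
  set \<open>S\<close> of those distinct parts whose first occurrence is overlined.
\<close>
definition overpartitions :: "nat \<Rightarrow> (nat multiset \<times> nat set) set" where
  "overpartitions n = {(M, S). 0 \<notin># M \<and> sum_mset M = n \<and> S \<subseteq> set_mset M}"

text \<open>Only meaningful for a nonempty overpartition.\<close>
definition overpartition_rank :: "nat multiset \<times> nat set \<Rightarrow> int" where
  "overpartition_rank p = int (Max (set_mset (fst p))) - int (size (fst p))"

definition Nbar :: "int \<Rightarrow> nat \<Rightarrow> nat \<Rightarrow> nat" where
  "Nbar s m n = card {p \<in> overpartitions n. fst p \<noteq> {#} \<and> [overpartition_rank p = s] (mod int m)}"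

text \<open>The \<open>n\<close>-th term of the series \<open>R\<^sub>s\<^sub>t(d)\<close> for \<open>\<ell> = 5\<close>.\<close>
definition R_term :: "int \<Rightarrow> int \<Rightarrow> nat \<Rightarrow> complex \<Rightarrow> nat \<Rightarrow> complex" where
  "R_term s t d q n =
     (of_nat (Nbar s 5 (5 * n + d)) - of_nat (Nbar t 5 (5 * n + d))) * q ^ n"

text \<open>\<open>qpoch [a\<^sub>1, \<dots>, a\<^sub>j] q\<close> is \<open>(a\<^sub>1, \<dots>, a\<^sub>j; q)\<^sub>\<infinity>\<close>.\<close>
definition qpoch :: "complex list \<Rightarrow> complex \<Rightarrow> complex" where
  "qpoch as q = (\<Prod>k. prod_list (map (\<lambda>a. 1 - a * q ^ k) as))"

text \<open>
  For \<open>n < 0\<close> the summand \<open>(-1)\<^sup>n q\<^bsup>5n\<^sup>2+5n\<^esup> / (1 - q\<^bsup>5n+c\<^esup>)\<close> contains a negative power of \<open>q\<close>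
  and so has a removable singularity at \<open>q = 0\<close>, where HOL division by zero would give the wrong
  value (for \<open>n = -1\<close> it would be \<open>-1\<close> in place of \<open>0\<close>).  We use the limit there.
\<close>
definition bilateral_term :: "int \<Rightarrow> complex \<Rightarrow> int \<Rightarrow> complex" where
  "bilateral_term c q n =
     (let f = (\<lambda>z. (-1) powi n * z powi (5 * n\<^sup>2 + 5 * n) / (1 - z powi (5 * n + c)))
      in if q = 0 then Lim (at 0) f else f q)"

definition bilateral_sum :: "int \<Rightarrow> complex \<Rightarrow> complex" where
  "bilateral_sum c q = (\<Sum>\<^sub>\<infinity>n\<in>UNIV. bilateral_term c q n)"

lemma bilateral_term_0:
  assumes "0 < c" "c < 5"
  shows "bilateral_term c 0 n = (if n = 0 then 1 else 0)"
proof -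
  let ?f = "\<lambda>z::complex. (-1) powi n * z powi (5 * n\<^sup>2 + 5 * n) / (1 - z powi (5 * n + c))"
  have "?f \<midarrow>0\<rightarrow> (if n = 0 then 1 else 0)"
  proof (cases "n \<ge> 0")
    case True
    define a b where "a = nat (5 * n\<^sup>2 + 5 * n)" and "b = nat (5 * n + c)"
    have ab: "5 * n\<^sup>2 + 5 * n = int a" "5 * n + c = int b"
      using True assms by (auto simp: a_def b_def)
    have b0: "b > 0" using True assms by (simp add: b_def)
    have a0: "a = 0 \<longleftrightarrow> n = 0"
    proof
      assume "a = 0"
      with ab(1) have "5 * n\<^sup>2 + 5 * n = 0" by simp
      thus "n = 0" using True zero_le_power2[of n] by linarith
    qed (simp add: a_def)
    have "((\<lambda>z::complex. (-1) powi n * z ^ a / (1 - z ^ b)) \<longlongrightarrow> (-1) powi n * 0 ^ a / (1 - 0 ^ b)) (at 0)"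
      using b0 by (intro tendsto_intros) (auto simp: zero_power)
    thus ?thesis unfolding ab power_int_of_nat using a0 b0 by (auto simp: zero_power)
  next
    case False
    define a b where "a = nat (5 * n\<^sup>2 + 5 * n)" and "b = nat (- 5 * n - c)"
    have "n * (n + 1) \<ge> 0" using False by (intro mult_nonpos_nonpos) auto
    hence "5 * n\<^sup>2 + 5 * n \<ge> 0" by (simp add: power2_eq_square algebra_simps)
    hence ab: "5 * n\<^sup>2 + 5 * n = int a" "5 * n + c = - int b"
      using False assms by (auto simp: a_def b_def)
    have b0: "b > 0" using False assms by (simp add: b_def)
    have "((\<lambda>z::complex. (-1) powi n * z ^ a * z ^ b / (z ^ b - 1)) \<longlongrightarrow>
             (-1) powi n * 0 ^ a * 0 ^ b / (0 ^ b - 1)) (at 0)"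
      using b0 by (intro tendsto_intros) (auto simp: zero_power)
    moreover have "\<forall>\<^sub>F z in at 0. (-1) powi n * z ^ a * z ^ b / (z ^ b - 1) = ?f z"
    proof -
      have "\<forall>\<^sub>F z in at (0::complex). z \<noteq> 0" by (simp add: eventually_at_filter)
      thus ?thesis
        by eventually_elim (simp add: ab power_int_minus divide_simps)
    qed
    ultimately have "?f \<midarrow>0\<rightarrow> (-1) powi n * 0 ^ a * 0 ^ b / (0 ^ b - 1)"
      by (rule Lim_transform_eventually)
    thus ?thesis using False b0 by (simp add: zero_power)
  qed
  thus ?thesis by (simp add: bilateral_term_def tendsto_Lim)
qed

end

theory Submission
  imports Defs "HOL-Complex_Analysis.Complex_Analysis"
begin

text \<open>
  Summing over the largest part writes the rank generating function, for a rank variable \<open>z\<close> on the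
  unit circle, as a series \<open>2 q S(z)\<close> that extends meromorphically in \<open>z\<close>. Both \<open>S\<close> and an Appell sum
  satisfy the same first-order q-difference equation under \<open>z \<mapsto> q z\<close>, and the homogeneous equation
  has no admissible solution, so the two agree up to elementary factors. Taking \<open>z\<close> to be the fifth
  roots of unity gives the rank differences modulo 5 in terms of bilateral sums, which split according
  to the residue of the summation index modulo 5. The pieces are Appell sums at base \<open>x\<^sup>2\<^sup>5\<close>; a three-term
  relation (again a uniqueness argument for a q-difference equation) reduces them to two Appell sums
  and to quotients of the theta functions \<open>j k = (q\<^sup>k, q\<^sup>1\<^sup>0\<^sup>-\<^sup>k; q\<^sup>1\<^sup>0)\<close>, where \<open>q = x\<^sup>5\<close>. The four-term identity
  for the logarithmic derivative of theta supplies all relations among these quotients, and with them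
  the claimed right-hand sides, multiplied by the dissected theta series in the denominator, match
  the dissected numerators. Since this holds at all five fifth roots \<open>x\<close> of \<open>q\<close>, the residue classes
  separate. The value \<open>q = 0\<close> is a count of the overpartitions of \<open>d \<le> 4\<close>.
\<close>

section \<open>q-Pochhammer symbols and the theta function\<close>

text \<open>Uniqueness rests on the multiplier: if it vanishes at z = 0, comparing leading
  coefficients at the origin kills every solution; if it is 1, solutions are constant. Each identity
  thus reduces to one functional equation and a check that simple poles cancel. The limit z -> 1 of
  the rank identity yields Gauss's value of \<open>vt q 1\<close>, which in turn fixes the constant
  of the Jacobi triple product. The obstacle is residue class 0. Its Appell sum sits on its own
  pole, with the singular index dropped, so the three-term relation is available only as a limit and
  leaves a logarithmic derivative \<open>lam\<close>, which by itself is no theta quotient. It is,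
  however, a linear form in the four numbers \<open>LL10 q k\<close>, k = 1, ..., 4, and so are many
  theta quotients, by the four-term identity; 1 + 10 \<open>lam\<close> at q and 3 - 10
  \<open>lam\<close> at q^2 turn out to be sums of theta quotients. Hence the work is done with s =
  (1 + 10 \<open>T x 2\<close>) / \<open>vt x 1\<close> and p = (3 + 10 \<open>T x 1\<close>) /
  \<open>vt x 1\<close>: the rank differences are (3 s - p) / 5 and -1 + (2 p - s) / 5.\<close>

definition qp :: "complex \<Rightarrow> complex \<Rightarrow> complex" where
  "qp a q = (\<Prod>k. 1 - a * q ^ k)"

lemma convergent_qp:
  fixes a q :: complex
  assumes "norm q < 1"
  shows "convergent_prod (\<lambda>k. 1 - a * q ^ k)"
proof -
  have "summable (\<lambda>k. norm a * norm q ^ k)"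
    using assms by (intro summable_mult summable_geometric) auto
  hence "summable (\<lambda>k. norm ((1 - a * q ^ k) - 1))"
    by (simp add: norm_mult norm_power)
  thus ?thesis
    using abs_convergent_prod_conv_summable abs_convergent_prod_imp_convergent_prod by blast
qed

lemma qpoch_eq: "norm q < 1 \<Longrightarrow> qpoch as q = prod_list (map (\<lambda>a. qp a q) as)"
proof (induction as)
  case Nil
  thus ?case by (simp add: qpoch_def)
next
  case (Cons a as)
  have conv: "convergent_prod (\<lambda>k. prod_list (map (\<lambda>a. 1 - a * q ^ k) as))" for as
    by (induction as) (auto intro!: convergent_prod_mult convergent_qp Cons.prems)
  have "qpoch (a # as) q = qp a q * qpoch as q"
    unfolding qpoch_def qp_def
    by (subst prodinf_mult) (auto intro!: conv convergent_qp Cons.prems)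
  thus ?case using Cons by simp
qed

lemma qp_rec: "norm q < 1 \<Longrightarrow> qp a q = (1 - a) * qp (a * q) q"
  unfolding qp_def
  using has_prod_unique[OF has_prod_ignore_initial_segment'[OF convergent_qp[of q a], of 1]]
  by (simp add: mult_ac)

lemma qp_eq_0_iff: "norm q < 1 \<Longrightarrow> qp a q = 0 \<longleftrightarrow> (\<exists>k. a * q ^ k = 1)"
  unfolding qp_def using has_prod_eq_0_iff[OF convergent_prod_has_prod[OF convergent_qp[of q a]]]
  by (auto simp: image_iff)

lemma LIMSEQ_qp: "norm q < 1 \<Longrightarrow> (\<lambda>n. \<Prod>k<n. 1 - a * q ^ k) \<longlonglongrightarrow> qp a q"
  using convergent_prod_LIMSEQ[OF convergent_qp[of q a]]
  unfolding qp_def by (subst filterlim_sequentially_Suc[symmetric]) (simp add: lessThan_Suc_atMost)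

lemma qp_split2:
  assumes "norm q < 1"
  shows "qp a q = qp a (q\<^sup>2) * qp (a * q) (q\<^sup>2)"
proof -
  have q2: "norm (q\<^sup>2) < 1" using assms by (simp add: norm_power power_less_one_iff)
  have "(\<lambda>n. \<Prod>k<2*n. 1 - a * q ^ k) \<longlonglongrightarrow> qp a q"
    by (rule filterlim_compose[OF LIMSEQ_qp[OF assms]])
       (auto intro!: filterlim_subseq strict_monoI)
  moreover have "(\<Prod>k<2*n. 1 - a * q ^ k) =
      (\<Prod>k<n. 1 - a * (q\<^sup>2) ^ k) * (\<Prod>k<n. 1 - (a * q) * (q\<^sup>2) ^ k)" for n
    by (induction n) (auto simp: power_mult power_mult_distrib mult_ac simp flip: power_mult power2_eq_square)
  moreover have "(\<lambda>n. (\<Prod>k<n. 1 - a * (q\<^sup>2) ^ k) * (\<Prod>k<n. 1 - (a * q) * (q\<^sup>2) ^ k))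
      \<longlonglongrightarrow> qp a (q\<^sup>2) * qp (a * q) (q\<^sup>2)"
    by (intro tendsto_mult LIMSEQ_qp q2)
  ultimately show ?thesis using LIMSEQ_unique by auto
qed

lemma qp_mult_minus:
  assumes "norm q < 1"
  shows "qp a q * qp (- a) q = qp (a\<^sup>2) (q\<^sup>2)"
proof -
  have q2: "norm (q\<^sup>2) < 1" using assms by (simp add: norm_power power_less_one_iff)
  have "(\<lambda>n. (\<Prod>k<n. 1 - a * q ^ k) * (\<Prod>k<n. 1 - (- a) * q ^ k)) \<longlonglongrightarrow> qp a q * qp (- a) q"
    by (intro tendsto_mult LIMSEQ_qp assms)
  moreover have "(\<Prod>k<n. 1 - a * q ^ k) * (\<Prod>k<n. 1 - (- a) * q ^ k) = (\<Prod>k<n. 1 - a\<^sup>2 * (q\<^sup>2) ^ k)" for n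
    unfolding prod.distrib[symmetric]
    by (intro prod.cong refl) (simp add: algebra_simps power2_eq_square power_mult_distrib)
  ultimately show ?thesis using LIMSEQ_qp[OF q2, of "a\<^sup>2"] by (simp add: LIMSEQ_unique)
qed

text \<open>On every disc the factors are dominated by a geometric series, so the partial products,
  which are polynomials in a, converge uniformly.\<close>

lemma holomorphic_qp:
  assumes "norm q < 1"
  shows "(\<lambda>a. qp a q) holomorphic_on A"
proof -
  have "(\<lambda>a. qp a q) field_differentiable (at z)" for z
  proof -
    define r where "r = norm z + 1"
    have summ: "summable (\<lambda>k. r * norm q ^ k)"
      using assms by (intro summable_mult summable_geometric) auto
    have "uniformly_convergent_on (cball 0 r) (\<lambda>N a. \<Sum>n<N. norm (- (a * q ^ n)))"
    proof (rule Weierstrass_m_test'[OF _ summ])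
      fix n a assume "a \<in> cball (0::complex) r"
      thus "norm (norm (- (a * q ^ n))) \<le> r * norm q ^ n"
        by (auto simp: norm_mult norm_power intro!: mult_right_mono)
    qed
    hence "uniformly_convergent_on (cball 0 r) (\<lambda>N a. \<Prod>n<N. 1 + - (a * q ^ n))"
      by (intro uniformly_convergent_on_prod continuous_intros) auto
    then obtain g where g: "uniform_limit (cball 0 r) (\<lambda>N a. \<Prod>n<N. 1 - a * q ^ n) g sequentially"
      by (auto simp: uniformly_convergent_on_def)
    have geq: "g a = qp a q" if "a \<in> cball 0 r" for a
      using tendsto_uniform_limitI[OF g that] LIMSEQ_qp[OF assms] LIMSEQ_unique by blast
    have "g holomorphic_on ball 0 r"
      by (rule holomorphic_uniform_limit[OF _ g, THEN conjunct2])
         (auto intro!: always_eventually holomorphic_intros holomorphic_on_imp_continuous_on)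
    hence "(\<lambda>a. qp a q) holomorphic_on ball 0 r"
      by (rule holomorphic_transform) (use geq in auto)
    moreover have "z \<in> ball 0 r" by (simp add: r_def)
    ultimately show ?thesis using holomorphic_on_imp_differentiable_at open_ball by blast
  qed
  thus ?thesis using field_differentiable_at_within holomorphic_on_def by blast
qed

section \<open>The theta function and its zeros\<close>

definition th :: "complex \<Rightarrow> complex \<Rightarrow> complex" where
  "th q z = qp z q * qp (q / z) q"

lemma holomorphic_th:
  assumes "norm q < 1" "0 \<notin> A"
  shows "th q holomorphic_on A"
proof -
  have *: "((\<lambda>a. qp a q) \<circ> (\<lambda>z. q / z)) holomorphic_on A"
    by (rule holomorphic_on_compose_gen[OF _ holomorphic_qp[of _ UNIV]])
       (use assms in \<open>auto intro!: holomorphic_intros\<close>)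
  show ?thesis unfolding th_def[abs_def]
    by (intro holomorphic_on_mult holomorphic_qp assms *[unfolded o_def])
qed

lemma th_inverse: 
  assumes "norm q < 1" "q \<noteq> 0" "z \<noteq> 0"
  shows "th q (1 / z) = - th q z / z"
proof -
  have "qp z q = (1 - z) * qp (z * q) q" "qp (1/z) q = (1 - 1/z) * qp (q / z) q"
    using qp_rec[of q z] qp_rec[of q "1/z"] assms by auto
  note * = this
  have "z * th q (1 / z) = qp (1/z) q * (z * qp (z * q) q)"
    using assms by (simp add: th_def mult_ac)
  also have "\<dots> = - (qp (q / z) q * ((1 - z) * qp (z * q) q))"
    unfolding *(2) using assms by (simp add: field_simps)
  also have "\<dots> = - th q z" by (simp add: th_def *(1) mult_ac)
  finally show ?thesis using assms by (simp add: field_simps)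
qed

text \<open>\<open>th q (q * z)\<close> and \<open>th q (1 / z)\<close> are the same product with
  its two factors exchanged, so the computation for inversion applies again.\<close>

lemma th_mult_q:
  assumes "norm q < 1" "q \<noteq> 0" "z \<noteq> 0"
  shows "th q (q * z) = - th q z / z"
proof -
  have "qp z q = (1 - z) * qp (z * q) q" "qp (1/z) q = (1 - 1/z) * qp (q / z) q"
    using qp_rec[of q z] qp_rec[of q "1/z"] assms by auto
  note * = this
  have "z * th q (q * z) = qp (1/z) q * (z * qp (z * q) q)"
    using assms by (simp add: th_def mult_ac)
  also have "\<dots> = - (qp (q / z) q * ((1 - z) * qp (z * q) q))"
    unfolding *(2) using assms by (simp add: field_simps)
  also have "\<dots> = - th q z" by (simp add: th_def *(1) mult_ac)
  finally show ?thesis using assms by (simp add: field_simps)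
qed

lemma th_q_divide:
  assumes "norm q < 1" "q \<noteq> 0" "z \<noteq> 0"
  shows "th q (q / z) = th q z"
  using assms by (simp add: th_def)

lemma power_int_unit_inj:
  fixes x :: real
  assumes "0 < x" "x < 1"
  shows "x powi m = x powi n \<longleftrightarrow> m = n"
  using power_int_strict_decreasing[of m n x] power_int_strict_decreasing[of n m x] assms
  by (cases m n rule: linorder_cases) auto

lemma power_int_eq_1_iff:
  fixes q :: complex
  assumes "norm q < 1" "q \<noteq> 0"
  shows "q powi k = 1 \<longleftrightarrow> k = 0"
proof
  assume "q powi k = 1"
  hence "norm q powi k = norm q powi 0" by (metis norm_one norm_power_int power_int_0_right)
  thus "k = 0" using power_int_unit_inj[of "norm q" k 0] assms by simp
qed auto

text \<open>The factor \<open>qp z q\<close> accounts for the powers of q with exponent at most 0,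
  the factor \<open>qp (q / z) q\<close> for the positive ones.\<close>

lemma th_eq_0_iff:
  assumes "norm q < 1" "q \<noteq> 0" "z \<noteq> 0"
  shows "th q z = 0 \<longleftrightarrow> (\<exists>k::int. z = q powi k)"
proof
  assume "th q z = 0"
  hence "(\<exists>k. z * q ^ k = 1) \<or> (\<exists>k. q / z * q ^ k = 1)"
    using assms by (simp add: th_def qp_eq_0_iff)
  thus "\<exists>k::int. z = q powi k"
  proof
    assume "\<exists>k. z * q ^ k = 1"
    then obtain k where "z * q ^ k = 1" by auto
    hence "z = q powi (- int k)" using assms by (simp add: power_int_minus field_simps)
    thus ?thesis by blast
  next
    assume "\<exists>k. q / z * q ^ k = 1"
    then obtain k where "q / z * q ^ k = 1" by auto
    hence "z = q powi (int (Suc k))" using assms by (simp only: power_int_of_nat) (simp add: field_simps)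
    thus ?thesis by blast
  qed
next
  assume "\<exists>k::int. z = q powi k"
  then obtain k :: int where k: "z = q powi k" by auto
  show "th q z = 0"
  proof (cases "k \<le> 0")
    case True
    hence "z * q ^ nat (- k) = 1" using k assms by (simp add: power_int_def field_simps)
    thus ?thesis using assms by (auto simp: th_def qp_eq_0_iff)
  next
    case False
    have "nat k = Suc (nat (k - 1))" using False by simp
    hence "z = q * q ^ (nat (k - 1))" using k False by (simp add: power_int_def)
    hence "q / z * q ^ (nat (k - 1)) = 1" using assms by (simp add: field_simps)
    thus ?thesis using assms unfolding th_def mult_eq_0_iff qp_eq_0_iff[OF assms(1)] by blast
  qed
qed

lemma th_split2:
  assumes "norm q < 1" "q \<noteq> 0" "z \<noteq> 0"
  shows "th q z = th (q\<^sup>2) z * th (q\<^sup>2) (q * z)"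
  unfolding th_def using qp_split2[OF assms(1), of z] qp_split2[OF assms(1), of "q/z"] assms
  by (simp add: power2_eq_square mult_ac)

lemma th_mult_minus:
  assumes "norm q < 1"
  shows "th q z * th q (- z) = th (q\<^sup>2) (z\<^sup>2)"
proof -
  have "th q z * th q (- z) = (qp z q * qp (- z) q) * (qp (q / z) q * qp (- (q / z)) q)"
    by (simp add: th_def mult_ac)
  thus ?thesis unfolding qp_mult_minus[OF assms] by (simp add: th_def power_divide)
qed

text \<open>By the identity theorem on the connected punctured plane, one nonzero value is enough to
  make all zeros isolated.\<close>

lemma th_ev_nonzero:
  assumes "norm q < 1" "q \<noteq> 0" "z \<noteq> 0"
  shows "eventually (\<lambda>w. th q w \<noteq> 0) (at z)"
proof -
  have conn: "connected (-{0::complex})" by (intro connected_punctured_universe) auto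
  obtain w where w: "w \<noteq> 0" "th q w \<noteq> 0"
  proof -
    \<comment> \<open>The norm of w is |q|^(1/2); if w were q^k, squaring would give 1 = 2
      k.\<close>
    define w where "w = complex_of_real (sqrt (norm q))"
    have "w \<noteq> q powi k" for k
    proof
      assume "w = q powi k"
      hence "norm w = norm q powi k" by (simp add: norm_power_int)
      hence "sqrt (norm q) = norm q powi k" by (simp add: w_def)
      hence "sqrt (norm q) ^ 2 = (norm q powi k) ^ 2" by simp
      hence "norm q powi 1 = norm q powi (k + k)"
        using assms by (subst power_int_add) (auto simp: power2_eq_square)
      hence "1 = k + k" using power_int_unit_inj[of "norm q" 1 "k + k"] assms by simp
      thus False by presburger
    qed
    moreover have "w \<noteq> 0" using assms by (simp add: w_def)
    ultimately show ?thesis using that th_eq_0_iff[OF assms(1,2)] by blast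
  qed
  have "\<forall>\<^sub>F w in at z. th q w \<noteq> 0 \<and> w \<in> - {0}"
    using non_zero_neighbour_alt[OF holomorphic_th[OF assms(1)], of "-{0}" z w] conn w assms by auto
  thus ?thesis by eventually_elim auto
qed

section \<open>Solutions of q-difference equations on the punctured plane\<close>

text \<open>Riemann's theorem on removable singularities, applied at all points of \<open>E\<close>
  at once. Sparseness at every point of \<open>D\<close> is what makes \<open>D - E\<close>
  open.\<close>

lemma removable_discrete:
  fixes w :: "complex \<Rightarrow> complex"
  assumes D: "open D" and hol: "w holomorphic_on (D - E)"
    and sparse: "\<And>z. z \<in> D \<Longrightarrow> eventually (\<lambda>x. x \<notin> E) (at z)"
    and lim: "\<And>e. e \<in> D \<inter> E \<Longrightarrow> \<exists>l. w \<midarrow>e\<rightarrow> l"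
  obtains G where "G holomorphic_on D" "\<And>z. z \<in> D - E \<Longrightarrow> G z = w z"
proof -
  define G where "G = (\<lambda>z. if z \<in> E then Lim (at z) w else w z)"
  have "G field_differentiable (at z)" if z: "z \<in> D" for z
  proof -
    have "eventually (\<lambda>x. x \<in> D) (nhds z)" using D z by (simp add: eventually_nhds_in_open)
    hence "eventually (\<lambda>x. x \<in> D \<and> (x \<noteq> z \<longrightarrow> x \<notin> E)) (nhds z)"
      using sparse[OF z] by (auto simp: eventually_at_filter elim: eventually_elim2)
    then obtain r where r: "r > 0" "\<And>x. dist x z < r \<Longrightarrow> x \<in> D \<and> (x \<noteq> z \<longrightarrow> x \<notin> E)"
      by (auto simp: eventually_nhds_metric)
    have 1: "w holomorphic_on (ball z r - {z})"
      by (rule holomorphic_on_subset[OF hol]) (use r in \<open>auto simp: dist_commute\<close>)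
    have 2: "G holomorphic_on (ball z r - {z})"
      by (rule holomorphic_transform[OF 1]) (use r in \<open>auto simp: G_def dist_commute\<close>)
    have ev: "eventually (\<lambda>x. G x = w x) (at z)"
      using sparse[OF z] by eventually_elim (simp add: G_def)
    have lim2: "G \<midarrow>z\<rightarrow> G z"
    proof (cases "z \<in> E")
      case True
      then obtain l where l: "w \<midarrow>z\<rightarrow> l" using lim z by blast
      hence "G z = l" using True by (simp add: G_def tendsto_Lim)
      thus ?thesis using l tendsto_cong[OF ev] by simp
    next
      case False
      have "open (D - E)"
      proof -
        have "\<exists>e>0. ball x e \<subseteq> D - E" if x: "x \<in> D - E" for x
        proof -
          have "eventually (\<lambda>y. y \<in> D - E) (nhds x)"
            using eventually_nhds_in_open[OF D, of x] sparse[of x] x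
            by (auto simp: eventually_at_filter elim: eventually_elim2)
          thus ?thesis by (auto simp: eventually_nhds_metric subset_iff dist_commute)
        qed
        thus ?thesis by (simp add: open_contains_ball)
      qed
      hence "isCont w z" using hol False z
        by (meson DiffI continuous_on_eq_continuous_at holomorphic_on_imp_continuous_on)
      hence "w \<midarrow>z\<rightarrow> G z" using False by (simp add: isCont_def G_def)
      thus ?thesis using tendsto_cong[OF ev] by simp
    qed
    have "G holomorphic_on (ball z r)"
    proof (rule no_isolated_singularity[of _ _ "{z}"])
      show "continuous_on (ball z r) G"
      proof -
        have "isCont G x" if "x \<in> ball z r" for x
        proof (cases "x = z")
          case True thus ?thesis using lim2 by (simp add: isCont_def)
        next
          case False
          thus ?thesis using 2 that
            by (meson DiffI continuous_on_eq_continuous_at holomorphic_on_imp_continuous_on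
                open_ball open_delete singletonD)
        qed
        thus ?thesis by (simp add: continuous_at_imp_continuous_on)
      qed
    qed (use 2 in auto)
    thus ?thesis using r(1) by (auto intro: holomorphic_on_imp_differentiable_at[of _ "ball z r"])
  qed
  hence "G holomorphic_on D" using field_differentiable_at_within holomorphic_on_def by blast
  thus ?thesis by (rule that) (auto simp: G_def)
qed

text \<open>Iterating the functional equation towards the origin keeps the values inside a compact
  annulus, so a solution extends to the origin.\<close>
lemma qdiff_extends:
  fixes w h :: "complex \<Rightarrow> complex"
  assumes q: "0 < norm q" "norm q < 1" and r: "r > 0"
    and hol: "w holomorphic_on (ball 0 r - {0})"
    and hb: "\<And>z. z \<in> ball 0 r - {0} \<Longrightarrow> norm (h z) \<le> 1"
    and eq: "\<And>z. z \<in> ball 0 r - {0} \<Longrightarrow> w (q * z) = h z * w z"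
  obtains W where "W holomorphic_on ball 0 r" "\<And>z. z \<in> ball 0 r - {0} \<Longrightarrow> W z = w z"
proof -
  define s where "s = r / 2"
  define A where "A = cball 0 s - ball (0::complex) (s * norm q)"
  have "compact A" unfolding A_def by (simp add: compact_diff)
  moreover have "A \<subseteq> ball 0 r - {0}" using r q by (auto simp: A_def s_def)
  hence "continuous_on A w" using hol holomorphic_on_imp_continuous_on holomorphic_on_subset by blast
  ultimately have "bounded (w ` A)" using compact_continuous_image compact_imp_bounded by blast
  then obtain B where B: "\<And>z. z \<in> A \<Longrightarrow> norm (w z) \<le> B" by (auto simp: bounded_iff)
  have bound: "norm (w z) \<le> B" if z: "z \<in> ball 0 s - {0}" for z
  proof -
    \<comment> \<open>As |h| \<le> 1, multiplying the argument by q cannot increase |w|, so the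
      bound on the annulus \<open>A\<close> spreads inwards.\<close>
    have *: "norm (w (q ^ n * x)) \<le> B" if "x \<in> A" for n x
    proof (induction n)
      case (Suc n)
      have x: "x \<noteq> 0" "norm x \<le> s" using that r q by (auto simp: A_def s_def)
      have "norm (q ^ n * x) \<le> 1 * s" unfolding norm_mult norm_power
        by (intro mult_mono) (use x q in \<open>auto simp: power_le_one\<close>)
      hence in_D: "q ^ n * x \<in> ball 0 r - {0}" using x q r by (auto simp: s_def)
      have "norm (w (q ^ Suc n * x)) = norm (h (q ^ n * x)) * norm (w (q ^ n * x))"
        using eq[OF in_D] by (simp add: mult.assoc norm_mult)
      also have "\<dots> \<le> 1 * B" by (intro mult_mono hb in_D Suc.IH) auto
      finally show ?case by simp
    qed (use B that in auto)
    have "\<exists>n. norm z \<ge> s * norm q ^ n"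
    proof -
      have "norm z / s > 0" using z r by (simp add: s_def)
      then obtain n where "norm q ^ n < norm z / s" using q real_arch_pow_inv by blast
      thus ?thesis using r by (intro exI[of _ n]) (simp add: s_def field_simps)
    qed
    \<comment> \<open>Minimality of n puts x = z / q^(n-1) into the annulus
      \<open>A\<close>.\<close>
    define n where "n = (LEAST n. norm z \<ge> s * norm q ^ n)"
    have n: "norm z \<ge> s * norm q ^ n" unfolding n_def by (rule LeastI_ex) fact
    have n0: "n > 0"
    proof (rule ccontr)
      assume "\<not> n > 0" hence "norm z \<ge> s" using n by simp
      thus False using z by simp
    qed
    have n1: "norm z < s * norm q ^ (n - 1)"
      using not_less_Least[of "n - 1" "\<lambda>n. norm z \<ge> s * norm q ^ n"] n0 by (simp add: n_def)
    define x where "x = z / q ^ (n - 1)"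
    have zx: "z = q ^ (n - 1) * x" using q by (simp add: x_def)
    have "x \<in> A"
    proof -
      have "norm x < s" using n1 q by (simp add: x_def norm_divide norm_power field_simps)
      moreover have "norm q ^ n = norm q ^ (n - 1) * norm q" using n0 by (simp add: power_eq_if)
      hence "norm x \<ge> s * norm q" using n q by (simp add: x_def norm_divide norm_power field_simps)
      ultimately show ?thesis by (simp add: A_def)
    qed
    thus ?thesis using * zx by metis
  qed
  have "(\<lambda>z. (z - 0) * w z) \<midarrow>0\<rightarrow> 0"
  proof (rule Lim_null_comparison)
    show "\<forall>\<^sub>F z in at 0. norm ((z - 0) * w z) \<le> norm z * B"
    proof -
      have "eventually (\<lambda>z::complex. z \<in> ball 0 s - {0}) (at 0)"
        using r by (auto simp: s_def eventually_at intro!: exI[of _ "r/2"])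
      thus ?thesis by eventually_elim (auto simp: norm_mult intro!: mult_left_mono bound)
    qed
    show "(\<lambda>z::complex. norm z * B) \<midarrow>0\<rightarrow> 0"
      by (rule tendsto_eq_intros refl | simp)+
  qed
  then obtain g where "g holomorphic_on ball 0 r" "\<forall>z\<in>ball 0 r - {0}. g z = w z"
    using holomorphic_on_extend_lim[OF hol, of ] r by auto
  thus ?thesis using that by blast
qed

lemma holomorphic_factor_zero_nonconstant':
  assumes "f holomorphic_on S" "open S" "connected S" "\<xi> \<in> S" "f \<xi> = 0" "\<not> f constant_on S"
  shows "\<exists>g r. \<exists>n>0. r > 0 \<and> ball \<xi> r \<subseteq> S \<and> g holomorphic_on ball \<xi> r \<and>
      (\<forall>w\<in>ball \<xi> r. f w = (w - \<xi>) ^ n * g w \<and> g w \<noteq> 0)"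
  apply (rule holomorphic_factor_zero_nonconstant[OF assms])
  subgoal for g r n
    by (rule exI[of _ g], rule exI[of _ r], rule exI[of _ n], intro conjI ballI,
        assumption, assumption, assumption, assumption) blast+
  done

text \<open>Leading coefficients at 0: if the extension were z^n g(z) with g(0) \<noteq> 0, then g(q
  z) q^n = h(z) g(z), and z -> 0 would give g(0) q^n = h(0) g(0) = 0.\<close>

lemma qdiff_zero:
  fixes w h :: "complex \<Rightarrow> complex"
  assumes q: "0 < norm q" "norm q < 1" and r: "r > 0"
    and hol: "w holomorphic_on (ball 0 r - {0})"
    and h: "isCont h 0" "h 0 = 0"
    and eq: "\<And>z. z \<in> ball 0 r - {0} \<Longrightarrow> w (q * z) = h z * w z"
    and z: "z \<in> ball 0 r - {0}"
  shows "w z = 0"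
proof -
  have "eventually (\<lambda>x. norm (h x) < 1) (nhds 0)"
  proof -
    have "(\<lambda>x. norm (h x)) \<midarrow>0\<rightarrow> norm (h 0)" using h(1) unfolding isCont_def by (rule tendsto_norm)
    hence "\<forall>\<^sub>F x in nhds 0. x \<noteq> 0 \<longrightarrow> norm (h x) < 1"
      using h(2) by (auto simp: eventually_at_filter dest!: order_tendstoD(2)[of _ _ _ 1])
    thus ?thesis by eventually_elim (use h(2) in auto)
  qed
  then obtain d where d: "d > 0" "\<And>x. norm x < d \<Longrightarrow> norm (h x) < 1"
    by (auto simp: eventually_nhds_metric)
  \<comment> \<open>On the smaller disc |h| < 1, as \<open>qdiff_extends\<close> requires; analytic
    continuation returns to radius r at the end.\<close>
  define r' where "r' = min r d"
  have r': "r' > 0" "r' \<le> r" "r' \<le> d" using r d by (auto simp: r'_def)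
  have hol': "w holomorphic_on (ball 0 r' - {0})"
    by (rule holomorphic_on_subset[OF hol]) (use r' in auto)
  have eq': "w (q * z) = h z * w z" and hb: "norm (h z) \<le> 1" if "z \<in> ball 0 r' - {0}" for z
    using that r' eq[of z] d(2)[of z] by auto
  obtain W where W: "W holomorphic_on ball 0 r'" "\<And>z. z \<in> ball 0 r' - {0} \<Longrightarrow> W z = w z"
    using qdiff_extends[OF q r'(1) hol' hb eq'] by blast
  have in_ball: "q * z \<in> ball 0 r' - {0}" if "z \<in> ball 0 r' - {0}" for z
  proof -
    have "norm (q * z) \<le> 1 * norm z" unfolding norm_mult using q by (intro mult_right_mono) auto
    thus ?thesis using that q by auto
  qed
  have eqW: "W (q * z) = h z * W z" if "z \<in> ball 0 r' - {0}" for z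
    using eq'[OF that] W(2)[OF that] W(2)[OF in_ball[OF that]] by simp
  have ev: "eventually (\<lambda>z. z \<in> ball 0 r' - {0}) (at 0)"
    using r'(1) by (auto simp: eventually_at dist_commute intro!: exI[of _ r'])
  have tq: "filterlim (\<lambda>z. q * z) (at 0) (at 0)"
  proof (rule filterlim_atI)
    show "(\<lambda>z. q * z) \<midarrow>0\<rightarrow> 0" by (rule tendsto_eq_intros refl | simp)+
    show "\<forall>\<^sub>F z in at 0. q * z \<noteq> 0" using q by (auto simp: eventually_at_filter)
  qed
  have h0: "h \<midarrow>0\<rightarrow> 0" using h by (simp add: isCont_def)
  \<comment> \<open>Applied twice: to \<open>W\<close> with n = 0, and to the cofactor
    \<open>g\<close> with n the order of the zero of \<open>W\<close>.\<close>
  have zero: "F 0 = 0"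
    if "isCont F 0" "eventually (\<lambda>z. F (q * z) * q ^ n = h z * F z) (at 0)" for F n
  proof -
    have F: "F \<midarrow>0\<rightarrow> F 0" using that(1) by (simp add: isCont_def)
    have "(\<lambda>z. F (q * z) * q ^ n) \<midarrow>0\<rightarrow> F 0 * q ^ n"
      by (intro tendsto_intros filterlim_compose[OF F tq])
    moreover have "(\<lambda>z. h z * F z) \<midarrow>0\<rightarrow> 0 * F 0" by (intro tendsto_intros F h0)
    hence "(\<lambda>z. F (q * z) * q ^ n) \<midarrow>0\<rightarrow> 0"
      using tendsto_cong[OF that(2)] by simp
    ultimately have "F 0 * q ^ n = 0" using LIM_unique by blast
    thus ?thesis using q by auto
  qed
  have contW: "isCont W 0"
    using W(1) r'(1) by (meson centre_in_ball continuous_on_eq_continuous_at holomorphic_on_imp_continuous_on open_ball)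
  have W0: "W 0 = 0"
    by (rule zero[of _ 0]) (use contW ev eqW in \<open>auto elim: eventually_mono\<close>)
  have "W constant_on ball 0 r'"
  proof (rule ccontr)
    assume "\<not> W constant_on ball 0 r'"
    note nc = this
    have c0: "0 \<in> ball (0::complex) r'" using r'(1) by simp
    show False
      using holomorphic_factor_zero_nonconstant'[OF W(1) open_ball connected_ball c0 W0 nc]
    proof (elim exE, goal_cases)
    case * : (1 g \<rho> n)
    have g: "0 < n" "0 < \<rho>" "ball (0::complex) \<rho> \<subseteq> ball 0 r'" "g holomorphic_on ball 0 \<rho>"
      "\<And>w. w \<in> ball 0 \<rho> \<Longrightarrow> W w = (w - 0) ^ n * g w" "\<And>w. w \<in> ball 0 \<rho> \<Longrightarrow> g w \<noteq> 0"
      using * by simp_all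
    have "isCont g 0"
      using g(2,4) by (meson centre_in_ball continuous_on_eq_continuous_at holomorphic_on_imp_continuous_on open_ball)
    moreover have "eventually (\<lambda>z. z \<in> ball 0 \<rho> - {0}) (at 0)"
      using g(2) by (auto simp: eventually_at dist_commute intro!: exI[of _ \<rho>])
    hence "eventually (\<lambda>z. g (q * z) * q ^ n = h z * g z) (at 0)"
    proof eventually_elim
      case (elim z)
      have "norm (q * z) \<le> 1 * norm z" unfolding norm_mult using q by (intro mult_right_mono) auto
      hence qz: "q * z \<in> ball 0 \<rho>" using elim by auto
      have "W (q * z) = h z * W z" by (rule eqW) (use elim g(3) in auto)
      hence "z ^ n * (g (q * z) * q ^ n) = z ^ n * (h z * g z)"
        using g(5)[of z] g(5)[OF qz] elim by (simp add: power_mult_distrib mult_ac)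
      thus ?case using elim by simp
    qed
    ultimately have "g 0 = 0" by (rule zero)
    thus False using g(2,6) by auto
    qed
  qed
  hence Wz: "W x = 0" if "x \<in> ball 0 r'" for x
    using that W0 r'(1) unfolding constant_on_def by (metis centre_in_ball)
  define x where "x = complex_of_real (r' / 2)"
  have x: "x \<in> ball 0 r' - {0}" using r'(1) by (auto simp: x_def)
  show "w z = 0"
  proof (rule analytic_continuation[OF hol _ _ _ _ _ _ z])
    show "connected (ball 0 r - {0::complex})" by (intro connected_open_delete) auto
    show "x \<in> ball 0 r - {0}" using x r' by auto
    show "x islimpt ball 0 r' - {0}" using x by (intro interior_limit_point) (simp add: interior_open[OF open_delete[OF open_ball]])
    show "w y = 0" if "y \<in> ball 0 r' - {0}" for y using Wz[of y] W(2)[OF that] that by auto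
  qed (use r' in auto)
qed

text \<open>The value is the same at z, q z, q^2 z, ..., a sequence tending to 0, where the solution
  has a holomorphic extension. So every value equals the one at 0.\<close>

lemma qdiff_const:
  fixes w :: "complex \<Rightarrow> complex"
  assumes q: "0 < norm q" "norm q < 1"
    and hol: "w holomorphic_on (-{0})"
    and eq: "\<And>z. z \<noteq> 0 \<Longrightarrow> w (q * z) = w z"
    and z: "z \<noteq> 0" "z' \<noteq> 0"
  shows "w z = w z'"
proof -
  define r where "r = max (norm z) (norm z') + 1"
  have r: "r > 0" unfolding r_def by (intro add_nonneg_pos) (auto simp: le_max_iff_disj)
  obtain W where W: "W holomorphic_on ball 0 r" "\<And>z. z \<in> ball 0 r - {0} \<Longrightarrow> W z = w z"
    by (rule qdiff_extends[OF q r, of w "\<lambda>_. 1"]) (use eq in \<open>auto intro: holomorphic_on_subset[OF hol]\<close>)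
  have "w x = W 0" if x: "x \<in> ball 0 r - {0}" for x
  proof -
    have wn: "w (q ^ n * x) = w x" for n
      using x eq[of "q ^ _ * x"] q by (induction n) (auto simp: mult.assoc)
    have "isCont W 0"
      using W(1) r by (meson centre_in_ball continuous_on_eq_continuous_at holomorphic_on_imp_continuous_on open_ball)
    moreover have "(\<lambda>n. q ^ n * x) \<longlonglongrightarrow> 0"
      using q by (intro tendsto_mult_left_zero LIMSEQ_power_zero)
    ultimately have "(\<lambda>n. W (q ^ n * x)) \<longlonglongrightarrow> W 0" by (rule isCont_tendsto_compose)
    moreover have "W (q ^ n * x) = w x" for n
    proof -
      have "norm (q ^ n * x) \<le> 1 * norm x" unfolding norm_mult norm_power
        by (intro mult_right_mono) (use q in \<open>auto simp: power_le_one\<close>)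
      hence "q ^ n * x \<in> ball 0 r - {0}" using x q by auto
      thus ?thesis using W(2) wn by simp
    qed
    ultimately show ?thesis by (simp add: LIMSEQ_const_iff)
  qed
  thus ?thesis using z by (simp add: r_def)
qed

section \<open>Meromorphic solutions with poles on finitely many orbits\<close>

definition orbits :: "complex \<Rightarrow> complex set \<Rightarrow> complex set" where
  "orbits q S = {s * q powi k |s k. s \<in> S}"

text \<open>Exhibits an orbit as the zero set of a holomorphic function; this yields its sparseness
  and lets pole sets be tested through \<open>th\<close>.\<close>

lemma orbits_iff_th:
  assumes "norm q < 1" "q \<noteq> 0" "z \<noteq> 0" "0 \<notin> S"
  shows "z \<in> orbits q S \<longleftrightarrow> (\<exists>s\<in>S. th q (z / s) = 0)"
proof -
  have "th q (z / s) = 0 \<longleftrightarrow> (\<exists>k. z = s * q powi k)" if "s \<in> S" for s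
  proof -
    have "s \<noteq> 0" using that assms by auto
    hence "z / s = q powi k \<longleftrightarrow> z = s * q powi k" for k by (simp add: field_simps)
    thus ?thesis using th_eq_0_iff[of q "z/s"] assms \<open>s \<noteq> 0\<close> by simp
  qed
  thus ?thesis by (auto simp: orbits_def)
qed

lemma orbits_sparse:
  assumes "norm q < 1" "q \<noteq> 0" "finite S" "0 \<notin> S" "z \<noteq> 0"
  shows "eventually (\<lambda>x. x \<notin> orbits q S) (at z)"
proof -
  have "eventually (\<lambda>x. \<forall>s\<in>S. th q (x / s) \<noteq> 0) (at z)"
  proof (intro eventually_ball_finite assms ballI)
    fix s assume s: "s \<in> S"
    hence "s \<noteq> 0" using assms by auto
    have "filterlim (\<lambda>x. x / s) (at (z / s)) (at z)"
    proof (rule filterlim_atI)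
      show "(\<lambda>x. x / s) \<midarrow>z\<rightarrow> z / s" using \<open>s \<noteq> 0\<close> by (intro tendsto_intros)
      show "\<forall>\<^sub>F x in at z. x / s \<noteq> z / s" using \<open>s \<noteq> 0\<close> by (auto simp: eventually_at_filter)
    qed
    thus "eventually (\<lambda>x. th q (x / s) \<noteq> 0) (at z)"
      using th_ev_nonzero[OF assms(1,2), of "z/s"] assms(5) \<open>s \<noteq> 0\<close> by (auto simp: filterlim_iff)
  qed
  moreover have "eventually (\<lambda>x. x \<noteq> 0) (at z)" 
    by (simp add: eventually_neq_at_within)
  ultimately show ?thesis by eventually_elim (use orbits_iff_th[OF assms(1,2) _ assms(4)] in blast)
qed

lemma orbits_mult_q_iff:
  assumes "q \<noteq> 0"
  shows "q * z \<in> orbits q S \<longleftrightarrow> z \<in> orbits q S"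
proof -
  have 1: "q * z = s * q powi k \<longleftrightarrow> z = s * q powi (k - 1)" for s k
  proof -
    have "q powi k = q * q powi (k - 1)" using assms by (metis diff_add_cancel power_int_add_1')
    hence "q * z = s * q powi k \<longleftrightarrow> q * z = q * (s * q powi (k - 1))" by (simp add: mult_ac)
    thus ?thesis using assms by simp
  qed
  have 2: "z = s * q powi k \<longleftrightarrow> q * z = s * q powi (k + 1)" for s k using 1[of s "k + 1"] by simp
  show ?thesis
  proof
    assume "q * z \<in> orbits q S"
    thus "z \<in> orbits q S" unfolding orbits_def using 1 by blast
  next
    assume "z \<in> orbits q S"
    then obtain s k where "s \<in> S" "z = s * q powi k" unfolding orbits_def by blast
    thus "q * z \<in> orbits q S" unfolding orbits_def using 2 by blast
  qed
qed

text \<open>The functional equation carries a finite limit from z to q z (\<open>up\<close>) and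
  back (\<open>down\<close>), so regularity has to be checked at one representative of each orbit
  only.\<close>

lemma qdiff_lim_orbit:
  assumes q: "norm q < 1" "q \<noteq> 0" and S: "finite S" "0 \<notin> S"
    and c: "c \<noteq> 0"
    and eq: "\<And>z. z \<noteq> 0 \<Longrightarrow> z \<notin> orbits q S \<Longrightarrow> w (q * z) = c * z ^ m * w z"
    and lim: "\<And>s. s \<in> S \<Longrightarrow> \<exists>l. w \<midarrow>s\<rightarrow> l"
    and e: "e \<in> orbits q S"
  shows "\<exists>l. w \<midarrow>e\<rightarrow> l"
proof -
  obtain s k where sk: "s \<in> S" "e = s * q powi k" using e by (auto simp: orbits_def)
  have s0: "s \<noteq> 0" using sk S by auto
  have tr: "filterlim (\<lambda>z. a * z) (at (a * z)) (at z)" if "a \<noteq> 0" for a z :: complex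
  proof (rule filterlim_atI)
    show "(\<lambda>x. a * x) \<midarrow>z\<rightarrow> a * z" by (intro tendsto_intros)
    show "\<forall>\<^sub>F x in at z. a * x \<noteq> a * z" using that by (auto simp: eventually_at_filter)
  qed
  have ev: "eventually (\<lambda>x. w (q * x) = c * x ^ m * w x \<and> x \<noteq> 0) (at z)" if "z \<noteq> 0" for z
  proof -
    have "eventually (\<lambda>x. x \<noteq> 0) (at z)" using that by (simp add: eventually_neq_at_within)
    with orbits_sparse[OF q S that] show ?thesis by eventually_elim (use eq in auto)
  qed
  have up: "\<exists>l. w \<midarrow>q * z\<rightarrow> l" if "w \<midarrow>z\<rightarrow> l" "z \<noteq> 0" for z l
  proof -
    have "(\<lambda>x. c * x ^ m * w x) \<midarrow>z\<rightarrow> c * z ^ m * l" by (intro tendsto_intros that)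
    hence "(\<lambda>x. w (q * x)) \<midarrow>z\<rightarrow> c * z ^ m * l"
      by (rule Lim_transform_eventually) (use ev[OF that(2)] in \<open>auto elim: eventually_mono\<close>)
    moreover have "filterlim (\<lambda>x. 1 / q * x) (at z) (at (q * z))"
      using tr[of "1 / q" "q * z"] q(2) by simp
    ultimately have "(\<lambda>x. w (q * (1 / q * x))) \<midarrow>q * z\<rightarrow> c * z ^ m * l"
      by (rule filterlim_compose)
    moreover have "q * (1 / q * x) = x" for x using q(2) by simp
    ultimately show ?thesis by auto
  qed
  have down: "\<exists>l. w \<midarrow>z\<rightarrow> l" if "w \<midarrow>q * z\<rightarrow> l" "z \<noteq> 0" for z l
  proof -
    have "(\<lambda>x. w (q * x)) \<midarrow>z\<rightarrow> l" using filterlim_compose[OF that(1) tr[of q z]] q(2) by simp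
    hence "(\<lambda>x. w (q * x) / (c * x ^ m)) \<midarrow>z\<rightarrow> l / (c * z ^ m)"
      using c that(2) by (intro tendsto_intros) auto
    moreover have "eventually (\<lambda>x. w (q * x) / (c * x ^ m) = w x) (at z)"
      using ev[OF that(2)] by eventually_elim (use c in auto)
    ultimately show ?thesis by (intro exI) (rule Lim_transform_eventually)
  qed
  have "\<exists>l. w \<midarrow>s * q powi k\<rightarrow> l"
  proof (induction k rule: int_induct[of _ 0])
    case base thus ?case using lim sk by simp
  next
    case (step1 i)
    then obtain l where "w \<midarrow>s * q powi i\<rightarrow> l" by auto
    from up[OF this] show ?case using s0 q(2) by (simp add: power_int_add mult_ac)
  next
    case (step2 i)
    then obtain l where "w \<midarrow>s * q powi i\<rightarrow> l" by auto
    moreover have "s * q powi i = q * (s * q powi (i - 1))" using q(2) by (simp add: power_int_diff)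
    ultimately show ?case using s0 q(2) by (auto intro!: down)
  qed
  thus ?thesis using sk by simp
qed

lemma qdiff_remove_poles:
  assumes q: "norm q < 1" "q \<noteq> 0" and S: "finite S" "0 \<notin> S" and c: "c \<noteq> 0"
    and hol: "w holomorphic_on (- {0} - orbits q S)"
    and eq: "\<And>z. z \<noteq> 0 \<Longrightarrow> z \<notin> orbits q S \<Longrightarrow> w (q * z) = c * z ^ m * w z"
    and lim: "\<And>s. s \<in> S \<Longrightarrow> \<exists>l. w \<midarrow>s\<rightarrow> l"
  obtains G where "G holomorphic_on (-{0})" "\<And>z. z \<in> - {0} - orbits q S \<Longrightarrow> G z = w z"
    "\<And>z. z \<noteq> 0 \<Longrightarrow> G (q * z) = c * z ^ m * G z"
proof -
  obtain G where G: "G holomorphic_on (-{0})" "\<And>z. z \<in> - {0} - orbits q S \<Longrightarrow> G z = w z"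
  proof (rule removable_discrete[OF _ hol])
    show "\<exists>l. w \<midarrow>e\<rightarrow> l" if "e \<in> -{0} \<inter> orbits q S" for e
      by (rule qdiff_lim_orbit[OF q S c eq lim]) (use that in auto)
  qed (auto intro: orbits_sparse[OF q S])
  have eqG: "G (q * x) = c * x ^ m * G x" if x: "x \<noteq> 0" for x
  proof -
    have cont: "isCont G y" if "y \<noteq> 0" for y
      using holomorphic_on_imp_continuous_on[OF G(1)] that by (simp add: continuous_on_eq_continuous_at open_Compl)
    have "isCont (\<lambda>x. G (q * x) - c * x ^ m * G x) x"
      using x q by (intro continuous_intros cont isCont_o2[OF _ cont]) auto
    hence "(\<lambda>x. G (q * x) - c * x ^ m * G x) \<midarrow>x\<rightarrow> G (q * x) - c * x ^ m * G x" by (simp add: isCont_def)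
    moreover have "eventually (\<lambda>x. x \<noteq> 0) (at x)" using x by (simp add: eventually_neq_at_within)
    with orbits_sparse[OF q S x] have "eventually (\<lambda>x. G (q * x) - c * x ^ m * G x = 0) (at x)"
      by eventually_elim (use q eq in \<open>simp add: G orbits_mult_q_iff\<close>)
    hence "(\<lambda>x. G (q * x) - c * x ^ m * G x) \<midarrow>x\<rightarrow> 0" by (simp add: tendsto_eventually)
    ultimately show ?thesis using LIM_unique by fastforce
  qed
  show ?thesis using that[OF G eqG] .
qed

text \<open>Once the poles are removed, m > 0 makes the multiplier c z^m vanish at the origin, so
  \<open>qdiff_zero\<close> applies on a disc of any radius.\<close>

lemma qdiff_meromorphic_zero:
  assumes q: "norm q < 1" "q \<noteq> 0" and S: "finite S" "0 \<notin> S" and c: "c \<noteq> 0" and m: "m > 0"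
    and hol: "w holomorphic_on (- {0} - orbits q S)"
    and eq: "\<And>z. z \<noteq> 0 \<Longrightarrow> z \<notin> orbits q S \<Longrightarrow> w (q * z) = c * z ^ m * w z"
    and lim: "\<And>s. s \<in> S \<Longrightarrow> \<exists>l. w \<midarrow>s\<rightarrow> l"
    and z: "z \<noteq> 0" "z \<notin> orbits q S"
  shows "w z = 0"
proof -
  obtain G where G: "G holomorphic_on (-{0})" "\<And>z. z \<in> - {0} - orbits q S \<Longrightarrow> G z = w z"
    "\<And>z. z \<noteq> 0 \<Longrightarrow> G (q * z) = c * z ^ m * G z"
    using qdiff_remove_poles[OF q S c hol eq lim] by blast
  have "G z = 0"
  proof (rule qdiff_zero[of q "norm z + 1" G "\<lambda>z. c * z ^ m"])
    show "G holomorphic_on ball 0 (norm z + 1) - {0}" by (rule holomorphic_on_subset[OF G(1)]) auto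
  qed (use q z m G(3) in \<open>auto intro!: continuous_intros add_nonneg_pos\<close>)
  thus ?thesis using G(2) z by auto
qed

text \<open>The analogue of Liouville's theorem for elliptic functions, in multiplicative
  form.\<close>

lemma qdiff_meromorphic_const:
  assumes q: "norm q < 1" "q \<noteq> 0" and S: "finite S" "0 \<notin> S"
    and hol: "w holomorphic_on (- {0} - orbits q S)"
    and eq: "\<And>z. z \<noteq> 0 \<Longrightarrow> z \<notin> orbits q S \<Longrightarrow> w (q * z) = w z"
    and lim: "\<And>s. s \<in> S \<Longrightarrow> \<exists>l. w \<midarrow>s\<rightarrow> l"
    and z: "z \<noteq> 0" "z \<notin> orbits q S" "z' \<noteq> 0" "z' \<notin> orbits q S"
  shows "w z = w z'"
proof -
  have eq': "w (q * z) = 1 * z ^ 0 * w z" if "z \<noteq> 0" "z \<notin> orbits q S" for z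
    using eq[OF that] by simp
  obtain G where G: "G holomorphic_on (-{0})" "\<And>z. z \<in> - {0} - orbits q S \<Longrightarrow> G z = w z"
    "\<And>z. z \<noteq> 0 \<Longrightarrow> G (q * z) = 1 * z ^ 0 * G z"
    by (rule qdiff_remove_poles[OF q S one_neq_zero hol eq' lim]) blast+
  have "G z = G z'"
    by (rule qdiff_const[OF _ q(1) G(1)]) (use q z G(3) in simp_all)
  thus ?thesis using G(2) z by auto
qed

section \<open>The logarithmic derivative of the theta function\<close>

text \<open>This is \<open>th q z / (1 - z)\<close>, the theta function with its zero at z = 1
  divided out; residues at 1 are expressed through its value there, (q; q)^2.\<close>

definition ths :: "complex \<Rightarrow> complex \<Rightarrow> complex" where
  "ths q z = qp (q * z) q * qp (q / z) q"

lemma th_eq_ths: "norm q < 1 \<Longrightarrow> th q z = (1 - z) * ths q z"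
  using qp_rec[of q z] by (simp add: th_def ths_def mult_ac)

lemma holomorphic_ths:
  assumes "norm q < 1" "0 \<notin> A"
  shows "ths q holomorphic_on A"
proof -
  have 1: "((\<lambda>a. qp a q) \<circ> (\<lambda>z. q / z)) holomorphic_on A"
    by (rule holomorphic_on_compose_gen[OF _ holomorphic_qp[of _ UNIV]])
       (use assms in \<open>auto intro!: holomorphic_intros\<close>)
  have 2: "((\<lambda>a. qp a q) \<circ> (\<lambda>z. q * z)) holomorphic_on A"
    by (rule holomorphic_on_compose_gen[OF _ holomorphic_qp[of _ UNIV]])
       (use assms in \<open>auto intro!: holomorphic_intros\<close>)
  show ?thesis unfolding ths_def[abs_def]
    using holomorphic_on_mult[OF 2 1] by (simp add: o_def)
qed

lemma ths_1: "ths q 1 = (qp q q)\<^sup>2"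
  by (simp add: ths_def power2_eq_square)

lemma qp_q_q_nonzero: "norm q < 1 \<Longrightarrow> qp q q \<noteq> 0"
proof
  assume q: "norm q < 1" and "qp q q = 0"
  then obtain k where "q * q ^ k = 1" using qp_eq_0_iff by blast
  hence "norm q ^ Suc k = 1" by (metis norm_one norm_power power_Suc)
  moreover have "norm q ^ Suc k < 1" using q by (simp add: power_less_one_iff del: power_Suc)
  ultimately show False by simp
qed

lemma th_field_differentiable:
  assumes "norm q < 1" "z \<noteq> 0"
  shows "th q field_differentiable (at z)" "ths q field_differentiable (at z)"
  by (rule holomorphic_on_imp_differentiable_at[of _ "-{0}"];
      use assms in \<open>auto intro: holomorphic_th holomorphic_ths\<close>)+

lemma th_DERIV:
  assumes "norm q < 1" "z \<noteq> 0"
  shows "(th q has_field_derivative deriv (th q) z) (at z)"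
        "(ths q has_field_derivative deriv (ths q) z) (at z)"
  using th_field_differentiable[OF assms] DERIV_deriv_iff_field_differentiable by blast+

definition LL :: "complex \<Rightarrow> complex \<Rightarrow> complex" where
  "LL q z = z * deriv (th q) z / th q z"

lemma LL_th: 
  assumes "norm q < 1" "z \<noteq> 0" "th q z \<noteq> 0"
  shows "(th q has_field_derivative LL q z * th q z / z) (at z)"
  using th_DERIV(1)[OF assms(1,2)] assms by (simp add: LL_def)

lemma LL_th_chain:
  assumes "norm q < 1" "g z \<noteq> 0" "th q (g z) \<noteq> 0" "(g has_field_derivative D) (at z)"
  shows "((\<lambda>z. th q (g z)) has_field_derivative LL q (g z) * th q (g z) / g z * D) (at z)"
  by (rule DERIV_chain2[OF LL_th assms(4)]) (use assms in auto)

lemma LL_unique: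
  assumes "norm q < 1" "z \<noteq> 0" "th q z \<noteq> 0" "(th q has_field_derivative D * th q z / z) (at z)"
  shows "LL q z = D"
  using DERIV_unique[OF LL_th[OF assms(1-3)] assms(4)] assms by simp

lemma LL_mult_q:
  assumes q: "norm q < 1" "q \<noteq> 0" and z: "z \<noteq> 0" "th q z \<noteq> 0"
  shows "LL q (q * z) = LL q z - 1"
proof -
  have nz: "th q (q * z) \<noteq> 0" using th_mult_q[OF q z(1)] z by simp
  have "((\<lambda>w. - th q (w / q) / (w / q)) has_field_derivative
      (LL q z - 1) * th q (q * z) / (q * z)) (at (q * z))"
    using q z
    by (auto intro!: derivative_eq_intros LL_th_chain[OF q(1)] simp: th_mult_q field_simps)
  moreover have "eventually (\<lambda>w. w \<noteq> 0) (nhds (q * z))"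
    using q z by (intro t1_space_nhds) auto
  hence "eventually (\<lambda>w. - th q (w / q) / (w / q) = th q w) (nhds (q * z))"
  proof eventually_elim
    case (elim w)
    thus ?case using th_mult_q[OF q, of "w / q"] q by simp
  qed
  ultimately have "(th q has_field_derivative (LL q z - 1) * th q (q * z) / (q * z)) (at (q * z))"
    by (subst (asm) DERIV_cong_ev[OF refl _ refl])
  thus ?thesis by (intro LL_unique) (use q z nz in auto)
qed

lemma LL_inverse:
  assumes q: "norm q < 1" "q \<noteq> 0" and z: "z \<noteq> 0" "th q z \<noteq> 0"
  shows "LL q (1 / z) = 1 - LL q z"
proof -
  have nz: "th q (1 / z) \<noteq> 0" using th_inverse[OF q z(1)] z by simp
  have "((\<lambda>w. - w * th q (1 / w)) has_field_derivative
      (1 - LL q z) * th q (1 / z) / (1 / z)) (at (1 / z))"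
    using q z
    by (auto intro!: derivative_eq_intros LL_th_chain[OF q(1)]
          simp: th_inverse field_simps power2_eq_square)
  moreover have "eventually (\<lambda>w. w \<noteq> 0) (nhds (1 / z))"
    using q z by (intro t1_space_nhds) auto
  hence "eventually (\<lambda>w. - w * th q (1 / w) = th q w) (nhds (1 / z))"
  proof eventually_elim
    case (elim w)
    thus ?case using th_inverse[OF q, of w] by simp
  qed
  ultimately have "(th q has_field_derivative (1 - LL q z) * th q (1 / z) / (1 / z)) (at (1 / z))"
    by (subst (asm) DERIV_cong_ev[OF refl _ refl])
  thus ?thesis by (intro LL_unique) (use q z nz in auto)
qed

lemma LL_split2:
  assumes q: "norm q < 1" "q \<noteq> 0" and z: "z \<noteq> 0" "th q z \<noteq> 0"
  shows "LL q z = LL (q\<^sup>2) z + LL (q\<^sup>2) (q * z)"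
proof -
  have q2: "norm (q\<^sup>2) < 1" using q by (simp add: norm_power power_less_one_iff)
  have nz: "th (q\<^sup>2) z \<noteq> 0" "th (q\<^sup>2) (q * z) \<noteq> 0" using th_split2[OF q z(1)] z by auto
  have "((\<lambda>w. th (q\<^sup>2) w * th (q\<^sup>2) (q * w)) has_field_derivative
      (LL (q\<^sup>2) z + LL (q\<^sup>2) (q * z)) * th q z / z) (at z)"
    using q z nz th_split2[OF q z(1)]
    by (auto intro!: derivative_eq_intros LL_th_chain[OF q2]
          simp: field_simps)
  moreover have "eventually (\<lambda>w. w \<noteq> 0) (nhds z)"
    using q z by (intro t1_space_nhds) auto
  hence "eventually (\<lambda>w. th (q\<^sup>2) w * th (q\<^sup>2) (q * w) = th q w) (nhds z)"
    by eventually_elim (use th_split2[OF q] in auto)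
  ultimately have "(th q has_field_derivative (LL (q\<^sup>2) z + LL (q\<^sup>2) (q * z)) * th q z / z) (at z)"
    by (subst (asm) DERIV_cong_ev[OF refl _ refl])
  thus ?thesis by (intro LL_unique) (use q z in auto)
qed

lemma LL_minus:
  assumes q: "norm q < 1" "q \<noteq> 0" and z: "z \<noteq> 0" "th q z \<noteq> 0" "th q (- z) \<noteq> 0"
  shows "LL q z + LL q (- z) = 2 * LL (q\<^sup>2) (z\<^sup>2)"
proof -
  have q2: "norm (q\<^sup>2) < 1" using q by (simp add: norm_power power_less_one_iff)
  have nz: "th (q\<^sup>2) (z\<^sup>2) \<noteq> 0" using th_mult_minus[OF q(1), of z] z by auto
  have "((\<lambda>w. th q w * th q (- w)) has_field_derivative
      (LL q z + LL q (- z)) * th (q\<^sup>2) (z\<^sup>2) / z) (at z)"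
    using q z unfolding th_mult_minus[OF q(1), symmetric]
    by (auto intro!: derivative_eq_intros LL_th_chain[OF q(1)] simp: field_simps)
  moreover have "((\<lambda>w. th (q\<^sup>2) (w\<^sup>2)) has_field_derivative
      LL (q\<^sup>2) (z\<^sup>2) * th (q\<^sup>2) (z\<^sup>2) / z\<^sup>2 * (2 * z)) (at z)"
    by (rule LL_th_chain[OF q2]) (use z nz in \<open>auto intro!: derivative_eq_intros\<close>)
  moreover have "LL (q\<^sup>2) (z\<^sup>2) * th (q\<^sup>2) (z\<^sup>2) / z\<^sup>2 * (2 * z) =
      (2 * LL (q\<^sup>2) (z\<^sup>2)) * th (q\<^sup>2) (z\<^sup>2) / z"
    using z by (simp add: power2_eq_square)
  ultimately have "(LL q z + LL q (- z)) * th (q\<^sup>2) (z\<^sup>2) / z = (2 * LL (q\<^sup>2) (z\<^sup>2)) * th (q\<^sup>2) (z\<^sup>2) / z"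
    unfolding th_mult_minus[OF q(1)] using DERIV_unique by metis
  thus ?thesis using z nz by simp
qed

lemma lim_divide_zero:
  fixes F :: "complex \<Rightarrow> complex"
  assumes "F field_differentiable (at s)" "F s = 0"
  shows "\<exists>l. (\<lambda>z. F z / (z - s)) \<midarrow>s\<rightarrow> l"
  using assms by (auto simp: field_differentiable_def has_field_derivative_iff)

lemma LL_near_1:
  assumes q: "norm q < 1" "q \<noteq> 0"
  shows "eventually (\<lambda>x. LL q x = x / (x - 1) + x * deriv (ths q) x / ths q x) (at 1)"
proof -
  have "eventually (\<lambda>x. x \<noteq> 0) (at (1::complex))" "eventually (\<lambda>x. x \<noteq> 1) (at (1::complex))"
    by (simp_all add: eventually_neq_at_within)
  moreover have "eventually (\<lambda>x. th q x \<noteq> 0) (at 1)" by (rule th_ev_nonzero[OF q]) simp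
  ultimately show ?thesis
  proof eventually_elim
    case (elim x)
    have nz: "ths q x \<noteq> 0" using elim th_eq_ths[OF q(1), of x] by auto
    have "((\<lambda>w. (1 - w) * ths q w) has_field_derivative (1 - x) * deriv (ths q) x - ths q x) (at x)"
      using elim by (auto intro!: derivative_eq_intros th_DERIV(2) q)
    hence "(th q has_field_derivative (1 - x) * deriv (ths q) x - ths q x) (at x)"
      by (simp flip: th_eq_ths[OF q(1)])
    hence "deriv (th q) x = (1 - x) * deriv (ths q) x - ths q x" by (rule DERIV_imp_deriv)
    thus ?case using elim nz by (simp add: LL_def th_eq_ths[OF q(1)] divide_simps) (simp add: algebra_simps)
  qed
qed

text \<open>Differentiating th = (1 - x) ths logarithmically isolates the principal part x / (x -
  1); the remaining term is continuous because \<open>ths q 1\<close> is nonzero.\<close>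

lemma LL_pole_1:
  assumes q: "norm q < 1" "q \<noteq> 0"
  shows "\<exists>l. (\<lambda>x. LL q x - x / (x - 1)) \<midarrow>1\<rightarrow> l"
proof -
  have hol: "deriv (ths q) holomorphic_on (-{0})" by (intro holomorphic_deriv holomorphic_ths q) auto
  have "isCont (deriv (ths q)) 1" "isCont (ths q) 1"
    using hol holomorphic_ths[OF q(1), of "-{0}"]
    by (auto simp: continuous_on_eq_continuous_at open_Compl dest!: holomorphic_on_imp_continuous_on)
  hence "(\<lambda>x. x * deriv (ths q) x / ths q x) \<midarrow>1\<rightarrow> 1 * deriv (ths q) 1 / ths q 1"
    using qp_q_q_nonzero[OF q(1)] by (intro tendsto_intros) (auto simp: isCont_def ths_1)
  moreover have "eventually (\<lambda>x. x * deriv (ths q) x / ths q x = LL q x - x / (x - 1)) (at 1)"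
    using LL_near_1[OF q] by eventually_elim simp
  ultimately show ?thesis by (intro exI) (rule Lim_transform_eventually)
qed

lemma holomorphic_LL:
  assumes q: "norm q < 1" "0 \<notin> A" "\<And>x. x \<in> A \<Longrightarrow> th q x \<noteq> 0"
  shows "LL q holomorphic_on A"
proof -
  have "deriv (th q) holomorphic_on (-{0})" by (intro holomorphic_deriv holomorphic_th q) auto
  hence "deriv (th q) holomorphic_on A" by (rule holomorphic_on_subset) (use q in auto)
  thus ?thesis unfolding LL_def[abs_def]
    by (intro holomorphic_on_divide holomorphic_on_mult holomorphic_on_ident holomorphic_th q)
qed

lemma th_1: "norm q < 1 \<Longrightarrow> th q 1 = 0"
  by (simp add: th_eq_ths)

lemma th_mult_field_differentiable:
  assumes "norm q < 1" "a \<noteq> 0" "z \<noteq> 0"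
  shows "(\<lambda>z. th q (a * z)) field_differentiable (at z)" "(\<lambda>z. ths q (a * z)) field_differentiable (at z)"
proof -
  have az: "(\<lambda>z. a * z) field_differentiable (at z)" by (intro derivative_intros)
  have "th q field_differentiable (at (a * z))" "ths q field_differentiable (at (a * z))"
    using assms by (auto intro: th_field_differentiable)
  thus "(\<lambda>z. th q (a * z)) field_differentiable (at z)" "(\<lambda>z. ths q (a * z)) field_differentiable (at z)"
    using field_differentiable_compose[OF az] unfolding o_def by blast+
qed

lemma holomorphic_on_mult_arg:
  assumes "f holomorphic_on B" "(\<lambda>z. a * z) ` A \<subseteq> B"
  shows "(\<lambda>z. f (a * z)) holomorphic_on A"
proof -
  have "f \<circ> (\<lambda>z. a * z) holomorphic_on A"
    by (rule holomorphic_on_compose_gen[OF _ assms]) (intro holomorphic_intros)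
  thus ?thesis by (simp add: o_def)
qed

lemma holomorphic_th_mult:
  assumes "norm q < 1" "a \<noteq> 0" "0 \<notin> A"
  shows "(\<lambda>z. th q (a * z)) holomorphic_on A"
proof (rule holomorphic_on_mult_arg)
  show "th q holomorphic_on (-{0})" by (rule holomorphic_th) (use assms in auto)
qed (use assms in auto)

lemma isCont_LL:
  assumes q: "norm q < 1" and z: "z \<noteq> 0" "th q z \<noteq> 0"
  shows "isCont (LL q) z"
proof -
  have op: "open ((-{0}) \<inter> th q -` (-{0}))"
    by (rule continuous_open_preimage) (use q in \<open>auto intro!: holomorphic_on_imp_continuous_on holomorphic_th\<close>)
  moreover have "continuous_on ((-{0}) \<inter> th q -` (-{0})) (LL q)"
    by (intro holomorphic_on_imp_continuous_on holomorphic_LL) (use q in auto)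
  ultimately have "\<forall>z\<in>(-{0}) \<inter> th q -` (-{0}). isCont (LL q) z"
    using continuous_on_eq_continuous_at[OF op] by blast
  thus ?thesis using z by simp
qed

text \<open>Take the difference of the two sides as a function of c. It is q-periodic, since the
  shifts by -1 of \<open>LL q c\<close> and \<open>LL q (a * b * c)\<close> cancel; its simple poles
  at c = 1 and c = 1 / (a b) are removable; so it is constant. At c = 1 / a it vanishes by the
  inversion formula and \<open>th q 1 = 0\<close>.\<close>

theorem LL_four_term:
  assumes q: "norm q < 1" "q \<noteq> 0" and nz: "a \<noteq> 0" "b \<noteq> 0" "c \<noteq> 0"
    and th: "th q a \<noteq> 0" "th q b \<noteq> 0" "th q (a * b) \<noteq> 0" "th q c \<noteq> 0" "th q (a * b * c) \<noteq> 0"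
  shows "1 - LL q a - LL q b - LL q c + LL q (a * b * c) =
    (qp q q)\<^sup>2 * th q (a * b) * th q (b * c) * th q (a * c) / (th q a * th q b * th q c * th q (a * b * c))"
proof -
  define K where "K = (qp q q)\<^sup>2 * th q (a * b) / (th q a * th q b)"
  define w where "w = (\<lambda>c. 1 - LL q a - LL q b - LL q c + LL q (a * b * c)
      - K * th q (b * c) * th q (a * c) / (th q c * th q (a * b * c)))"
  define S where "S = {1, 1 / (a * b)}"
  have S: "finite S" "0 \<notin> S" using nz by (auto simp: S_def)
  have orb: "z \<in> orbits q S \<longleftrightarrow> th q z = 0 \<or> th q (a * b * z) = 0" if "z \<noteq> 0" for z
    using orbits_iff_th[OF q that S(2)] by (simp add: S_def mult_ac)
  have nzA: "x \<noteq> 0 \<and> th q x \<noteq> 0 \<and> th q (a * b * x) \<noteq> 0" if "x \<in> - {0} - orbits q S" for x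
    using that orb[of x] by simp
  have J: "qp q q \<noteq> 0" by (rule qp_q_q_nonzero[OF q(1)])
  have "w c = w (1 / a)"
  proof (rule qdiff_meromorphic_const[OF q S, of w])
    have LLc: "LL q holomorphic_on (- {0} - orbits q S)"
      by (rule holomorphic_LL) (use q orb in auto)
    have LLabc: "(\<lambda>c. LL q (a * b * c)) holomorphic_on (- {0} - orbits q S)"
    proof (rule holomorphic_on_mult_arg)
      show "LL q holomorphic_on {x. x \<noteq> 0 \<and> th q x \<noteq> 0}" by (rule holomorphic_LL) (use q in auto)
      show "(\<lambda>z. a * b * z) ` (- {0} - orbits q S) \<subseteq> {x. x \<noteq> 0 \<and> th q x \<noteq> 0}"
        using nzA nz by (intro image_subsetI CollectI) simp
    qed
    show "w holomorphic_on (- {0} - orbits q S)" unfolding w_def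
      by (intro holomorphic_on_diff holomorphic_on_add holomorphic_on_mult holomorphic_on_divide holomorphic_on_const
          LLc LLabc holomorphic_th holomorphic_th_mult q) (simp_all add: nzA nz)
    show "w (q * z) = w z" if z: "z \<noteq> 0" "z \<notin> orbits q S" for z
    proof -
      have nzz: "th q z \<noteq> 0" "th q (a * b * z) \<noteq> 0" using orb z by auto
      have "LL q (q * (a * b * z)) = LL q (a * b * z) - 1" "LL q (q * z) = LL q z - 1"
        using LL_mult_q[OF q] nzz nz z by auto
      moreover have t: "th q (q * (a * b * z)) = - th q (a * b * z) / (a * b * z)"
          "th q (q * z) = - th q z / z" "th q (q * (b * z)) = - th q (b * z) / (b * z)"
          "th q (q * (a * z)) = - th q (a * z) / (a * z)"
        by (rule th_mult_q[OF q]; use nz z in simp)+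
      have "K * B * A / (C * D) = K * (- B / (b * z)) * (- A / (a * z)) / ((- C / z) * (- D / (a * b * z)))"
        if "C \<noteq> 0" "D \<noteq> 0" for A B C D :: complex
        using that nz z by (simp add: divide_simps)
      from this[OF nzz, of "th q (b * z)" "th q (a * z)"]
      have "K * th q (b * z) * th q (a * z) / (th q z * th q (a * b * z)) =
          K * th q (q * (b * z)) * th q (q * (a * z)) / (th q (q * z) * th q (q * (a * b * z)))"
        unfolding t .
      moreover have m: "a * b * (q * z) = q * (a * b * z)" "b * (q * z) = q * (b * z)" "a * (q * z) = q * (a * z)"
        by (simp_all add: mult_ac)
      ultimately show ?thesis unfolding w_def m by simp
    qed
    show "\<exists>l. w \<midarrow>s\<rightarrow> l" if "s \<in> S" for s
    proof -
      consider "s = 1" | "s = 1 / (a * b)" using \<open>s \<in> S\<close> by (auto simp: S_def)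
      thus ?thesis
      proof cases
        case 1
        \<comment> \<open>F / (x - 1) collects the polar parts of \<open>LL q x\<close> and of the
          theta quotient; F 1 = 0 says that the residues agree.\<close>
        define F where "F = (\<lambda>x. x - K * th q (b * x) * th q (a * x) / (ths q x * th q (a * b * x)))"
        have "F field_differentiable (at 1)" unfolding F_def
          using nz th J q
          by (intro derivative_intros th_mult_field_differentiable th_field_differentiable) (auto simp: ths_1)
        moreover have "F 1 = 0" using th J by (simp add: F_def K_def ths_1 field_simps)
        ultimately obtain l1 where l1: "(\<lambda>x. F x / (x - 1)) \<midarrow>1\<rightarrow> l1" using lim_divide_zero by blast
        obtain l2 where l2: "(\<lambda>x. LL q x - x / (x - 1)) \<midarrow>1\<rightarrow> l2" using LL_pole_1[OF q] by blast
        have "isCont (\<lambda>x. LL q (a * b * x)) 1"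
          by (rule isCont_o2[of _ _ "LL q"]) (use nz th q in \<open>auto intro!: isCont_LL continuous_intros\<close>)
        hence "(\<lambda>x. LL q (a * b * x)) \<midarrow>1\<rightarrow> LL q (a * b * 1)" by (simp add: isCont_def)
        hence "(\<lambda>x. 1 - LL q a - LL q b + LL q (a * b * x) - (LL q x - x / (x - 1)) - F x / (x - 1))
            \<midarrow>1\<rightarrow> 1 - LL q a - LL q b + LL q (a * b * 1) - l2 - l1"
          by (intro tendsto_intros l1 l2)
        moreover have "eventually (\<lambda>x. x \<noteq> 1) (at (1::complex))" by (simp add: eventually_neq_at_within)
        hence "eventually (\<lambda>x. 1 - LL q a - LL q b + LL q (a * b * x) - (LL q x - x / (x - 1)) - F x / (x - 1) = w x) (at 1)"
        proof eventually_elim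
          case (elim x)
          have "K * th q (b * x) * th q (a * x) / (th q x * th q (a * b * x)) =
              - (K * th q (b * x) * th q (a * x) / (ths q x * th q (a * b * x))) / (x - 1)"
            using elim by (simp add: th_eq_ths[OF q(1), of x] divide_simps) (simp add: algebra_simps)
          thus ?case by (simp add: w_def F_def diff_divide_distrib)
        qed
        ultimately show ?thesis unfolding 1 by (intro exI) (rule Lim_transform_eventually)
      next
        case 2
        \<comment> \<open>The same at s = 1 / (a b), where now \<open>LL q (a * b * x)\<close> has
          the pole. The factor s below converts 1 / (x - s) into 1 / (a b x - 1).\<close>
        define F where "F = (\<lambda>x. a * b * x + K * th q (b * x) * th q (a * x) / (th q x * ths q (a * b * x)))"
        have s: "th q (1 / (a * b)) = - th q (a * b) / (a * b)" using th_inverse[OF q, of "a * b"] nz by simp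
        have "F field_differentiable (at s)" unfolding F_def
          using nz th J q s 2
          by (intro derivative_intros th_mult_field_differentiable th_field_differentiable) (auto simp: ths_1)
        moreover have "F s = 0"
        proof -
          have 1: "b * s = 1 / a" "a * s = 1 / b" "a * b * s = 1" using nz 2 by (auto simp: field_simps)
          have 3: "th q s = - th q (a * b) / (a * b)" using s 2 by simp
          have "F s = 1 + K * (- th q a / a) * (- th q b / b) / (- th q (a * b) / (a * b) * (qp q q)\<^sup>2)"
            using th_inverse[OF q nz(1)] th_inverse[OF q nz(2)] unfolding F_def 1 3 by (simp add: ths_1)
          also have "\<dots> = 0" using th J nz by (simp add: K_def divide_simps)
          finally show ?thesis .
        qed
        ultimately obtain l1 where l1: "(\<lambda>x. F x / (x - s)) \<midarrow>s\<rightarrow> l1" using lim_divide_zero by blast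
        obtain l2 where l2: "(\<lambda>x. LL q x - x / (x - 1)) \<midarrow>1\<rightarrow> l2" using LL_pole_1[OF q] by blast
        have "filterlim (\<lambda>x. a * b * x) (at 1) (at s)"
        proof (rule filterlim_atI)
          show "(\<lambda>x. a * b * x) \<midarrow>s\<rightarrow> 1" using nz 2 by (auto intro!: tendsto_eq_intros)
          show "\<forall>\<^sub>F x in at s. a * b * x \<noteq> 1"
          proof -
            have "a * b * x \<noteq> 1" if "x \<noteq> s" for x
            proof
              assume "a * b * x = 1"
              hence "a * b * x = a * b * s" using 2 nz by simp
              thus False using nz that by simp
            qed
            thus ?thesis by (simp add: eventually_at_filter)
          qed
        qed
        from filterlim_compose[OF l2 this]
        have l3: "(\<lambda>x. LL q (a * b * x) - a * b * x / (a * b * x - 1)) \<midarrow>s\<rightarrow> l2" by simp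
        have "isCont (LL q) s"
          using nz th q s 2 by (intro isCont_LL) auto
        hence "LL q \<midarrow>s\<rightarrow> LL q s" by (simp add: isCont_def)
        hence "(\<lambda>x. 1 - LL q a - LL q b - LL q x + (LL q (a * b * x) - a * b * x / (a * b * x - 1)) + s * (F x / (x - s)))
            \<midarrow>s\<rightarrow> 1 - LL q a - LL q b - LL q s + l2 + s * l1"
          by (intro tendsto_intros l1 l3)
        moreover have "eventually (\<lambda>x. x \<noteq> s) (at s)" by (simp add: eventually_neq_at_within)
        hence "eventually (\<lambda>x. 1 - LL q a - LL q b - LL q x + (LL q (a * b * x) - a * b * x / (a * b * x - 1)) + s * (F x / (x - s)) = w x) (at s)"
        proof eventually_elim
          case (elim x)
          have abs: "a * b * s = 1" using 2 nz by simp
          have x: "a * b * x \<noteq> 1"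
          proof
            assume "a * b * x = 1"
            hence "a * b * x = a * b * s" using abs by simp
            thus False using nz elim by simp
          qed
          have "s * (a * b * x - 1) = (a * b * s) * x - s" by (simp add: algebra_simps)
          hence "s * (a * b * x - 1) = x - s" by (simp add: abs)
          hence 1: "s / (x - s) = 1 / (a * b * x - 1)" using elim x by (simp add: frac_eq_eq)
          have "s * (F x / (x - s)) = F x / (a * b * x - 1)"
            using arg_cong[OF 1, of "\<lambda>y. F x * y"] by (simp add: mult_ac)
          also have "\<dots> = a * b * x / (a * b * x - 1) + K * th q (b * x) * th q (a * x) / (th q x * ths q (a * b * x)) / (a * b * x - 1)"
            by (simp add: F_def add_divide_distrib)
          also have "K * th q (b * x) * th q (a * x) / (th q x * ths q (a * b * x)) / (a * b * x - 1) =
             - (K * th q (b * x) * th q (a * x) / (th q x * th q (a * b * x)))"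
            using x by (simp add: th_eq_ths[OF q(1), of "a * b * x"] divide_simps) (simp add: algebra_simps)
          finally show ?case by (simp add: w_def)
        qed
        ultimately show ?thesis by (intro exI) (rule Lim_transform_eventually)
      qed
    qed
    show "c \<notin> orbits q S" "1 / a \<notin> orbits q S" using orb th nz q by (auto simp: th_inverse)
  qed (use nz in auto)
  also have "w (1 / a) = 0"
    using LL_inverse[OF q nz(1) th(1)] nz th_1[OF q(1)] by (simp add: w_def)
  finally show ?thesis by (simp add: w_def K_def mult_ac)
qed

section \<open>Theta functions of level ten\<close>

definition th10 :: "complex \<Rightarrow> nat \<Rightarrow> complex" where
  "th10 q k = th (q ^ 10) (q ^ k)"

definition LL10 :: "complex \<Rightarrow> nat \<Rightarrow> complex" where
  "LL10 q k = LL (q ^ 10) (q ^ k)"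

lemma th_power_nonzero:
  assumes q: "norm q < 1" "q \<noteq> 0" and m: "m > 0" and k: "\<not> m dvd k"
  shows "th (q ^ m) (q ^ k) \<noteq> 0"
proof
  have qm: "norm (q ^ m) < 1" "q ^ m \<noteq> 0" using q m by (auto simp: norm_power power_less_one_iff)
  assume "th (q ^ m) (q ^ k) = 0"
  then obtain i :: int where "q ^ k = (q ^ m) powi i" using th_eq_0_iff[OF qm, of "q ^ k"] q by auto
  hence "q powi (int m * i - int k) = 1"
    using q by (simp add: power_int_diff power_int_mult)
  hence "int m * i = int k" using power_int_eq_1_iff[OF q] by auto
  hence "int m dvd int k" by (metis dvd_triv_left)
  thus False using k by simp
qed

lemma th10_nonzero:
  assumes q: "norm q < 1" "q \<noteq> 0"
  shows "th10 q 1 \<noteq> 0" "th10 q 2 \<noteq> 0" "th10 q 3 \<noteq> 0" "th10 q 4 \<noteq> 0" "th10 q 5 \<noteq> 0"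
  unfolding th10_def by (rule th_power_nonzero[OF q]; simp)+

lemma th_ten:
  assumes q: "norm q < 1" "q \<noteq> 0"
  defines "j \<equiv> th10 q"
  shows "j 6 = j 4" "j 7 = j 3" "j 8 = j 2" "j 9 = j 1" "j 12 = - j 2 / q\<^sup>2"
    and "th (q ^ 10) (1 / q ^ k) = - j k / q ^ k"
proof -
  have B: "norm (q ^ 10) < 1" "q ^ 10 \<noteq> 0" using q by (auto simp: norm_power power_less_one_iff)
  have *: "j m = j k" if "m + k = 10" for k m
  proof -
    have "q ^ 10 / q ^ m = q ^ k" using q by (simp add: power_add flip: that)
    thus ?thesis using th_q_divide[OF B, of "q ^ m"] q by (simp add: j_def th10_def)
  qed
  show "j 6 = j 4" "j 7 = j 3" "j 8 = j 2" "j 9 = j 1"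
    by (rule *; simp)+
  show "j 12 = - j 2 / q\<^sup>2" 
    using th_mult_q[OF B, of "q\<^sup>2"] q by (simp add: j_def th10_def flip: power_add)
  show "th (q ^ 10) (1 / q ^ k) = - j k / q ^ k"
    using th_inverse[OF B, of "q ^ k"] q by (simp add: j_def th10_def)
qed

lemma LL_ten:
  assumes q: "norm q < 1" "q \<noteq> 0"
  defines "l \<equiv> LL10 q"
  shows "l 6 = - l 4" "l 7 = - l 3" "l 8 = - l 2" "l 9 = - l 1" "l 12 = l 2 - 1"
    and "\<not> 10 dvd k \<Longrightarrow> LL (q ^ 10) (1 / q ^ k) = 1 - l k"
proof -
  have B: "norm (q ^ 10) < 1" "q ^ 10 \<noteq> 0" using q by (auto simp: norm_power power_less_one_iff)
  show inv: "LL (q ^ 10) (1 / q ^ k) = 1 - l k" if "\<not> 10 dvd k" for k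
    using LL_inverse[OF B, of "q ^ k"] th_power_nonzero[OF q _ that] q by (simp add: l_def LL10_def)
  have *: "l m = - l k" if "m + k = 10" "\<not> 10 dvd k" for k m
  proof -
    have e: "q ^ 10 * (1 / q ^ k) = q ^ m" using q by (simp add: power_add flip: that(1))
    have "th (q ^ 10) (1 / q ^ k) \<noteq> 0" 
      using th_inverse[OF B, of "q ^ k"] th_power_nonzero[OF q _ that(2)] q by simp
    from LL_mult_q[OF B _ this] q show ?thesis
      unfolding e inv[OF that(2)] by (simp add: l_def LL10_def)
  qed
  show "l 6 = - l 4" "l 7 = - l 3" "l 8 = - l 2" "l 9 = - l 1"
    by (rule *; simp)+
  show "l 12 = l 2 - 1"
    using LL_mult_q[OF B, of "q\<^sup>2"] th_power_nonzero[OF q, of 10 2] q by (simp add: l_def LL10_def flip: power_add)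
qed

text \<open>Six specializations of the four-term identity at base q^10 to powers of q. Each turns a
  theta quotient into a linear form in the four numbers l 1, ..., l 4, so that relations between
  quotients become linear algebra.\<close>

lemma ten_products:
  assumes q: "norm q < 1" "q \<noteq> 0"
  defines "j \<equiv> th10 q" and "l \<equiv> LL10 q" and "J \<equiv> qp (q ^ 10) (q ^ 10)"
  shows "q * J\<^sup>2 * j 5 / (j 3 * j 4) = - l 1 - l 4 + l 2 + l 3" (is ?a)
    and "q * J\<^sup>2 * j 1 * j 4 / ((j 2)\<^sup>2 * j 3) = - l 1 - l 3 + 2 * l 2" (is ?b)
    and "q * J\<^sup>2 * j 2 * j 3 / (j 1 * (j 4)\<^sup>2) = - l 1 + l 3 + 2 * l 4" (is ?c)
    and "J\<^sup>2 * j 4 * (j 5)\<^sup>2 / ((j 2)\<^sup>2 * (j 3)\<^sup>2) = 1 - 2 * l 2 - 2 * l 3" (is ?d)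
    and "q\<^sup>2 * J\<^sup>2 * (j 1)\<^sup>2 / (j 2 * (j 3)\<^sup>2) = - l 4 - l 2 + 2 * l 3" (is ?e)
    and "q\<^sup>2 * J\<^sup>2 * (j 2)\<^sup>2 / (j 4) ^ 3 = 3 * l 4 - l 2" (is ?f)
proof -
  have B: "norm (q ^ 10) < 1" "q ^ 10 \<noteq> 0" using q by (auto simp: norm_power power_less_one_iff)
  have nz: "j 1 \<noteq> 0" "j 2 \<noteq> 0" "j 3 \<noteq> 0" "j 4 \<noteq> 0" "j 5 \<noteq> 0"
    unfolding j_def by (rule th10_nonzero[OF q])+
  \<comment> \<open>Integer exponents are used because most of the specializations involve negative
    powers of q.\<close>
  define thi LLi where "thi = (\<lambda>k::int. th (q ^ 10) (q powi k))" and "LLi = (\<lambda>k::int. LL (q ^ 10) (q powi k))"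
  have thi_pos: "thi (int k) = j k" and thi_neg: "thi (- int k) = - j k / q ^ k" for k
    using th_ten(6)[OF q, of k] by (simp_all add: thi_def j_def th10_def power_int_minus inverse_eq_divide)
  have LLi_pos: "LLi (int k) = l k" and LLi_neg: "\<not> 10 dvd k \<Longrightarrow> LLi (- int k) = 1 - l k" for k
    using LL_ten(6)[OF q, of k] by (simp_all add: LLi_def l_def LL10_def power_int_minus inverse_eq_divide)
  have T: "thi 1 = j 1" "thi 2 = j 2" "thi 3 = j 3" "thi 4 = j 4" "thi 5 = j 5" "thi 6 = j 6" "thi 7 = j 7"
    "thi (-1) = - j 1 / q ^ 1" "thi (-2) = - j 2 / q ^ 2" "thi (-3) = - j 3 / q ^ 3" "thi (-4) = - j 4 / q ^ 4"
    "thi (-7) = - j 7 / q ^ 7" "thi (-8) = - j 8 / q ^ 8" "thi (-12) = - j 12 / q ^ 12"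
    using thi_pos[of 1] thi_pos[of 2] thi_pos[of 3] thi_pos[of 4] thi_pos[of 5] thi_pos[of 6] thi_pos[of 7]
      thi_neg[of 1] thi_neg[of 2] thi_neg[of 3] thi_neg[of 4] thi_neg[of 7] thi_neg[of 8] thi_neg[of 12] by simp_all
  have L: "LLi 1 = l 1" "LLi 2 = l 2" "LLi 3 = l 3" "LLi 4 = l 4" "LLi 7 = l 7"
    "LLi (-2) = 1 - l 2" "LLi (-3) = 1 - l 3" "LLi (-4) = 1 - l 4" "LLi (-7) = 1 - l 7" "LLi (-12) = 1 - l 12"
    using LLi_pos[of 1] LLi_pos[of 2] LLi_pos[of 3] LLi_pos[of 4] LLi_pos[of 7]
      LLi_neg[of 2] LLi_neg[of 3] LLi_neg[of 4] LLi_neg[of 7] LLi_neg[of 12] by simp_all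
  note t = th_ten(1-5)[OF q, folded j_def] and l = LL_ten(1-5)[OF q, folded l_def]
  have thi_nz: "thi k \<noteq> 0" if "\<not> 10 dvd k" for k
  proof (cases k rule: int_cases2)
    case (nonneg n)
    hence "\<not> 10 dvd n" using that by auto
    from th_power_nonzero[OF q _ this] show ?thesis using thi_pos[of n] nonneg by (simp add: j_def th10_def)
  next
    case (nonpos n)
    hence "\<not> 10 dvd n" using that by auto
    from th_power_nonzero[OF q _ this] show ?thesis using thi_neg[of n] nonpos q by (simp add: j_def th10_def)
  qed
  have pw: "x ^ 3 = x * x * x" "x ^ 4 = x * x * x * x" "x ^ 7 = x * x * x * x * x * x * x"
     "x ^ 8 = x * x * x * x * x * x * x * x" "x ^ 12 = x * x * x * x * x * x * x * x * x * x * x * x" for x :: complex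
    by (simp_all add: eval_nat_numeral mult_ac)
  have four: "1 - LLi m - LLi n - LLi p + LLi (m + n + p) =
      J\<^sup>2 * thi (m + n) * thi (n + p) * thi (m + p) / (thi m * thi n * thi p * thi (m + n + p))"
    if "\<not> 10 dvd m" "\<not> 10 dvd n" "\<not> 10 dvd p" "\<not> 10 dvd (m + n)" "\<not> 10 dvd (m + n + p)" for m n p
    using LL_four_term[OF B, of "q powi m" "q powi n" "q powi p"] that[THEN thi_nz] q
    by (simp add: thi_def LLi_def J_def power_int_add)
  have "1 - LLi (1) - LLi (4) - LLi (-2) + LLi (3) =
      J\<^sup>2 * thi (5) * thi (2) * thi (-1) / (thi (1) * thi (4) * thi (-2) * thi (3))"
    using four[of "1" "4" "-2"] by simp
  thus ?a unfolding T L t l using q nz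
    by (simp add: divide_simps power2_eq_square pw) (simp add: algebra_simps)
  have "1 - LLi (1) - LLi (3) - LLi (-2) + LLi (2) =
      J\<^sup>2 * thi (4) * thi (1) * thi (-1) / (thi (1) * thi (3) * thi (-2) * thi (2))"
    using four[of "1" "3" "-2"] by simp
  thus ?b unfolding T L t l using q nz
    by (simp add: divide_simps power2_eq_square pw) (simp add: algebra_simps)
  have "1 - LLi (1) - LLi (-4) - LLi (-4) + LLi (-7) =
      J\<^sup>2 * thi (-3) * thi (-8) * thi (-3) / (thi (1) * thi (-4) * thi (-4) * thi (-7))"
    using four[of "1" "-4" "-4"] by simp
  thus ?c unfolding T L t l using q nz
    by (simp add: divide_simps power2_eq_square pw) (simp add: algebra_simps)
  have "1 - LLi (2) - LLi (2) - LLi (3) + LLi (7) =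
      J\<^sup>2 * thi (4) * thi (5) * thi (5) / (thi (2) * thi (2) * thi (3) * thi (7))"
    using four[of "2" "2" "3"] by simp
  thus ?d unfolding T L t l by (simp add: power2_eq_square mult_ac)
  have "1 - LLi (4) - LLi (2) - LLi (-3) + LLi (3) =
      J\<^sup>2 * thi (6) * thi (-1) * thi (1) / (thi (4) * thi (2) * thi (-3) * thi (3))"
    using four[of "4" "2" "-3"] by simp
  thus ?e unfolding T L t l using q nz
    by (simp add: divide_simps power2_eq_square pw) (simp add: algebra_simps)
  have "1 - LLi (-4) - LLi (-4) - LLi (-4) + LLi (-12) =
      J\<^sup>2 * thi (-8) * thi (-8) * thi (-8) / (thi (-4) * thi (-4) * thi (-4) * thi (-12))"
    using four[of "-4" "-4" "-4"] by simp
  thus ?f unfolding T L t l using q nz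
    by (simp add: divide_simps power2_eq_square pw) (simp add: algebra_simps)
qed

text \<open>Six linear forms in four unknowns are dependent: in \<open>ten_products\<close> the
  first form is the sum of the second and the fifth, and the third is the sum of the first and the
  sixth. Clearing denominators gives the two theta identities.\<close>

lemma ten_theta:
  assumes q: "norm q < 1" "q \<noteq> 0"
  defines "j \<equiv> th10 q"
  shows "j 5 * (j 2)\<^sup>2 * j 3 = j 1 * j 3 * (j 4)\<^sup>2 + q * (j 1)\<^sup>2 * j 2 * j 4"
    and "j 2 * (j 3)\<^sup>2 * j 4 = j 1 * j 5 * (j 4)\<^sup>2 + q * j 1 * (j 2)\<^sup>2 * j 3"
proof -
  define J where "J = qp (q ^ 10) (q ^ 10)"
  define l where "l = LL10 q"
  note p = ten_products[OF q, folded j_def J_def l_def]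
  have B: "norm (q ^ 10) < 1" "q ^ 10 \<noteq> 0" using q by (auto simp: norm_power power_less_one_iff)
  have J: "J \<noteq> 0" using qp_q_q_nonzero[OF B(1)] by (simp add: J_def)
  have nz: "j 1 \<noteq> 0" "j 2 \<noteq> 0" "j 3 \<noteq> 0" "j 4 \<noteq> 0" "j 5 \<noteq> 0"
    unfolding j_def by (rule th10_nonzero[OF q])+
  have "q * J\<^sup>2 * j 5 / (j 3 * j 4) = q * J\<^sup>2 * j 1 * j 4 / ((j 2)\<^sup>2 * j 3) + q\<^sup>2 * J\<^sup>2 * (j 1)\<^sup>2 / (j 2 * (j 3)\<^sup>2)"
    unfolding p(1,2,5) by simp
  hence "q * J\<^sup>2 * (j 5 / (j 3 * j 4)) = q * J\<^sup>2 * (j 1 * j 4 / ((j 2)\<^sup>2 * j 3) + q * (j 1)\<^sup>2 / (j 2 * (j 3)\<^sup>2))"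
    by (simp add: algebra_simps power2_eq_square)
  hence "j 5 / (j 3 * j 4) = j 1 * j 4 / ((j 2)\<^sup>2 * j 3) + q * (j 1)\<^sup>2 / (j 2 * (j 3)\<^sup>2)"
    unfolding mult_cancel_left using J q by auto
  thus "j 5 * (j 2)\<^sup>2 * j 3 = j 1 * j 3 * (j 4)\<^sup>2 + q * (j 1)\<^sup>2 * j 2 * j 4"
    using nz by (simp add: divide_simps power2_eq_square) (simp add: algebra_simps)
  have "q * J\<^sup>2 * j 2 * j 3 / (j 1 * (j 4)\<^sup>2) = q * J\<^sup>2 * j 5 / (j 3 * j 4) + q\<^sup>2 * J\<^sup>2 * (j 2)\<^sup>2 / (j 4) ^ 3"
    unfolding p(1,3,6) by simp
  hence "q * J\<^sup>2 * (j 2 * j 3 / (j 1 * (j 4)\<^sup>2)) = q * J\<^sup>2 * (j 5 / (j 3 * j 4) + q * (j 2)\<^sup>2 / (j 4) ^ 3)"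
    by (simp add: algebra_simps power2_eq_square)
  hence "j 2 * j 3 / (j 1 * (j 4)\<^sup>2) = j 5 / (j 3 * j 4) + q * (j 2)\<^sup>2 / (j 4) ^ 3"
    unfolding mult_cancel_left using J q by auto
  thus "j 2 * (j 3)\<^sup>2 * j 4 = j 1 * j 5 * (j 4)\<^sup>2 + q * j 1 * (j 2)\<^sup>2 * j 3"
    using nz by (simp add: divide_simps power2_eq_square power3_eq_cube) (simp add: algebra_simps)
qed

text \<open>At z = a this is a times the logarithmic derivative of th(-z) / (th(z) th(a z)), the
  quantity that survives when the three-term relation for Appell sums is taken to the limit z ->
  a.\<close>

definition lam :: "complex \<Rightarrow> complex \<Rightarrow> complex" where
  "lam q z = LL q (- z) - LL q z - LL q (z\<^sup>2)"

text \<open>\<open>LL_split2\<close> passes from base q^5 to base q^10, and \<open>LL_minus\<close>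
  removes the negative argument.\<close>

lemma lam_five:
  assumes q: "norm q < 1" "q \<noteq> 0"
  defines "l \<equiv> LL10 q"
  shows "lam (q ^ 5) q = - 2 * l 1 + l 2 + l 3 + 2 * l 4"
    and "lam (q ^ 5) (q\<^sup>2) = l 1 - 2 * l 2 + 2 * l 3 + l 4"
proof -
  have B: "norm (q ^ 5) < 1" "q ^ 5 \<noteq> 0" using q by (auto simp: norm_power power_less_one_iff)
  note L = LL_ten[OF q, folded l_def]
  have sp: "LL (q ^ 5) (q ^ k) = l k + l (5 + k)" if "\<not> 5 dvd k" for k
    using LL_split2[OF B, of "q ^ k"] th_power_nonzero[OF q _ that] q
    by (simp add: l_def LL10_def power_add flip: power_mult)
  have mi: "LL (q ^ 5) (- (q ^ k)) = 2 * l (2 * k) - LL (q ^ 5) (q ^ k)" if "\<not> 5 dvd k" "\<not> 10 dvd 2 * k" for k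
  proof -
    have "th (q ^ 5) (- (q ^ k)) \<noteq> 0"
      using th_mult_minus[OF B(1), of "q ^ k"] th_power_nonzero[OF q _ that(2)] by (auto simp flip: power_mult simp: mult.commute)
    thus ?thesis using LL_minus[OF B, of "q ^ k"] th_power_nonzero[OF q _ that(1)] q
      by (simp add: l_def LL10_def mult.commute flip: power_mult) (simp add: algebra_simps)
  qed
  show "lam (q ^ 5) q = - 2 * l 1 + l 2 + l 3 + 2 * l 4"
    using sp[of 1] sp[of 2] mi[of 1] L by (simp add: lam_def)
  show "lam (q ^ 5) (q\<^sup>2) = l 1 - 2 * l 2 + 2 * l 3 + l 4"
    using sp[of 2] sp[of 4] mi[of 2] L by (simp add: lam_def flip: power_mult)
qed

text \<open>Every term is a linear form in l 1, ..., l 4, so only coefficients have to match. These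
  are the identities needed for the coefficient of x^0 in the dissection, with the logarithmic
  derivatives coming from the Appell sums at their poles.\<close>

lemma class_zero_products:
  assumes q: "norm q < 1" "q \<noteq> 0"
  defines "j \<equiv> th10 q" and "J \<equiv> qp (q ^ 10) (q ^ 10)"
  shows "J\<^sup>2 * j 4 * (j 5)\<^sup>2 / ((j 2)\<^sup>2 * (j 3)\<^sup>2) + 4 * (q * J\<^sup>2 * j 5 / (j 3 * j 4))
      + 4 * (q * J\<^sup>2 * j 1 * j 4 / ((j 2)\<^sup>2 * j 3)) + 12 * (q * J\<^sup>2 * j 2 * j 3 / (j 1 * (j 4)\<^sup>2))
      = 1 + 10 * lam (q ^ 5) q"
    and "3 * (J\<^sup>2 * j 4 * (j 5)\<^sup>2 / ((j 2)\<^sup>2 * (j 3)\<^sup>2)) + 2 * (q * J\<^sup>2 * j 5 / (j 3 * j 4))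
      + 12 * (q * J\<^sup>2 * j 1 * j 4 / ((j 2)\<^sup>2 * j 3)) - 4 * (q * J\<^sup>2 * j 2 * j 3 / (j 1 * (j 4)\<^sup>2))
      = 3 - 10 * lam (q ^ 5) (q\<^sup>2)"
  unfolding ten_products[OF q, folded j_def J_def] lam_five[OF q] by (simp_all add: algebra_simps)

section \<open>Appell sums\<close>

text \<open>The terms equal (r^n s)^n, eventually at most 2^(-n) for n > 0; negative indices follow
  with 1 / s in place of s.\<close>

lemma gauss_summable:
  fixes r s :: real
  assumes r: "0 < r" "r < 1" and s: "s > 0"
  shows "(\<lambda>n::int. r powi (n\<^sup>2) * s powi n) summable_on UNIV"
proof -
  have *: "(\<lambda>n::nat. r ^ (n\<^sup>2) * s ^ n) summable_on UNIV" if s: "s > 0" for s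
  proof -
    have "(\<lambda>n. r ^ n * s) \<longlonglongrightarrow> 0" using r by (intro tendsto_mult_left_zero LIMSEQ_power_zero) auto
    hence "eventually (\<lambda>n. r ^ n * s < 1 / 2) sequentially" by (rule order_tendstoD) auto
    hence "eventually (\<lambda>n. norm (r ^ (n\<^sup>2) * s ^ n) \<le> (1 / 2) ^ n) sequentially"
    proof eventually_elim
      case (elim n)
      have "r ^ (n\<^sup>2) * s ^ n = (r ^ n * s) ^ n"
        by (simp add: power_mult_distrib power2_eq_square power_mult)
      also have "\<dots> \<le> (1 / 2) ^ n" using elim r s by (intro power_mono) auto
      finally show ?case using r s by simp
    qed
    hence "summable (\<lambda>n. r ^ (n\<^sup>2) * s ^ n)"
      by (rule summable_comparison_test_ev) (intro summable_geometric, simp)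
    thus ?thesis using r s by (intro summable_nonneg_imp_summable_on) auto
  qed
  have 1: "(\<lambda>n::int. r powi (n\<^sup>2) * s powi n) summable_on range int"
  proof (subst summable_on_reindex)
    have "(\<lambda>n::int. r powi (n\<^sup>2) * s powi n) \<circ> int = (\<lambda>n. r ^ (n\<^sup>2) * s ^ n)"
      by (auto simp: fun_eq_iff simp flip: of_nat_power)
    thus "(\<lambda>n::int. r powi (n\<^sup>2) * s powi n) \<circ> int summable_on UNIV" using *[OF s] by simp
  qed auto
  have 2: "(\<lambda>n::int. r powi (n\<^sup>2) * s powi n) summable_on range (\<lambda>n. - int n)"
  proof (subst summable_on_reindex)
    have "(\<lambda>n::int. r powi (n\<^sup>2) * s powi n) \<circ> (\<lambda>n. - int n) = (\<lambda>n. r ^ (n\<^sup>2) * (1 / s) ^ n)"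
      by (auto simp: fun_eq_iff power_int_minus field_simps simp flip: of_nat_power)
    thus "(\<lambda>n::int. r powi (n\<^sup>2) * s powi n) \<circ> (\<lambda>n. - int n) summable_on UNIV" using *[of "1 / s"] s by simp
  qed (auto simp: inj_on_def)
  have "range int \<union> range (\<lambda>n. - int n) = UNIV"
  proof -
    have "k \<in> range int \<union> range (\<lambda>n. - int n)" for k by (cases k rule: int_cases2) auto
    thus ?thesis by blast
  qed
  thus ?thesis using summable_on_union[OF 1 2] by simp
qed

text \<open>The Weierstrass test on a closed disc around each point, with the finite partial sums as
  the approximating net.\<close>

lemma holomorphic_infsum:
  fixes f :: "'a \<Rightarrow> complex \<Rightarrow> complex"
  assumes hol: "\<And>n. n \<in> A \<Longrightarrow> f n holomorphic_on U"
    and bound: "\<And>x. x \<in> U \<Longrightarrow> \<exists>r>0. cball x r \<subseteq> U \<and>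
      (\<exists>M. M summable_on A \<and> (\<forall>n\<in>A. \<forall>y\<in>cball x r. norm (f n y) \<le> M n))"
  shows "(\<lambda>x. \<Sum>\<^sub>\<infinity>n\<in>A. f n x) holomorphic_on U"
proof -
  have "(\<lambda>x. \<Sum>\<^sub>\<infinity>n\<in>A. f n x) field_differentiable (at x)" if x: "x \<in> U" for x
  proof -
    obtain r M where r: "r > 0" "cball x r \<subseteq> U" and M: "M summable_on A"
      "\<forall>n\<in>A. \<forall>y\<in>cball x r. norm (f n y) \<le> M n" using bound[OF x] by auto
    have ul: "uniform_limit (cball x r) (\<lambda>X y. \<Sum>n\<in>X. f n y) (\<lambda>y. \<Sum>\<^sub>\<infinity>n\<in>A. f n y) (finite_subsets_at_top A)"
      by (rule Weierstrass_m_test_general[OF _ M(1)]) (use M(2) in auto)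
    have ev: "\<forall>\<^sub>F X in finite_subsets_at_top A. finite X \<and> X \<subseteq> A"
      by (rule eventually_finite_subsets_at_top_weakI) auto
    have "continuous_on (cball x r) (\<lambda>y. \<Sum>\<^sub>\<infinity>n\<in>A. f n y) \<and> (\<lambda>y. \<Sum>\<^sub>\<infinity>n\<in>A. f n y) holomorphic_on ball x r"
    proof (rule holomorphic_uniform_limit[OF _ ul])
      show "\<forall>\<^sub>F X in finite_subsets_at_top A. continuous_on (cball x r) (\<lambda>y. \<Sum>n\<in>X. f n y) \<and>
            (\<lambda>y. \<Sum>n\<in>X. f n y) holomorphic_on ball x r"
        using ev
      proof eventually_elim
        case (elim X)
        have h: "(\<lambda>y. \<Sum>n\<in>X. f n y) holomorphic_on U"
          by (intro holomorphic_on_sum hol) (use elim in auto)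
        have "ball x r \<subseteq> U" using r(2) ball_subset_cball by blast
        thus ?case using h r(2) holomorphic_on_subset holomorphic_on_imp_continuous_on by blast
      qed
    qed auto
    thus ?thesis using r(1) by (auto intro: holomorphic_on_imp_differentiable_at[of _ "ball x r"])
  qed
  thus ?thesis using field_differentiable_at_within holomorphic_on_def by blast
qed

section \<open>The theta series and the Appell sum: convergence and regularity\<close>

definition vt :: "complex \<Rightarrow> complex \<Rightarrow> complex" where
  "vt q y = (\<Sum>\<^sub>\<infinity>n::int. (-1) powi n * q powi (n\<^sup>2) * y powi n)"

definition app_term :: "complex \<Rightarrow> complex \<Rightarrow> int \<Rightarrow> complex \<Rightarrow> complex" where
  "app_term q y n x = (-1) powi n * q powi (n\<^sup>2) * y powi n / (1 - x * q powi n)"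

text \<open>The index set is kept as a parameter so that one singular term can be split off, the sum
  over the other indices being regular at that pole.\<close>

definition app_on :: "complex \<Rightarrow> complex \<Rightarrow> int set \<Rightarrow> complex \<Rightarrow> complex" where
  "app_on q y A x = (\<Sum>\<^sub>\<infinity>n\<in>A. app_term q y n x)"

abbreviation app :: "complex \<Rightarrow> complex \<Rightarrow> complex \<Rightarrow> complex" where
  "app q y \<equiv> app_on q y UNIV"

lemma norm_minus_one_powi [simp]: "norm ((-1 :: complex) powi n) = 1"
  by (simp add: norm_power_int)

lemma minus_one_powi_minus [simp]: "inverse ((-1 :: complex) powi n) = (-1) powi n"
  by (cases "even n") (auto simp: power_int_minus_left)

lemma vt_summable_norm:
  fixes q y :: complex
  assumes q: "norm q < 1" "q \<noteq> 0" and y: "y \<noteq> 0"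
  shows "(\<lambda>n::int. norm ((-1) powi n * q powi (n\<^sup>2) * y powi n)) summable_on A"
proof -
  have "(\<lambda>n::int. norm q powi (n\<^sup>2) * norm y powi n) summable_on UNIV"
    by (rule gauss_summable) (use q y in auto)
  hence "(\<lambda>n::int. norm q powi (n\<^sup>2) * norm y powi n) summable_on A"
    by (rule summable_on_subset_banach) auto
  thus ?thesis by (simp add: norm_mult norm_power_int)
qed

lemma vt_summable:
  fixes q y :: complex
  assumes q: "norm q < 1" "q \<noteq> 0" and y: "y \<noteq> 0"
  shows "(\<lambda>n::int. (-1) powi n * q powi (n\<^sup>2) * y powi n) summable_on A"
  using vt_summable_norm[OF assms] by (rule abs_summable_summable)

text \<open>Which end of the interval dominates depends on the sign of n; the sum of both is a bound
  for either sign.\<close>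

lemma powi_bounds:
  fixes x :: complex
  assumes "0 < a" "a \<le> norm x" "norm x \<le> b"
  shows "norm x powi n \<le> a powi n + b powi n"
proof (cases "n \<ge> 0")
  case True
  hence "norm x powi n \<le> b powi n" using assms by (intro power_int_mono) auto
  thus ?thesis using assms by (smt (verit) zero_le_power_int)
next
  case False
  have "norm x powi n \<le> a powi n" using assms False by (intro power_int_antimono) auto
  moreover have "b powi n \<ge> 0" using assms by simp
  ultimately show ?thesis by simp
qed

lemma annulus_nhd:
  fixes x :: complex
  assumes "x \<noteq> 0"
  obtains r where "r > 0" "cball x r \<subseteq> -{0}" "\<And>y. y \<in> cball x r \<Longrightarrow> norm x / 2 \<le> norm y \<and> norm y \<le> 2 * norm x"
proof
  show "norm x / 2 > 0" using assms by simp
  show *: "norm x / 2 \<le> norm y \<and> norm y \<le> 2 * norm x" if "y \<in> cball x (norm x / 2)" for y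
  proof -
    have "norm (x - y) \<le> norm x / 2" using that by (simp add: dist_norm)
    moreover have "norm x \<le> norm (x - y) + norm y" by (metis add.commute diff_add_cancel norm_triangle_ineq)
    moreover have "norm y \<le> norm (x - y) + norm x" by (metis norm_minus_commute diff_add_cancel norm_triangle_ineq)
    ultimately show ?thesis using norm_ge_zero[of x] by linarith
  qed
  show "cball x (norm x / 2) \<subseteq> -{0}" using * assms by force
qed

lemma holomorphic_vt:
  assumes q: "norm q < 1" "q \<noteq> 0"
  shows "vt q holomorphic_on (-{0})"
  unfolding vt_def[abs_def]
proof (rule holomorphic_infsum)
  fix n :: int
  show "(\<lambda>y. (-1) powi n * q powi n\<^sup>2 * y powi n) holomorphic_on (-{0})"
    by (intro holomorphic_intros) auto
next
  fix x :: complex assume "x \<in> -{0}"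
  hence x: "x \<noteq> 0" by simp
  obtain r where r: "r > 0" "cball x r \<subseteq> -{0}" 
    "\<And>y. y \<in> cball x r \<Longrightarrow> norm x / 2 \<le> norm y \<and> norm y \<le> 2 * norm x" using annulus_nhd[OF x] by metis
  define M where "M = (\<lambda>n::int. norm q powi n\<^sup>2 * (norm x / 2) powi n + norm q powi n\<^sup>2 * (2 * norm x) powi n)"
  have "M summable_on UNIV" unfolding M_def
    by (intro summable_on_add gauss_summable) (use q x in auto)
  moreover have "norm ((-1) powi n * q powi n\<^sup>2 * y powi n) \<le> M n" if "y \<in> cball x r" for y n
  proof -
    have "norm y powi n \<le> (norm x / 2) powi n + (2 * norm x) powi n"
      by (rule powi_bounds) (use r(3)[OF that] x in auto)
    hence "norm q powi n\<^sup>2 * norm y powi n \<le> norm q powi n\<^sup>2 * ((norm x / 2) powi n + (2 * norm x) powi n)"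
      by (intro mult_left_mono) auto
    thus ?thesis by (simp add: M_def norm_mult norm_power_int algebra_simps)
  qed
  ultimately show "\<exists>r>0. cball x r \<subseteq> - {0} \<and> (\<exists>M. M summable_on UNIV \<and>
    (\<forall>n\<in>UNIV. \<forall>y\<in>cball x r. norm ((-1) powi n * q powi n\<^sup>2 * y powi n) \<le> M n))"
    using r by blast
qed

text \<open>These are the only indices n for which x q^n can come close to 1 while a \<le> |x| \<le>
  b. For all others |1 - x q^n| \<ge> 1/2, which is what \<open>app_term_bound\<close> uses.\<close>

lemma finite_middle_powers:
  fixes r :: real
  assumes r: "0 < r" "r < 1" and a: "0 < a" 
  shows "finite {n::int. 1 / 2 < b * r powi n \<and> a * r powi n < 2}"
proof -
  have "(\<lambda>n. b * r ^ n) \<longlonglongrightarrow> 0" "(\<lambda>n. r ^ n) \<longlonglongrightarrow> 0"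
    using r by (auto intro!: tendsto_mult_right_zero LIMSEQ_power_zero)
  hence "eventually (\<lambda>n. b * r ^ n < 1 / 2) sequentially" "eventually (\<lambda>n. r ^ n < a / 2) sequentially"
    using order_tendstoD(2)[of "\<lambda>n. b * r ^ n" 0 sequentially "1 / 2"]
      order_tendstoD(2)[of "\<lambda>n. r ^ n" 0 sequentially "a / 2"] a by simp_all
  then obtain N where N: "\<And>n. n \<ge> N \<Longrightarrow> b * r ^ n < 1 / 2 \<and> r ^ n < a / 2"
    unfolding eventually_sequentially by (metis le_trans nle_le)
  have "n \<in> {- int N..int N}" if n: "1 / 2 < b * r powi n" "a * r powi n < 2" for n
  proof (rule ccontr)
    assume "n \<notin> {- int N..int N}"
    then consider m where "n = int m" "m \<ge> N" | m where "n = - int m" "m \<ge> N"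
      by (cases n rule: int_cases2) auto
    thus False
    proof cases
      case 1 thus ?thesis using N[of m] n by simp
    next
      case 2
      hence "r ^ m < a / 2" using N by simp
      moreover have "a / r ^ m < 2" using n 2 by (simp add: power_int_minus field_simps)
      ultimately show ?thesis using r by (simp add: field_simps)
    qed
  qed
  hence "{n::int. 1 / 2 < b * r powi n \<and> a * r powi n < 2} \<subseteq> {- int N..int N}" by blast
  thus ?thesis by (rule finite_subset) simp
qed

lemma app_term_bound:
  assumes "\<not> (1 / 2 < b * norm q powi n \<and> a * norm q powi n < 2)" "a \<le> norm x" "norm x \<le> b"
  shows "x * q powi n \<noteq> 1" "norm (app_term q y n x) \<le> 2 * norm ((-1) powi n * q powi (n\<^sup>2) * y powi n)"
proof -
  have xq: "a * norm q powi n \<le> norm (x * q powi n)" "norm (x * q powi n) \<le> b * norm q powi n"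
    using assms(2,3) by (auto simp: norm_mult norm_power_int intro!: mult_right_mono)
  have "norm (1 - x * q powi n) \<ge> 1 / 2"
  proof (cases "b * norm q powi n \<le> 1 / 2")
    case True
    have "1 \<le> norm (1 - x * q powi n) + norm (x * q powi n)"
      by (metis diff_add_cancel norm_one norm_triangle_ineq)
    thus ?thesis using True xq by linarith
  next
    case False
    have "norm (x * q powi n) \<le> norm (1 - x * q powi n) + 1"
      by (metis diff_add_cancel norm_minus_commute norm_one norm_triangle_ineq)
    thus ?thesis using False assms(1) xq by linarith
  qed
  note * = this
  show "x * q powi n \<noteq> 1" using * by auto
  have "norm (app_term q y n x) = norm ((-1) powi n * q powi (n\<^sup>2) * y powi n) / norm (1 - x * q powi n)"
    by (simp add: app_term_def norm_divide)
  also have "\<dots> \<le> norm ((-1) powi n * q powi (n\<^sup>2) * y powi n) / (1 / 2)"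
    using * by (intro divide_left_mono) auto
  finally show "norm (app_term q y n x) \<le> 2 * norm ((-1) powi n * q powi (n\<^sup>2) * y powi n)" by simp
qed

text \<open>The point x may be a pole: only finitely many terms have small denominators, and a
  vanishing denominator contributes the value 0.\<close>

lemma app_summable:
  assumes q: "norm q < 1" "q \<noteq> 0" and y: "y \<noteq> 0" and x: "x \<noteq> 0"
  shows "(\<lambda>n. app_term q y n x) summable_on A"
proof -
  define F where "F = {n::int. 1 / 2 < norm x * norm q powi n \<and> norm x * norm q powi n < 2}"
  have F: "finite F" unfolding F_def by (rule finite_middle_powers) (use q x in auto)
  have "(\<lambda>n. norm (app_term q y n x)) summable_on (-F)"
  proof (rule summable_on_comparison_test)
    show "(\<lambda>n. 2 * norm ((-1) powi n * q powi (n\<^sup>2) * y powi n)) summable_on -F"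
      by (intro summable_on_cmult_right vt_summable_norm q y)
  qed (use app_term_bound(2)[of "norm x" q _ "norm x" x y] in \<open>auto simp: F_def\<close>)
  hence "(\<lambda>n. app_term q y n x) summable_on (-F)" by (rule abs_summable_summable)
  hence "(\<lambda>n. app_term q y n x) summable_on (-F \<union> F)" by (rule summable_on_union) (simp add: F)
  hence "(\<lambda>n. app_term q y n x) summable_on UNIV" by simp
  thus ?thesis by (rule summable_on_subset_banach) auto
qed

text \<open>On an annulus around x only the finitely many indices in \<open>F\<close> can produce
  poles, and those terms are differentiable at x by assumption; the remaining sum is holomorphic by
  the uniform bound.\<close>

lemma app_on_differentiable:
  assumes q: "norm q < 1" "q \<noteq> 0" and y: "y \<noteq> 0" and x: "x \<noteq> 0" and A: "\<And>n. n \<in> A \<Longrightarrow> x * q powi n \<noteq> 1"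
  shows "app_on q y A field_differentiable (at x)"
proof -
  define a b where "a = norm x / 2" and "b = 2 * norm x"
  define F where "F = {n::int. 1 / 2 < b * norm q powi n \<and> a * norm q powi n < 2}"
  have F: "finite F" unfolding F_def by (rule finite_middle_powers) (use q x in \<open>auto simp: a_def\<close>)
  define U where "U = {z::complex. a < norm z \<and> norm z < b}"
  have U: "open U" unfolding U_def by (intro open_Collect_conj open_Collect_less continuous_intros)
  have xU: "x \<in> U" using x by (simp add: U_def a_def b_def)
  have "(\<lambda>z. \<Sum>\<^sub>\<infinity>n\<in>A - F. app_term q y n z) holomorphic_on U"
  proof (rule holomorphic_infsum)
    fix n assume n: "n \<in> A - F"
    have "z * q powi n \<noteq> 1" if "z \<in> U" for z
      using app_term_bound(1)[of b q n a z] n that by (auto simp: F_def U_def)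
    thus "app_term q y n holomorphic_on U" unfolding app_term_def[abs_def]
      by (intro holomorphic_intros) auto
  next
    fix z assume "z \<in> U"
    then obtain r where r: "r > 0" "cball z r \<subseteq> U" using U open_contains_cball by blast
    moreover have "(\<lambda>n. 2 * norm ((-1) powi n * q powi (n\<^sup>2) * y powi n)) summable_on A - F"
      by (intro summable_on_cmult_right vt_summable_norm q y)
    moreover have "norm (app_term q y n w) \<le> 2 * norm ((-1) powi n * q powi (n\<^sup>2) * y powi n)"
      if "n \<in> A - F" "w \<in> cball z r" for n w
    proof (rule app_term_bound)
      have "w \<in> U" using that r by blast
      thus "a \<le> norm w" "norm w \<le> b" by (auto simp: U_def)
    qed (use that in \<open>auto simp: F_def\<close>)
    ultimately show "\<exists>r>0. cball z r \<subseteq> U \<and> (\<exists>M. M summable_on A - F \<and> 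
      (\<forall>n\<in>A - F. \<forall>w\<in>cball z r. norm (app_term q y n w) \<le> M n))" by blast
  qed
  hence 1: "(\<lambda>z. \<Sum>\<^sub>\<infinity>n\<in>A - F. app_term q y n z) field_differentiable (at x)"
    using U xU holomorphic_on_imp_differentiable_at by blast
  have 2: "(\<lambda>z. \<Sum>n\<in>A \<inter> F. app_term q y n z) field_differentiable (at x)"
  proof (intro field_differentiable_sum)
    fix n assume "n \<in> A \<inter> F"
    thus "app_term q y n field_differentiable (at x)" unfolding app_term_def[abs_def]
      using A by (intro derivative_intros) auto
  qed
  have eq: "app_on q y A z = (\<Sum>n\<in>A \<inter> F. app_term q y n z) + (\<Sum>\<^sub>\<infinity>n\<in>A - F. app_term q y n z)" if "z \<noteq> 0" for z
  proof -
    have "app_on q y A z = (\<Sum>\<^sub>\<infinity>n\<in>(A \<inter> F) \<union> (A - F). app_term q y n z)" 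
      unfolding app_on_def by (rule arg_cong[where f = "infsum _"]) auto
    also have "\<dots> = infsum (\<lambda>n. app_term q y n z) (A \<inter> F) + (\<Sum>\<^sub>\<infinity>n\<in>A - F. app_term q y n z)"
      by (rule infsum_Un_disjoint) (use app_summable[OF q y that] in auto)
    finally show ?thesis using F by simp
  qed
  show ?thesis
  proof (rule field_differentiable_transform_within[of "norm x" x UNIV])
    show "(\<lambda>z. (\<Sum>n\<in>A \<inter> F. app_term q y n z) + (\<Sum>\<^sub>\<infinity>n\<in>A - F. app_term q y n z)) field_differentiable (at x)"
      by (rule field_differentiable_add[OF 2 1])
    show "(\<Sum>n\<in>A \<inter> F. app_term q y n z) + (\<Sum>\<^sub>\<infinity>n\<in>A - F. app_term q y n z) = app_on q y A z"
      if "dist z x < norm x" for z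
    proof -
      have "z \<noteq> 0" using that by (auto simp: dist_norm)
      thus ?thesis using eq by simp
    qed
  qed (use x in auto)
qed

lemma app_split:
  assumes q: "norm q < 1" "q \<noteq> 0" and y: "y \<noteq> 0" and x: "x \<noteq> 0"
  shows "app q y x = app_term q y n x + app_on q y (-{n}) x"
proof -
  have "app q y x = (\<Sum>\<^sub>\<infinity>m\<in>{n} \<union> (-{n}). app_term q y m x)" 
    unfolding app_on_def by (rule arg_cong[where f = "infsum _"]) auto
  also have "\<dots> = infsum (\<lambda>n. app_term q y n x) {n} + (\<Sum>\<^sub>\<infinity>n\<in>-{n}. app_term q y n x)"
    by (rule infsum_Un_disjoint) (use app_summable[OF q y x] in auto)
  finally show ?thesis by (simp add: app_on_def)
qed

section \<open>Functional equations of the theta series and the Appell sum\<close>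

lemma powi_square_shift:
  assumes "(q::complex) \<noteq> 0"
  shows "q powi ((n - 1)\<^sup>2) = q * (q powi (n\<^sup>2) / (q powi n)\<^sup>2)"
proof -
  have "(n - 1)\<^sup>2 = 1 + n\<^sup>2 - 2 * n" by (simp add: power2_eq_square algebra_simps)
  thus ?thesis using assms by (simp add: power_int_add power_int_diff power_int_mult mult.commute[of 2] power_int_power)
qed

lemma app_shift_term:
  assumes "q \<noteq> 0" "y \<noteq> 0"
  shows "app_term q y (n - 1) (q * x) = - (q / y) * app_term q (y / q\<^sup>2) n x"
proof -
  have 1: "(-1 :: complex) powi (n - 1) = - ((-1) powi n)" by (simp add: power_int_diff)
  have 2: "y powi (n - 1) = y powi n / y" using assms by (simp add: power_int_diff)
  have 3: "(y / q\<^sup>2) powi n = y powi n / (q powi n)\<^sup>2"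
    by (simp add: power_int_divide_distrib power_int_power flip: power_int_mult) (simp add: power_int_power' power_int_power mult.commute)
  have "q * q powi (n - 1) = q powi n" using assms by (simp add: power_int_diff)
  hence 4: "q * x * q powi (n - 1) = x * q powi n" by (metis mult.assoc mult.commute)
  show ?thesis unfolding app_term_def 1 2 3 4 powi_square_shift[OF assms(1)] by (simp add: mult_ac)
qed

lemma app_mult_q:
  assumes "q \<noteq> 0" "y \<noteq> 0"
  shows "app q y (q * x) = - (q / y) * app q (y / q\<^sup>2) x"
proof -
  have "app q y (q * x) = (\<Sum>\<^sub>\<infinity>n. app_term q y (n - 1) (q * x))"
    unfolding app_on_def by (rule infsum_reindex_bij_betw[symmetric]) (rule bij_betwI[of _ _ _ "\<lambda>n. n + 1"], auto)
  also have "\<dots> = - (q / y) * app q (y / q\<^sup>2) x"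
    unfolding app_shift_term[OF assms] app_on_def by (rule infsum_cmult_right')
  finally show ?thesis .
qed

lemma app_inverse:
  assumes q: "q \<noteq> 0" and y: "y \<noteq> 0" and x: "x \<noteq> 0" "\<And>n. x * q powi n \<noteq> 1"
  shows "app q y x = - (1 / x) * app q (q / y) (1 / x)"
proof -
  have t: "app_term q y (- n) x = - (1 / x) * app_term q (q / y) n (1 / x)" for n
  proof -
    have 1: "(-1 :: complex) powi (- n) = (-1) powi n" by (simp add: power_int_minus)
    have 2: "(q / y) powi n = q powi n / y powi n" by (simp add: power_int_divide_distrib)
    have 3: "1 - x * q powi (- n) = - x * (1 - 1 / x * q powi n) / q powi n"
      using q x by (simp add: power_int_minus field_simps)
    have 4: "y powi (- n) = 1 / y powi n" by (simp add: power_int_minus field_simps)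
    have gen: "c * s * (1 / Y) / (- x * D / X) = - (1 / x) * (c * s * (X / Y) / D)" for c s Y X D
      by simp
    show ?thesis unfolding app_term_def 1 2 3 4 power2_minus by (rule gen)
  qed
  have "app q y x = (\<Sum>\<^sub>\<infinity>n. app_term q y (- n) x)"
    unfolding app_on_def by (rule infsum_reindex_bij_betw[symmetric]) (rule bij_betwI[of _ _ _ "\<lambda>n. - n"], auto)
  also have "\<dots> = - (1 / x) * app q (q / y) (1 / x)"
    unfolding t app_on_def by (rule infsum_cmult_right')
  finally show ?thesis .
qed

lemma vt_inverse: "vt q (1 / y) = vt q y"
proof -
  have "vt q (1 / y) = (\<Sum>\<^sub>\<infinity>n. (-1) powi (- n) * q powi ((- n)\<^sup>2) * (1 / y) powi (- n))"
    unfolding vt_def by (rule infsum_reindex_bij_betw[symmetric]) (rule bij_betwI[of _ _ _ "\<lambda>n. - n"], auto)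
  also have "\<dots> = vt q y" unfolding vt_def by (simp add: power_int_minus power_int_divide_distrib)
  finally show ?thesis .
qed

lemma vt_shift:
  assumes "q \<noteq> 0" "y \<noteq> 0"
  shows "vt q (y / q\<^sup>2) = - (y / q) * vt q y"
proof -
  have t: "(-1) powi n * q powi (n\<^sup>2) * (y / q\<^sup>2) powi n = - (y / q) * ((-1) powi (n - 1) * q powi ((n - 1)\<^sup>2) * y powi (n - 1))" for n
  proof -
    have "(-1 :: complex) powi (n - 1) = - ((-1) powi n)" by (simp add: power_int_diff)
    moreover have "y powi (n - 1) = y powi n / y" using assms by (simp add: power_int_diff)
    moreover have "(y / q\<^sup>2) powi n = y powi n / (q powi n)\<^sup>2"
      by (simp add: power_int_divide_distrib power_int_power flip: power_int_mult) (simp add: power_int_power' power_int_power mult.commute)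
    ultimately show ?thesis using powi_square_shift[OF assms(1), of n] assms by simp
  qed
  have "vt q (y / q\<^sup>2) = - (y / q) * (\<Sum>\<^sub>\<infinity>n. (-1) powi (n - 1) * q powi ((n - 1)\<^sup>2) * y powi (n - 1))"
    unfolding vt_def t by (rule infsum_cmult_right')
  also have "(\<Sum>\<^sub>\<infinity>n. (-1) powi (n - 1) * q powi ((n - 1)\<^sup>2) * y powi (n - 1)) = vt q y"
    unfolding vt_def by (rule infsum_reindex_bij_betw) (rule bij_betwI[of _ _ _ "\<lambda>n. n + 1"], auto)
  finally show ?thesis .
qed

text \<open>At y = q the shift law and the symmetry under y -> 1 / y give opposite signs. This
  removes the constant term from the q-difference equation of \<open>app q q\<close>.\<close>

lemma vt_q:
  assumes "q \<noteq> 0"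
  shows "vt q q = 0"
proof -
  have "vt q (1 / q) = - vt q q" using vt_shift[OF assms assms] assms by (simp add: power2_eq_square)
  thus ?thesis using vt_inverse[of q q] by simp
qed

text \<open>After the index shift, the partial fraction 1 / (X^2 (1 - x X)) = x^2 / (1 - x X) + 1 /
  X^2 + x / X with X = q^n separates the Appell sum from two theta series.\<close>

lemma app_qdiff:
  assumes q: "norm q < 1" "q \<noteq> 0" and y: "y \<noteq> 0" and x: "x \<noteq> 0" "\<And>n. x * q powi n \<noteq> 1"
  shows "app q y (q * x) = - (q / y) * x\<^sup>2 * app q y x + vt q y - (q / y) * x * vt q (y / q)"
proof -
  have t: "app_term q (y / q\<^sup>2) n x = x\<^sup>2 * app_term q y n x + 
      ((-1) powi n * q powi (n\<^sup>2) * (y / q\<^sup>2) powi n + x * ((-1) powi n * q powi (n\<^sup>2) * (y / q) powi n))" for n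
  proof -
    have 1: "(y / q\<^sup>2) powi n = y powi n / (q powi n)\<^sup>2" "(y / q) powi n = y powi n / q powi n"
      by (simp add: power_int_divide_distrib power_int_power flip: power_int_mult) 
         (simp_all add: power_int_power' power_int_power mult.commute power_int_divide_distrib)
    have gen: "c * s * (Y / X\<^sup>2) / (1 - x * X) = x\<^sup>2 * (c * s * Y / (1 - x * X)) + (c * s * (Y / X\<^sup>2) + x * (c * s * (Y / X)))"
      if "X \<noteq> 0" "x * X \<noteq> 1" for c s Y X :: complex
      using that by (simp add: divide_simps) (simp add: algebra_simps power2_eq_square)
    show ?thesis unfolding app_term_def 1 by (rule gen) (use q x in auto)
  qed
  have "app q (y / q\<^sup>2) x = (\<Sum>\<^sub>\<infinity>n. x\<^sup>2 * app_term q y n x + 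
      ((-1) powi n * q powi (n\<^sup>2) * (y / q\<^sup>2) powi n + x * ((-1) powi n * q powi (n\<^sup>2) * (y / q) powi n)))"
    unfolding app_on_def t ..
  also have "\<dots> = x\<^sup>2 * app q y x + (vt q (y / q\<^sup>2) + x * vt q (y / q))"
    unfolding app_on_def vt_def using q y x
    by (subst infsum_add infsum_cmult_right'; 
        (intro summable_on_add summable_on_cmult_right app_summable vt_summable)?; simp?)+
  finally have *: "app q (y / q\<^sup>2) x = x\<^sup>2 * app q y x + (- (y / q) * vt q y + x * vt q (y / q))"
    by (simp add: vt_shift[OF q(2) y])
  show ?thesis unfolding app_mult_q[OF q(2) y] * using q y by (simp add: field_simps)
qed

section \<open>The rank function as an Appell sum\<close>

text \<open>A version on a disc: the rank series is available only for |z| < 1 / |q|, so its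
  functional equation holds near the origin and not on the whole punctured plane.\<close>

lemma qdiff_zero_sparse:
  assumes q: "0 < norm q" "norm q < 1" and r: "r > 0"
    and hol: "w holomorphic_on (ball 0 r - {0} - E)"
    and sparse: "\<And>z. z \<in> ball 0 r - {0} \<Longrightarrow> eventually (\<lambda>x. x \<notin> E) (at z)"
    and lim: "\<And>e. e \<in> (ball 0 r - {0}) \<inter> E \<Longrightarrow> \<exists>l. w \<midarrow>e\<rightarrow> l"
    and E: "\<And>z. z \<notin> E \<Longrightarrow> q * z \<notin> E"
    and h: "continuous_on (ball 0 r) h" "h 0 = 0"
    and eq: "\<And>z. z \<in> ball 0 r - {0} - E \<Longrightarrow> w (q * z) = h z * w z"
    and z: "z \<in> ball 0 r - {0} - E"
  shows "w z = 0"
proof -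
  have op: "open (ball 0 r - {0::complex})" by (rule open_delete) simp
  obtain G where G: "G holomorphic_on (ball 0 r - {0})" "\<And>z. z \<in> ball 0 r - {0} - E \<Longrightarrow> G z = w z"
    using removable_discrete[OF op hol sparse lim] by blast
  have qD: "q * x \<in> ball 0 r - {0}" if "x \<in> ball 0 r - {0}" for x
  proof -
    have "norm (q * x) \<le> 1 * norm x" unfolding norm_mult using q by (intro mult_right_mono) auto
    thus ?thesis using that q by auto
  qed
  have contG: "isCont G y" if "y \<in> ball 0 r - {0}" for y
    using holomorphic_on_imp_continuous_on[OF G(1)] continuous_on_eq_continuous_at[OF op] that by blast
  have conth: "isCont h y" if "y \<in> ball 0 r" for y
    using h(1) continuous_on_eq_continuous_at[OF open_ball] that by blast
  have eqG: "G (q * x) = h x * G x" if x: "x \<in> ball 0 r - {0}" for x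
  proof -
    have "isCont (\<lambda>x. G (q * x)) x"
      by (rule isCont_o2[of _ _ G]) (use contG[OF qD[OF x]] in \<open>auto intro!: continuous_intros\<close>)
    hence "isCont (\<lambda>x. G (q * x) - h x * G x) x"
      using x by (intro continuous_intros contG conth) auto
    hence "(\<lambda>x. G (q * x) - h x * G x) \<midarrow>x\<rightarrow> G (q * x) - h x * G x" by (simp add: isCont_def)
    moreover have "eventually (\<lambda>x. x \<in> ball 0 r - {0}) (at x)"
      using op x by (metis eventually_at_topological)
    with sparse[OF x] have "eventually (\<lambda>x. G (q * x) - h x * G x = 0) (at x)"
    proof eventually_elim
      case (elim y)
      thus ?case using G(2)[of y] G(2)[of "q * y"] qD[of y] E[of y] eq[of y] by simp
    qed
    hence "(\<lambda>x. G (q * x) - h x * G x) \<midarrow>x\<rightarrow> 0" by (simp add: tendsto_eventually)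
    ultimately have "G (q * x) - h x * G x = 0" by (rule LIM_unique)
    thus ?thesis by simp
  qed
  have "G z = 0"
    by (rule qdiff_zero[OF q r G(1), of h]) (use conth h(2) r eqG z in auto)
  thus ?thesis using G(2) z by auto
qed

text \<open>The quotient (-q/z; q)_n / (q/z; q)_(n+1). Parts up to n supply numerator and
  denominator factors, while the part n + 1, which must occur, supplies the last denominator
  factor.\<close>

definition rc :: "complex \<Rightarrow> complex \<Rightarrow> nat \<Rightarrow> complex" where
  "rc q z n = (\<Prod>k<n. 1 + q / z * q ^ k) / (\<Prod>k<Suc n. 1 - q / z * q ^ k)"

text \<open>For \<open>|z| = 1\<close> the term of index \<open>n\<close> of \<open>2 q S(z)\<close> counts the overpartitions with largest part \<open>n + 1\<close>.\<close>
definition rS :: "complex \<Rightarrow> complex \<Rightarrow> complex" where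
  "rS q z = (\<Sum>n. rc q z n * (z * q) ^ n)"

text \<open>This is \<open>qp (q / z) q * rS q z\<close> with the denominators cancelled term by
  term, hence holomorphic also at the poles of \<open>rS\<close>.\<close>

definition rT :: "complex \<Rightarrow> complex \<Rightarrow> complex" where
  "rT q z = (\<Sum>\<^sub>\<infinity>n::nat. (z * q) ^ n * (\<Prod>k<n. 1 + q / z * q ^ k) * qp (q / z * q ^ Suc n) q)"

lemma rc_tendsto:
  assumes "norm q < 1" "qp (q / z) q \<noteq> 0"
  shows "rc q z \<longlonglongrightarrow> qp (- (q / z)) q / qp (q / z) q"
  unfolding rc_def using LIMSEQ_qp[OF assms(1), of "- (q / z)"] LIMSEQ_qp[OF assms(1), of "q / z"] assms
  by (intro tendsto_divide filterlim_compose[OF LIMSEQ_qp filterlim_Suc]) auto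

lemma rc_summable:
  assumes q: "norm q < 1" "qp (q / z) q \<noteq> 0" and t: "norm t < 1"
  shows "summable (\<lambda>n. norm (rc q z n * t ^ n))"
proof -
  obtain B where B: "B > 0" "\<And>n. norm (rc q z n) \<le> B"
    using Bseq_def convergent_imp_Bseq convergentI[OF rc_tendsto[OF q]] by blast
  have "summable (\<lambda>n. B * norm t ^ n)" using t by (intro summable_mult summable_geometric) auto
  thus ?thesis
    by (rule summable_comparison_test'[where N = 0])
       (use B in \<open>auto simp: norm_mult norm_power intro!: mult_right_mono\<close>)
qed

text \<open>Multiply the recurrence c(n+1) (1 - (q/z) q^(n+1)) = c(n) (1 + (q/z) q^n) by t^(n+1) and
  sum; c(0) (1 - q/z) = 1 supplies the constant term.\<close>

lemma rc_gen_qdiff: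
  assumes q: "norm q < 1" and nz: "qp (q / z) q \<noteq> 0" and z: "z \<noteq> 0" and t: "norm t < 1"
  shows "(1 - t) * (\<Sum>n. rc q z n * t ^ n) = 1 + q / z * (1 + t) * (\<Sum>n. rc q z n * (t * q) ^ n)"
proof -
  have nz': "q / z * q ^ k \<noteq> 1" for k using nz qp_eq_0_iff[OF q] by blast
  have tq: "norm (t * q) < 1"
    using mult_strict_mono'[OF t q] by (simp add: norm_mult)
  define c where "c = rc q z"
  have rec: "c (Suc n) * (1 - q / z * q ^ Suc n) = c n * (1 + q / z * q ^ n)" for n
  proof -
    have "1 - q / z * q ^ Suc n \<noteq> 0" using nz'[of "Suc n"] by (metis eq_iff_diff_eq_0)
    thus ?thesis by (simp add: c_def rc_def)
  qed
  have s: "summable (\<lambda>n. c n * t ^ n)" "summable (\<lambda>n. c n * (t * q) ^ n)"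
    unfolding c_def by (rule summable_norm_cancel[OF rc_summable[OF q nz]]; fact t tq)+
  define C1 C2 where "C1 = (\<Sum>n. c n * t ^ n)" and "C2 = (\<Sum>n. c n * (t * q) ^ n)"
  have C: "(\<lambda>n. c n * t ^ n) sums C1" "(\<lambda>n. c n * (t * q) ^ n) sums C2"
    using s by (auto simp: C1_def C2_def)
  have 1: "(\<lambda>n. c (Suc n) * t ^ Suc n) sums (C1 - c 0)" "(\<lambda>n. c (Suc n) * (t * q) ^ Suc n) sums (C2 - c 0)"
    using sums_Suc_iff[of "\<lambda>n. c n * t ^ n" "C1 - c 0"]
      sums_Suc_iff[of "\<lambda>n. c n * (t * q) ^ n" "C2 - c 0"] C by (simp_all del: power_Suc)
  have "(\<lambda>n. c (Suc n) * t ^ Suc n - q / z * (c (Suc n) * (t * q) ^ Suc n)) sums (C1 - c 0 - q / z * (C2 - c 0))"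
    by (intro sums_diff sums_mult 1)
  moreover have "c (Suc n) * t ^ Suc n - q / z * (c (Suc n) * (t * q) ^ Suc n) =
      t * (c n * t ^ n) + t * q / z * (c n * (t * q) ^ n)" for n
  proof -
    have "c (Suc n) * t ^ Suc n - q / z * (c (Suc n) * (t * q) ^ Suc n) = 
        (c (Suc n) * (1 - q / z * q ^ Suc n)) * t ^ Suc n"
      by (simp add: algebra_simps power_mult_distrib)
    also have "\<dots> = t * (c n * t ^ n) + t * q / z * (c n * (t * q) ^ n)"
      unfolding rec by (simp add: algebra_simps power_mult_distrib)
    finally show ?thesis .
  qed
  ultimately have "(\<lambda>n. t * (c n * t ^ n) + t * q / z * (c n * (t * q) ^ n)) sums (C1 - c 0 - q / z * (C2 - c 0))"
    by simp
  moreover have "(\<lambda>n. t * (c n * t ^ n) + t * q / z * (c n * (t * q) ^ n)) sums (t * C1 + t * q / z * C2)"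
    by (intro sums_add sums_mult C)
  ultimately have *: "C1 - c 0 - q / z * (C2 - c 0) = t * C1 + t * q / z * C2" by (rule sums_unique2)
  have "c 0 * (1 - q / z) = 1" using nz'[of 0] by (simp add: c_def rc_def)
  hence "c 0 = 1 + q / z * c 0" by (simp add: algebra_simps)
  hence "(1 - t) * C1 = 1 + q / z * (1 + t) * C2" using * by algebra
  thus ?thesis by (simp add: C1_def C2_def c_def)
qed

text \<open>Replacing z by q z shifts each product by one factor. The series at q z thereby reduces
  to the series with coefficients \<open>rc q z\<close> at z q^2, the same one that
  \<open>rc_gen_qdiff\<close> relates to \<open>rS q z\<close>.\<close>

lemma rS_mult_q:
  assumes q: "norm q < 1" "q \<noteq> 0" and nz: "qp (1 / z) q \<noteq> 0" and z: "z \<noteq> 0" "norm (z * q) < 1"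
  shows "rS q (q * z) * (z - 1) = z + (z + 1) * z * q\<^sup>2 * (\<Sum>n. rc q z n * (z * q * q) ^ n)"
proof -
  have z1: "z \<noteq> 1"
    using nz qp_eq_0_iff[OF q(1), of "1/z"] by (auto dest!: spec[of _ 0])
  have nz1: "qp (q / (q * z)) q \<noteq> 0" using nz q by simp
  have nz2: "qp (q / z) q \<noteq> 0" using nz qp_rec[OF q(1), of "1 / z"] by auto
  have tq: "norm (q * z * q) < 1"
    using mult_strict_mono'[OF z(2) q(1)] by (simp add: norm_mult mult_ac)
  have sh: "rc q (q * z) (Suc n) = (z + 1) / (z - 1) * rc q z n" for n
  proof -
    have "rc q (q * z) (Suc n) = (\<Prod>k<Suc n. 1 + 1 / z * q ^ k) / (\<Prod>k<Suc (Suc n). 1 - 1 / z * q ^ k)"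
      using q by (simp add: rc_def)
    also have "(\<Prod>k<Suc n. 1 + 1 / z * q ^ k) = (1 + 1 / z) * (\<Prod>k<n. 1 + q / z * q ^ k)"
      by (subst prod.lessThan_Suc_shift) (simp add: mult_ac)
    also have "(\<Prod>k<Suc (Suc n). 1 - 1 / z * q ^ k) = (1 - 1 / z) * (\<Prod>k<Suc n. 1 - q / z * q ^ k)"
      by (subst prod.lessThan_Suc_shift) (simp add: mult_ac)
    also have "(1 + 1 / z) * A / ((1 - 1 / z) * B) = (z + 1) / (z - 1) * (A / B)" for A B
    proof -
      have "(1 + 1 / z) / (1 - 1 / z) = (z + 1) / (z - 1)" using z z1 by (simp add: field_simps)
      thus ?thesis by (metis times_divide_times_eq)
    qed
    finally show ?thesis by (simp add: rc_def)
  qed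
  have s1: "summable (\<lambda>n. rc q (q * z) n * (q * z * q) ^ n)"
    using rc_summable[OF q(1) nz1 tq] by (rule summable_norm_cancel)
  have "norm (z * q * q) < 1" using tq by (simp add: mult_ac)
  hence s2: "summable (\<lambda>n. rc q z n * (z * q * q) ^ n)"
    by (rule summable_norm_cancel[OF rc_summable[OF q(1) nz2]])
  have "rS q (q * z) = rc q (q * z) 0 + (\<Sum>n. rc q (q * z) (Suc n) * (q * z * q) ^ Suc n)"
    unfolding rS_def using suminf_split_head[OF s1] by simp
  also have "rc q (q * z) 0 = z / (z - 1)" using q z z1 by (simp add: rc_def field_simps)
  also have "(\<lambda>n. rc q (q * z) (Suc n) * (q * z * q) ^ Suc n) = 
      (\<lambda>n. (z + 1) / (z - 1) * (z * q * q) * (rc q z n * (z * q * q) ^ n))"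
    by (auto simp: sh fun_eq_iff mult_ac)
  also have "(\<Sum>n. (z + 1) / (z - 1) * (z * q * q) * (rc q z n * (z * q * q) ^ n)) = 
      (z + 1) / (z - 1) * (z * q * q) * (\<Sum>n. rc q z n * (z * q * q) ^ n)"
    by (rule suminf_mult[OF s2])
  finally have *: "rS q (q * z) = z / (z - 1) + (z + 1) / (z - 1) * (z * q * q) * (\<Sum>n. rc q z n * (z * q * q) ^ n)" .
  have gen: "(z / (z - 1) + (z + 1) / (z - 1) * (z * q * q) * C) * (z - 1) = z + (z + 1) * z * q\<^sup>2 * C" for C
    using z1 by (simp add: divide_simps) (simp add: algebra_simps power2_eq_square)
  show ?thesis unfolding * by (rule gen)
qed

text \<open>Eliminate the auxiliary series \<open>C\<close> between \<open>rc_gen_qdiff\<close> at t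
  = z q and \<open>rS_mult_q\<close>. The combination is arranged to match the two sides of the rank
  identity.\<close>

lemma rS_qdiff:
  assumes q: "norm q < 1" "q \<noteq> 0" and nz: "qp (1 / z) q \<noteq> 0" and z: "z \<noteq> 0" "norm (z * q) < 1"
  shows "((1 + q * z) * (1 + 2 * q * rS q (q * z)) - (1 - q * z)) * (1 - z) = 
     - q * z\<^sup>2 * (1 - q * z) * ((1 + z) * (1 + 2 * q * rS q z) + (1 - z))"
proof -
  have nz2: "qp (q / z) q \<noteq> 0" using nz qp_rec[OF q(1), of "1 / z"] by auto
  define C where "C = (\<Sum>n. rc q z n * (z * q * q) ^ n)"
  have "(1 - z * q) * rS q z = 1 + q / z * (1 + z * q) * C"
    using rc_gen_qdiff[OF q(1) nz2 z] by (simp add: rS_def C_def)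
  hence 1: "z * (1 - z * q) * rS q z = z + q * (1 + z * q) * C" using z by (simp add: field_simps)
  have 2: "rS q (q * z) * (z - 1) = z + (z + 1) * z * q\<^sup>2 * C"
    unfolding C_def by (rule rS_mult_q[OF assms])
  show ?thesis using 1 2 by algebra
qed

text \<open>Away from y = 0 the finite product is at most the exponential of a geometric series, and
  the remaining factor is a value of \<open>qp\<close> on a compact disc; neither bound depends on
  n.\<close>

lemma rT_bound:
  assumes q: "norm q < 1"
  shows "\<exists>B. \<forall>n y. a \<le> norm y \<longrightarrow> a > 0 \<longrightarrow> norm ((\<Prod>k<n. 1 + q / y * q ^ k) * qp (q / y * q ^ Suc n) q) \<le> B"
proof (cases "a > 0")
  case a: True
  define b where "b = norm q / a"
  have "compact (cball (0::complex) b)" by simp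
  moreover have "continuous_on (cball 0 b) (\<lambda>x. qp x q)"
    using holomorphic_qp[OF q] holomorphic_on_imp_continuous_on by blast
  ultimately have "bounded ((\<lambda>x. qp x q) ` cball 0 b)"
    using compact_continuous_image compact_imp_bounded by blast
  then obtain B1 where "\<forall>x\<in>cball 0 b. norm (qp x q) \<le> B1" by (auto simp: bounded_iff)
  hence B1: "norm (qp x q) \<le> B1" if "norm x \<le> b" for x using that by auto
  have "norm ((\<Prod>k<n. 1 + q / y * q ^ k) * qp (q / y * q ^ Suc n) q) \<le> exp (b / (1 - norm q)) * B1"
    if y: "a \<le> norm y" for n y
  proof -
    have qy: "norm (q / y) \<le> b"
      unfolding b_def norm_divide by (rule divide_left_mono[OF y]) (use y a in \<open>auto intro!: mult_pos_pos\<close>)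
    have "norm (\<Prod>k<n. 1 + q / y * q ^ k) \<le> (\<Prod>k<n. 1 + b * norm q ^ k)"
      unfolding prod_norm[symmetric]
    proof (intro prod_mono conjI)
      fix k 
      have "norm (1 + q / y * q ^ k) \<le> 1 + norm (q / y) * norm q ^ k"
        using norm_triangle_ineq[of 1 "q / y * q ^ k"] by (simp add: norm_mult norm_power norm_divide)
      also have "\<dots> \<le> 1 + b * norm q ^ k" using qy by (intro add_left_mono mult_right_mono) auto
      finally show "norm (1 + q / y * q ^ k) \<le> 1 + b * norm q ^ k" .
    qed auto
    also have "\<dots> \<le> exp (\<Sum>k<n. b * norm q ^ k)"
      by (rule prod_le_exp_sum) (use a in \<open>auto simp: b_def\<close>)
    also have "(\<Sum>k<n. b * norm q ^ k) \<le> (\<Sum>k. b * norm q ^ k)"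
      by (intro sum_le_suminf summable_mult summable_geometric) (use q a in \<open>auto simp: b_def\<close>)
    also have "(\<Sum>k. b * norm q ^ k) = b / (1 - norm q)"
      using q by (subst suminf_mult) (auto intro: summable_geometric simp: suminf_geometric)
    finally have 1: "norm (\<Prod>k<n. 1 + q / y * q ^ k) \<le> exp (b / (1 - norm q))" by simp
    have "norm (q / y * q ^ Suc n) \<le> b * 1" unfolding norm_mult norm_power
      by (intro mult_mono qy power_le_one) (use q a in \<open>auto simp: b_def\<close>)
    hence "norm (qp (q / y * q ^ Suc n) q) \<le> B1" using B1 by simp
    thus ?thesis unfolding norm_mult using 1 by (intro mult_mono) auto
  qed
  thus ?thesis by blast
qed auto

lemma holomorphic_rT:
  assumes q: "norm q < 1" "q \<noteq> 0"
  shows "rT q holomorphic_on (ball 0 (1 / norm q) - {0})"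
  unfolding rT_def[abs_def]
proof (rule holomorphic_infsum)
  fix n :: nat
  have "((\<lambda>a. qp a q) \<circ> (\<lambda>z. q / z * q ^ Suc n)) holomorphic_on (ball 0 (1 / norm q) - {0})"
    by (rule holomorphic_on_compose_gen[OF _ holomorphic_qp[OF q(1), of UNIV]]) (auto intro!: holomorphic_intros)
  thus "(\<lambda>z. (z * q) ^ n * (\<Prod>k<n. 1 + q / z * q ^ k) * qp (q / z * q ^ Suc n) q) 
      holomorphic_on (ball 0 (1 / norm q) - {0})"
    unfolding o_def by (intro holomorphic_on_mult holomorphic_on_prod holomorphic_intros) auto
next
  fix x :: complex assume x: "x \<in> ball 0 (1 / norm q) - {0}"
  define U where "U = {z::complex. norm x / 2 < norm z \<and> norm z < (norm x + 1 / norm q) / 2}"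
  have "open U" unfolding U_def by (intro open_Collect_conj open_Collect_less continuous_intros)
  moreover have "x \<in> U" using x by (auto simp: U_def)
  ultimately obtain r where r: "r > 0" "cball x r \<subseteq> U" using open_contains_cball by blast
  obtain B where B: "\<And>n y. norm x / 2 \<le> norm y \<Longrightarrow> norm ((\<Prod>k<n. 1 + q / y * q ^ k) * qp (q / y * q ^ Suc n) q) \<le> B"
    using rT_bound[OF q(1), of "norm x / 2"] x by auto
  have "norm x / 2 \<le> norm x" by simp
  from B[OF this, of 0] have B0: "B \<ge> 0" using norm_ge_zero order_trans by blast
  define \<rho> where "\<rho> = (norm x + 1 / norm q) / 2 * norm q"
  have \<rho>: "0 \<le> \<rho>" "\<rho> < 1" using x q by (auto simp: \<rho>_def field_simps)
  have "(\<lambda>n. \<rho> ^ n * B) summable_on UNIV"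
    using \<rho> B0 by (intro summable_nonneg_imp_summable_on summable_mult2 summable_geometric) auto
  moreover have "norm ((y * q) ^ n * (\<Prod>k<n. 1 + q / y * q ^ k) * qp (q / y * q ^ Suc n) q) \<le> \<rho> ^ n * B"
    if "y \<in> cball x r" for n y
  proof -
    have y: "y \<in> U" using that r by blast
    have "norm (y * q) \<le> \<rho>" unfolding \<rho>_def norm_mult
      by (rule mult_right_mono) (use y in \<open>auto simp: U_def\<close>)
    hence "norm ((y * q) ^ n) \<le> \<rho> ^ n" unfolding norm_power by (intro power_mono) auto
    moreover have "norm ((\<Prod>k<n. 1 + q / y * q ^ k) * qp (q / y * q ^ Suc n) q) \<le> B"
      by (rule B) (use y in \<open>auto simp: U_def\<close>)
    ultimately have "norm ((y * q) ^ n) * norm ((\<Prod>k<n. 1 + q / y * q ^ k) * qp (q / y * q ^ Suc n) q) \<le> \<rho> ^ n * B"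
      using \<rho> by (intro mult_mono) auto
    thus ?thesis by (simp add: norm_mult mult.assoc)
  qed
  moreover have "U \<subseteq> ball 0 (1 / norm q) - {0}"
    using x by (auto simp: U_def)
  ultimately show "\<exists>r>0. cball x r \<subseteq> ball 0 (1 / norm q) - {0} \<and> (\<exists>M. M summable_on UNIV \<and>
     (\<forall>n\<in>UNIV. \<forall>y\<in>cball x r. norm ((y * q) ^ n * (\<Prod>k<n. 1 + q / y * q ^ k) * qp (q / y * q ^ Suc n) q) \<le> M n))"
    using r by blast
qed

lemma qp_split_n: "norm q < 1 \<Longrightarrow> qp a q = (\<Prod>k<n. 1 - a * q ^ k) * qp (a * q ^ n) q"
  by (induction n) (auto simp: qp_rec[of q "a * q ^ _"] mult_ac)

lemma rT_eq:
  assumes q: "norm q < 1" and nz: "qp (q / z) q \<noteq> 0" and z: "norm (z * q) < 1"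
  shows "rT q z = qp (q / z) q * rS q z"
proof -
  have "(z * q) ^ n * (\<Prod>k<n. 1 + q / z * q ^ k) * qp (q / z * q ^ Suc n) q = qp (q / z) q * (rc q z n * (z * q) ^ n)" for n
  proof -
    have "q / z * q ^ k \<noteq> 1" for k using nz qp_eq_0_iff[OF q] by blast
    hence "1 - q / z * q ^ k \<noteq> 0" for k by (metis eq_iff_diff_eq_0)
    hence "(\<Prod>k<Suc n. 1 - q / z * q ^ k) \<noteq> 0" unfolding prod_zero_iff[OF finite_lessThan] by blast
    moreover have "t * N * Q = D * Q * (N / D * t)" if "D \<noteq> 0" for t N Q D :: complex
      using that by simp
    ultimately show ?thesis unfolding rc_def qp_split_n[OF q, of "q / z" "Suc n"] by blast
  qed
  hence "rT q z = qp (q / z) q * (\<Sum>\<^sub>\<infinity>n. rc q z n * (z * q) ^ n)"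
    unfolding rT_def by (simp only: infsum_cmult_right')
  also have "(\<Sum>\<^sub>\<infinity>n. rc q z n * (z * q) ^ n) = rS q z"
    unfolding rS_def
    by (rule infsumI[OF norm_summable_imp_has_sum[OF rc_summable[OF q nz z]
          summable_sums[OF summable_norm_cancel[OF rc_summable[OF q nz z]]]]])
  finally show ?thesis .
qed

text \<open>At z = 1 the series telescopes: 2 q times its n-th term is the difference of consecutive
  values of (-q; q)_n / (q; q)_n.\<close>

lemma rS_qp_1:
  assumes q: "norm q < 1"
  shows "1 + 2 * q * rS q 1 = qp (- q) q / qp q q"
proof -
  have nz: "qp (q / 1) q \<noteq> 0" using qp_q_q_nonzero[OF q] by simp
  define f where "f = (\<lambda>n. (\<Prod>k<n. 1 + q * q ^ k) / (\<Prod>k<n. 1 - q * q ^ k))"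
  have f_lim: "f \<longlonglongrightarrow> qp (- q) q / qp q q" unfolding f_def
    using LIMSEQ_qp[OF q, of "- q"] LIMSEQ_qp[OF q, of q] nz by (intro tendsto_divide) auto
  have nz': "1 - q * q ^ k \<noteq> 0" for k using nz qp_eq_0_iff[OF q, of q] by auto
  have "f (Suc n) - f n = 2 * q * (rc q 1 n * (1 * q) ^ n)" for n
  proof -
    have "(\<Prod>k<n. 1 - q * q ^ k) \<noteq> 0" using nz' by (simp add: prod_zero_iff)
    moreover have "N * (1 + x) / (D * (1 - x)) - N / D = 2 * x * (N / (D * (1 - x)))"
      if "D \<noteq> 0" "1 - x \<noteq> 0" for N D x :: complex
      using that by (simp add: divide_simps) (simp add: algebra_simps)
    ultimately show ?thesis using nz'[of n] by (simp add: f_def rc_def)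
  qed
  hence "(\<lambda>n. 2 * q * (rc q 1 n * (1 * q) ^ n)) sums (qp (- q) q / qp q q - f 0)"
    using telescope_sums[OF f_lim] by simp
  moreover have "(\<lambda>n. 2 * q * (rc q 1 n * (1 * q) ^ n)) sums (2 * q * rS q 1)"
    unfolding rS_def
    by (intro sums_mult summable_sums summable_norm_cancel[OF rc_summable[OF q nz]]) (use q in auto)
  ultimately have "2 * q * rS q 1 = qp (- q) q / qp q q - f 0" by (rule sums_unique2[symmetric])
  thus ?thesis by (simp add: f_def)
qed

lemma orbits_1_iff: "z \<in> orbits q {1} \<longleftrightarrow> (\<exists>k. z = q powi k)"
  by (auto simp: orbits_def)

lemma orbits_1D:
  assumes "q \<noteq> 0" "z \<notin> orbits q {1}"
  shows "z * q powi n \<noteq> 1"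
proof
  assume "z * q powi n = 1"
  hence "z = q powi (- n)" using assms(1) by (simp add: power_int_minus field_simps)
  thus False using assms(2) orbits_1_iff by blast
qed

lemma app_q_qdiff:
  assumes q: "norm q < 1" "q \<noteq> 0" and x: "x \<noteq> 0" "x \<notin> orbits q {1}"
  shows "app q q (q * x) = - x\<^sup>2 * app q q x - x * vt q 1"
  using app_qdiff[OF q q(2) x(1) orbits_1D[OF q(2) x(2)]] q vt_q[OF q(2)] by simp

text \<open>Both sides, divided by \<open>1 - z\<close>, solve the same inhomogeneous equation, whose homogeneous
  part \<open>w (q z) = - q z\<^sup>2 w z\<close> has no solution with at most simple poles on the orbit of 1.\<close>
theorem rank_function_eq:
  assumes q: "norm q < 1" "q \<noteq> 0"
    and z: "z \<in> ball 0 (1 / norm q) - {0} - orbits q {1}"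
  shows "vt q 1 * (1 + z) * (1 + 2 * q * rS q z) = (1 - z) * (vt q 1 + 2 * z * app q q z)"
proof -
  define D where "D = ball 0 (1 / norm q) - {0::complex}"
  define E where "E = orbits q {1}"
  \<comment> \<open>The difference of the two sides times \<open>qp (q / z) q\<close>, written with
    \<open>rT\<close>: the poles of \<open>rS\<close> are cleared and those of the Appell sum become
    removable.\<close>
  define P where "P = (\<lambda>z. vt q 1 * (1 + z) * (qp (q / z) q + 2 * q * rT q z) -
      (1 - z) * qp (q / z) q * (vt q 1 + 2 * z * app q q z))"
  have E: "q * z \<in> E \<longleftrightarrow> z \<in> E" for z unfolding E_def by (rule orbits_mult_q_iff[OF q(2)])
  have nz: "qp (1 / z) q \<noteq> 0" "qp (q / z) q \<noteq> 0" if "z \<noteq> 0" "z \<notin> E" for z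
  proof -
    have "th q (1 / z) \<noteq> 0"
      using orbits_iff_th[OF q that(1), of "{1}"] th_inverse[OF q that(1)] that by (simp add: E_def)
    thus "qp (1 / z) q \<noteq> 0" by (simp add: th_def)
    thus "qp (q / z) q \<noteq> 0" using qp_rec[OF q(1), of "1 / z"] by auto
  qed
  have holqp: "(\<lambda>z. qp (q / z) q) holomorphic_on (-{0})"
  proof -
    have "((\<lambda>a. qp a q) \<circ> (\<lambda>z. q / z)) holomorphic_on (-{0})"
      by (rule holomorphic_on_compose_gen[OF _ holomorphic_qp[OF q(1), of UNIV]]) (auto intro!: holomorphic_intros)
    thus ?thesis by (simp add: o_def)
  qed
  have opD: "open D" unfolding D_def by (rule open_delete) simp
  have D0: "D \<subseteq> -{0}" by (auto simp: D_def)
  have P_eq: "P z = qp (q / z) q * (vt q 1 * (1 + z) * (1 + 2 * q * rS q z) - (1 - z) * (vt q 1 + 2 * z * app q q z))"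
    if "z \<in> D - E" for z
  proof -
    have "norm (z * q) < 1" using that q by (auto simp: D_def norm_mult field_simps)
    hence "rT q z = qp (q / z) q * rS q z" using nz[of z] that by (intro rT_eq q) (auto simp: D_def)
    thus ?thesis by (simp add: P_def algebra_simps)
  qed
  have "P z = 0"
  proof (rule qdiff_zero_sparse[of q "1 / norm q" P E "\<lambda>z. q * z * (1 - q * z)"])
    have app_hol: "app q q holomorphic_on D - E"
    proof -
      have "app q q field_differentiable (at x)" if "x \<in> D - E" for x
        by (rule app_on_differentiable) (use that q orbits_1D[of q x] in \<open>auto simp: D_def E_def\<close>)
      thus ?thesis using field_differentiable_at_within holomorphic_on_def by blast
    qed
    have qpD: "(\<lambda>z. qp (q / z) q) holomorphic_on D - E" "rT q holomorphic_on D - E"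
      using holomorphic_rT[OF q] D0 by (auto intro: holomorphic_on_subset[OF holqp] holomorphic_on_subset simp: D_def)
    show "P holomorphic_on ball 0 (1 / norm q) - {0} - E"
      unfolding P_def D_def[symmetric]
      by (intro holomorphic_on_diff holomorphic_on_mult holomorphic_on_add holomorphic_on_const holomorphic_on_ident
          qpD app_hol)
    show "eventually (\<lambda>x. x \<notin> E) (at z)" if "z \<in> ball 0 (1 / norm q) - {0}" for z
      unfolding E_def by (rule orbits_sparse[OF q]) (use that in auto)
    show "\<exists>l. P \<midarrow>e\<rightarrow> l" if e: "e \<in> (ball 0 (1 / norm q) - {0}) \<inter> E" for e
    proof -
      obtain k where k: "e = q powi k" using e by (auto simp: E_def orbits_1_iff)
      have e0: "e \<noteq> 0" using e by auto
      \<comment> \<open>Already q^(-1) lies on the boundary of the disc, so only nonnegative powers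
        of q are poles inside.\<close>
      have k0: "k \<ge> 0"
      proof (rule ccontr)
        assume "\<not> k \<ge> 0"
        hence "norm q powi (-1) \<le> norm q powi k" using q by (intro power_int_decreasing) auto
        thus False using e k q by (auto simp: norm_power_int power_int_minus field_simps)
      qed
      define ch where "ch = (\<lambda>z. (1 - z) * qp (q / z) q)"
      have ch_diff: "ch field_differentiable (at e)" unfolding ch_def
        using holomorphic_on_imp_differentiable_at[OF holqp, of e] e0
        by (intro derivative_intros) auto
      \<comment> \<open>The pole at 1 is met by the factor 1 - z, the pole at q^k with k > 0 by the
        factor of index k - 1 of \<open>qp (q / z) q\<close>.\<close>
      have ch0: "ch e = 0"
      proof (cases "k = 0")
        case False
        hence "q * q ^ nat (k - 1) = e" using k k0 q by (simp add: power_int_def power_eq_if nat_diff_distrib)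
        hence "q / e * q ^ nat (k - 1) = 1" using e0 by simp
        thus ?thesis using qp_eq_0_iff[OF q(1)] by (auto simp: ch_def)
      qed (simp add: ch_def k)
      obtain l1 where l1: "(\<lambda>z. ch z / (z - e)) \<midarrow>e\<rightarrow> l1" using lim_divide_zero[OF ch_diff ch0] by blast
      define c where "c = (-1) powi (- k) * q powi ((- k)\<^sup>2) * q powi (- k)"
      have "app_on q q (- {- k}) field_differentiable (at e)"
      proof (rule app_on_differentiable[OF q q(2) e0])
        fix n assume "n \<in> - {- k}"
        thus "e * q powi n \<noteq> 1" using power_int_eq_1_iff[OF q, of "k + n"] q
          by (auto simp: k power_int_add)
      qed
      hence l2: "app_on q q (- {- k}) \<midarrow>e\<rightarrow> app_on q q (- {- k}) e"
        using field_differentiable_imp_continuous_at isCont_def by blast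
      have "isCont (rT q) e" "isCont (\<lambda>z. qp (q / z) q) e"
        using holomorphic_on_imp_continuous_on[OF holomorphic_rT[OF q]] 
          holomorphic_on_imp_continuous_on[OF holqp] e e0 opD
        by (auto simp: continuous_on_eq_continuous_at D_def open_Compl)
      hence l3: "rT q \<midarrow>e\<rightarrow> rT q e" "(\<lambda>z. qp (q / z) q) \<midarrow>e\<rightarrow> qp (q / e) q" by (simp_all add: isCont_def)
      have "(\<lambda>z. vt q 1 * (1 + z) * (qp (q / z) q + 2 * q * rT q z) -
          ((1 - z) * qp (q / z) q * vt q 1 + 2 * z * (- c * e * (ch z / (z - e)) + (1 - z) * qp (q / z) q * app_on q q (- {- k}) z)))
          \<midarrow>e\<rightarrow> vt q 1 * (1 + e) * (qp (q / e) q + 2 * q * rT q e) -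
          ((1 - e) * qp (q / e) q * vt q 1 + 2 * e * (- c * e * l1 + (1 - e) * qp (q / e) q * app_on q q (- {- k}) e))"
        by (intro tendsto_intros l1 l2 l3)
      moreover have "eventually (\<lambda>z. z \<noteq> e) (at e)" "eventually (\<lambda>z. z \<noteq> 0) (at e)" 
        by (simp_all add: eventually_neq_at_within)
      hence "eventually (\<lambda>z. vt q 1 * (1 + z) * (qp (q / z) q + 2 * q * rT q z) -
          ((1 - z) * qp (q / z) q * vt q 1 + 2 * z * (- c * e * (ch z / (z - e)) + (1 - z) * qp (q / z) q * app_on q q (- {- k}) z))
          = P z) (at e)"
      proof eventually_elim
        case (elim z)
        have 1: "1 - z * q powi (- k) = - (z - e) / e" using e0 by (simp add: k power_int_minus field_simps)
        have "app q q z = c / (- (z - e) / e) + app_on q q (- {- k}) z"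
          unfolding app_split[OF q q(2) elim(2), of "- k"] app_term_def 1 c_def ..
        also have "c / (- (z - e) / e) = - c * e / (z - e)" using elim e0 by (simp add: field_simps)
        finally have ap: "app q q z = - c * e / (z - e) + app_on q q (- {- k}) z" .
        show ?case unfolding P_def ap by (simp add: ch_def divide_inverse algebra_simps)
      qed
      ultimately show ?thesis by (intro exI) (rule Lim_transform_eventually)
    qed
    show "q * z \<notin> E" if "z \<notin> E" for z using that E by simp
    \<comment> \<open>Passing from \<open>qp (q / z) q\<close> to \<open>qp (1 / z) q\<close>
      contributes -(1 - z) / z. This cancels the denominator 1 - z of the multiplier and lowers the
      power of z by one, but the new multiplier still vanishes at 0.\<close>
    show "P (q * z) = q * z * (1 - q * z) * P z" if z: "z \<in> ball 0 (1 / norm q) - {0} - E" for z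
    proof -
      have z': "z \<in> D - E" "z \<noteq> 0" "z \<notin> E" using z by (auto simp: D_def)
      have "norm (q * z) \<le> 1 * norm z" unfolding norm_mult using q by (intro mult_right_mono) auto
      hence qz: "q * z \<in> D - E" using z' E[of z] q by (auto simp: D_def)
      have zq: "norm (z * q) < 1" using z q by (auto simp: norm_mult field_simps)
      have z1: "z \<noteq> 1" using z'(3) orbits_1_iff[of 1 q] by (auto simp: E_def dest!: spec[of _ 0])
      define v where "v = vt q 1"
      have 1: "((1 + q * z) * (1 + 2 * q * rS q (q * z)) - (1 - q * z)) * (1 - z) =
          - q * z\<^sup>2 * (1 - q * z) * ((1 + z) * (1 + 2 * q * rS q z) + (1 - z))"
        by (rule rS_qdiff[OF q _ z'(2) zq]) (use nz z' in auto)
      have 2: "app q q (q * z) = - z\<^sup>2 * app q q z - z * v"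
        using app_q_qdiff[OF q z'(2)] z'(3) by (simp add: E_def v_def)
      have 3: "qp (q / (q * z)) q * z = - ((1 - z) * qp (q / z) q)"
        using qp_rec[OF q(1), of "1 / z"] q z' by (simp add: field_simps)
      have "(1 - z) * (v * (1 + q * z) * (1 + 2 * q * rS q (q * z)) - (1 - q * z) * (v + 2 * (q * z) * app q q (q * z)))
         = - q * z\<^sup>2 * (1 - q * z) * (v * (1 + z) * (1 + 2 * q * rS q z) - (1 - z) * (v + 2 * z * app q q z))"
        unfolding 2 using 1 by algebra
      hence "z * ((1 - z) * P (q * z)) = z * ((1 - z) * (q * z * (1 - q * z) * P z))"
        unfolding P_eq[OF z'(1)] P_eq[OF qz] v_def[symmetric] using 3 by algebra
      thus ?thesis using z' z1 by simp
    qed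
  qed (use q z in \<open>auto simp: E_def intro!: continuous_intros\<close>)
  moreover have "z \<in> D - E" using z by (simp add: D_def E_def)
  ultimately show ?thesis using P_eq[of z] nz(2)[of z] by (auto simp: D_def)
qed

text \<open>Gauss's identity, as the limit z -> 1 of the rank identity: on the right (1 - z) times
  the Appell sum tends to 1, the contribution of the index 0; on the left the series has the value
  found in \<open>rS_qp_1\<close>.\<close>

theorem gauss_vt:
  assumes q: "norm q < 1" "q \<noteq> 0"
  shows "vt q 1 * qp (- q) q = qp q q"
proof -
  have q1: "1 < 1 / norm q" using q by (simp add: field_simps)
  have T: "rT q 1 = qp q q * rS q 1"
    using rT_eq[OF q(1), of 1] qp_q_q_nonzero[OF q(1)] q by simp
  \<comment> \<open>F and G are the two sides times \<open>qp (q / z) q\<close>, rewritten so that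
    both have evident limits at 1.\<close>
  define F where "F = (\<lambda>z. vt q 1 * (1 + z) * (qp (q / z) q + 2 * q * rT q z))"
  define G where "G = (\<lambda>z. qp (q / z) q * ((1 - z) * vt q 1 + 2 * z * (1 + (1 - z) * app_on q q (- {0}) z)))"
  have op: "open (ball 0 (1 / norm q) - {0::complex})" by (rule open_delete) simp
  have "isCont (rT q) 1"
  proof -
    have "1 \<in> ball 0 (1 / norm q) - {0::complex}" using q1 by simp
    thus ?thesis
      using holomorphic_on_imp_continuous_on[OF holomorphic_rT[OF q]] continuous_on_eq_continuous_at[OF op] by blast
  qed
  hence l1: "rT q \<midarrow>1\<rightarrow> rT q 1" by (simp add: isCont_def)
  have "isCont (\<lambda>a. qp a q) (q / 1)" 
    using holomorphic_on_imp_continuous_on[OF holomorphic_qp[OF q(1), of UNIV]] by (simp add: continuous_on_eq_continuous_at)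
  hence l2: "(\<lambda>z. qp (q / z) q) \<midarrow>1\<rightarrow> qp (q / 1) q" by (rule isCont_tendsto_compose) (intro tendsto_intros, auto)
  have "app_on q q (- {0}) field_differentiable (at 1)"
    by (rule app_on_differentiable) (use q power_int_eq_1_iff[OF q] in auto)
  hence l3: "app_on q q (- {0}) \<midarrow>1\<rightarrow> app_on q q (- {0}) 1"
    using field_differentiable_imp_continuous_at isCont_def by blast
  have "F \<midarrow>1\<rightarrow> vt q 1 * (1 + 1) * (qp (q / 1) q + 2 * q * rT q 1)"
    unfolding F_def by (intro tendsto_intros l1 l2)
  moreover have "G \<midarrow>1\<rightarrow> qp (q / 1) q * ((1 - 1) * vt q 1 + 2 * 1 * (1 + (1 - 1) * app_on q q (- {0}) 1))"
    unfolding G_def by (intro tendsto_intros l2 l3)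
  moreover have "eventually (\<lambda>z. z \<notin> orbits q {1}) (at 1)" by (rule orbits_sparse[OF q]) auto
  moreover have "eventually (\<lambda>z. z \<in> ball 0 (1 / norm q) - {0}) (at (1::complex))"
    using op q1 by (intro eventually_at_in_open') auto
  ultimately have "vt q 1 * (1 + 1) * (qp (q / 1) q + 2 * q * rT q 1) = 
      qp (q / 1) q * ((1 - 1) * vt q 1 + 2 * 1 * (1 + (1 - 1) * app_on q q (- {0}) 1))"
  proof -
    assume F: "F \<midarrow>1\<rightarrow> vt q 1 * (1 + 1) * (qp (q / 1) q + 2 * q * rT q 1)"
      and G: "G \<midarrow>1\<rightarrow> qp (q / 1) q * ((1 - 1) * vt q 1 + 2 * 1 * (1 + (1 - 1) * app_on q q (- {0}) 1))"
      and ev: "eventually (\<lambda>z. z \<notin> orbits q {1}) (at 1)" "eventually (\<lambda>z. z \<in> ball 0 (1 / norm q) - {0}) (at (1::complex))"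
    from ev have "eventually (\<lambda>z. F z = G z) (at 1)"
    proof eventually_elim
      case (elim z)
      have z1: "z \<noteq> 1" using elim(1) orbits_1_iff[of 1 q] by (auto dest!: spec[of _ 0])
      have "th q z \<noteq> 0" using orbits_iff_th[OF q, of z "{1}"] elim by auto
      hence nz: "qp (q / z) q \<noteq> 0" by (simp add: th_def)
      have "rT q z = qp (q / z) q * rS q z"
        using elim q nz by (intro rT_eq) (auto simp: norm_mult field_simps)
      hence "F z = qp (q / z) q * (vt q 1 * (1 + z) * (1 + 2 * q * rS q z))" by (simp add: F_def algebra_simps)
      also have "\<dots> = qp (q / z) q * ((1 - z) * (vt q 1 + 2 * z * app q q z))"
        using rank_function_eq[OF q, of z] elim by simp
      also have "(1 - z) * (vt q 1 + 2 * z * app q q z) = (1 - z) * vt q 1 + 2 * z * (1 + (1 - z) * app_on q q (- {0}) z)"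
      proof -
        have "(1 - z) * app q q z = 1 + (1 - z) * app_on q q (- {0}) z"
          using app_split[OF q q(2), of z 0] elim z1 by (simp add: app_term_def distrib_left)
        thus ?thesis by algebra
      qed
      finally show ?case by (simp add: G_def)
    qed
    from Lim_transform_eventually[OF F this] G show ?thesis by (rule LIM_unique)
  qed
  hence "vt q 1 * (qp q q + 2 * q * (qp q q * rS q 1)) = qp q q" by (simp add: T)
  hence "vt q 1 * (qp q q * (1 + 2 * q * rS q 1)) = qp q q" by (simp add: algebra_simps)
  thus ?thesis using rS_qp_1[OF q(1)] qp_q_q_nonzero[OF q(1)] by simp
qed

text \<open>Numerator and denominator have the same multiplier under z -> q^2 z, and
  \<open>vt q\<close> vanishes at the zero 1 / q of the denominator; the quotient is therefore
  q^2-periodic with removable poles.\<close>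

lemma vt_th_ratio:
  assumes q: "norm q < 1" "q \<noteq> 0" and z: "z \<noteq> 0" "th (q\<^sup>2) (q * z) \<noteq> 0" "z' \<noteq> 0" "th (q\<^sup>2) (q * z') \<noteq> 0"
  shows "vt q z / th (q\<^sup>2) (q * z) = vt q z' / th (q\<^sup>2) (q * z')"
proof -
  have q2: "norm (q\<^sup>2) < 1" "q\<^sup>2 \<noteq> 0" using q by (auto simp: norm_power power_less_one_iff)
  have orb: "x \<in> orbits (q\<^sup>2) {1 / q} \<longleftrightarrow> th (q\<^sup>2) (q * x) = 0" if "x \<noteq> 0" for x
    using orbits_iff_th[OF q2 that, of "{1 / q}"] q by (simp add: mult.commute)
  have "(\<lambda>z. vt q z / th (q\<^sup>2) (q * z)) z = (\<lambda>z. vt q z / th (q\<^sup>2) (q * z)) z'"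
  proof (rule qdiff_meromorphic_const[OF q2, of "{1 / q}" "\<lambda>z. vt q z / th (q\<^sup>2) (q * z)"])
    show "(\<lambda>z. vt q z / th (q\<^sup>2) (q * z)) holomorphic_on - {0} - orbits (q\<^sup>2) {1 / q}"
      by (intro holomorphic_on_divide holomorphic_th_mult q2 q holomorphic_on_subset[OF holomorphic_vt[OF q]])
         (use orb in auto)
    show "vt q (q\<^sup>2 * x) / th (q\<^sup>2) (q * (q\<^sup>2 * x)) = vt q x / th (q\<^sup>2) (q * x)"
      if x: "x \<noteq> 0" "x \<notin> orbits (q\<^sup>2) {1 / q}" for x
    proof -
      have 1: "vt q x = - (q * x) * vt q (q\<^sup>2 * x)"
        using vt_shift[OF q(2), of "q\<^sup>2 * x"] q x by (simp add: power2_eq_square field_simps)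
      have 2: "th (q\<^sup>2) (q\<^sup>2 * (q * x)) = - th (q\<^sup>2) (q * x) / (q * x)"
        by (rule th_mult_q[OF q2]) (use q x in auto)
      have 3: "q * (q\<^sup>2 * x) = q\<^sup>2 * (q * x)" by (simp add: mult_ac)
      show ?thesis unfolding 3 2 1 using q x by (simp add: field_simps)
    qed
    show "\<exists>l. (\<lambda>z. vt q z / th (q\<^sup>2) (q * z)) \<midarrow>s\<rightarrow> l" if "s \<in> {1 / q}" for s
    proof -
      have s: "s = 1 / q" using that by simp
      define F where "F = (\<lambda>z. vt q z / ths (q\<^sup>2) (q * z))"
      have "F field_differentiable (at s)" unfolding F_def
        using holomorphic_on_imp_differentiable_at[OF holomorphic_vt[OF q], of s] q s qp_q_q_nonzero[OF q2(1)]
        by (intro derivative_intros th_mult_field_differentiable q2) (auto simp: ths_1)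
      moreover have "F s = 0" using vt_q[OF q(2)] vt_inverse[of q q] by (simp add: F_def s)
      ultimately obtain l where l: "(\<lambda>z. F z / (z - s)) \<midarrow>s\<rightarrow> l" using lim_divide_zero by blast
      have "(\<lambda>z. - s * (F z / (z - s))) \<midarrow>s\<rightarrow> - s * l" by (intro tendsto_intros l)
      moreover have "- s * (F z / (z - s)) = vt q z / th (q\<^sup>2) (q * z)" for z
      proof -
        have "1 - q * z = - (z - s) / s" using q by (simp add: s field_simps)
        hence t: "th (q\<^sup>2) (q * z) = - (z - s) / s * ths (q\<^sup>2) (q * z)" by (simp add: th_eq_ths[OF q2(1), of "q * z"])
        have "s \<noteq> 0" using q s by simp
        moreover have "- s * (V / T / d) = V / (- d / s * T)" if "s \<noteq> 0" for V T d
          using that by (simp add: mult_ac)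
        ultimately show ?thesis unfolding F_def t by blast
      qed
      ultimately show ?thesis by auto
    qed
  qed (use q z orb in auto)
  thus ?thesis by simp
qed

text \<open>The quotient of both sides is constant, and Gauss's identity evaluates it at z = 1. At
  zeros of the theta function the identity follows by continuity.\<close>

theorem jacobi_triple_vt:
  assumes q: "norm q < 1" "q \<noteq> 0" and z: "z \<noteq> 0"
  shows "vt q z = qp (q\<^sup>2) (q\<^sup>2) * th (q\<^sup>2) (q * z)"
proof -
  have q2: "norm (q\<^sup>2) < 1" "q\<^sup>2 \<noteq> 0" using q by (auto simp: norm_power power_less_one_iff)
  have nz1: "th (q\<^sup>2) (q * 1) \<noteq> 0" using th_power_nonzero[OF q, of 2 1] by simp
  have th1: "th (q\<^sup>2) (q * 1) = (qp q (q\<^sup>2))\<^sup>2" using q by (simp add: th_def power2_eq_square)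
  have J: "qp q q \<noteq> 0" "qp (q\<^sup>2) (q\<^sup>2) \<noteq> 0" using qp_q_q_nonzero q q2 by auto
  have a: "qp q q * qp (- q) q = qp (q\<^sup>2) (q\<^sup>2)" by (rule qp_mult_minus[OF q(1)])
  have b: "qp q q = qp q (q\<^sup>2) * qp (q\<^sup>2) (q\<^sup>2)" using qp_split2[OF q(1), of q] by (simp add: power2_eq_square)
  have "vt q 1 * qp (q\<^sup>2) (q\<^sup>2) = (qp q (q\<^sup>2) * qp (q\<^sup>2) (q\<^sup>2))\<^sup>2"
    using gauss_vt[OF q] a b by algebra
  hence v1: "vt q 1 = qp (q\<^sup>2) (q\<^sup>2) * th (q\<^sup>2) (q * 1)"
    using J th1 by (simp add: power2_eq_square)
  have ev: "vt q x = qp (q\<^sup>2) (q\<^sup>2) * th (q\<^sup>2) (q * x)" if "x \<noteq> 0" "th (q\<^sup>2) (q * x) \<noteq> 0" for x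
    using vt_th_ratio[OF q that _ nz1] v1 nz1 that by (simp add: field_simps)
  show ?thesis
  proof (cases "th (q\<^sup>2) (q * z) = 0")
    case False thus ?thesis by (rule ev[OF z])
  next
    case True
    have "eventually (\<lambda>x. x \<notin> orbits (q\<^sup>2) {1 / q}) (at z)" by (rule orbits_sparse[OF q2]) (use q z in auto)
    moreover have "eventually (\<lambda>x. x \<noteq> 0) (at z)" using z by (simp add: eventually_neq_at_within)
    ultimately have "eventually (\<lambda>x. vt q x = qp (q\<^sup>2) (q\<^sup>2) * th (q\<^sup>2) (q * x)) (at z)"
    proof eventually_elim
      case (elim x)
      show ?case by (rule ev) (use elim orbits_iff_th[OF q2, of x "{1 / q}"] q in \<open>auto simp: mult.commute\<close>)
    qed
    note ev' = this
    have lv: "vt q \<midarrow>z\<rightarrow> vt q z"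
      using holomorphic_on_imp_differentiable_at[OF holomorphic_vt[OF q], of z] z
        field_differentiable_imp_continuous_at isCont_def by blast
    have "(\<lambda>x. th (q\<^sup>2) (q * x)) \<midarrow>z\<rightarrow> th (q\<^sup>2) (q * z)"
      using th_mult_field_differentiable(1)[OF q2(1) q(2) z] field_differentiable_imp_continuous_at isCont_def by blast
    hence "(\<lambda>x. qp (q\<^sup>2) (q\<^sup>2) * th (q\<^sup>2) (q * x)) \<midarrow>z\<rightarrow> qp (q\<^sup>2) (q\<^sup>2) * th (q\<^sup>2) (q * z)" by (intro tendsto_intros)
    from LIM_unique[OF Lim_transform_eventually[OF lv ev'] this] show ?thesis .
  qed
qed

section \<open>The three-term relation for Appell sums\<close>

text \<open>The zero of F at s removes the simple pole of 1 / (1 - b z); in the applications F s = 0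
  is an equality of residues.\<close>

lemma lim_simple_pole_cancel:
  fixes F h :: "complex \<Rightarrow> complex"
  assumes b: "b * s = 1" and F: "F field_differentiable (at s)" "F s = 0" and h: "isCont h s"
    and eq: "eventually (\<lambda>z. w z = F z / (1 - b * z) + h z) (at s)"
  shows "\<exists>l. w \<midarrow>s\<rightarrow> l"
proof -
  obtain l where l: "(\<lambda>z. F z / (z - s)) \<midarrow>s\<rightarrow> l" using lim_divide_zero[OF F] by blast
  have s: "s \<noteq> 0" using b by auto
  have "(\<lambda>z. - s * (F z / (z - s)) + h z) \<midarrow>s\<rightarrow> - s * l + h s"
    using h by (intro tendsto_intros l) (simp add: isCont_def)
  moreover have "eventually (\<lambda>z. - s * (F z / (z - s)) + h z = w z) (at s)"
    using eq
  proof eventually_elim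
    case (elim z)
    have "s * (1 - b * z) = s - (b * s) * z" by (simp add: algebra_simps)
    hence "1 - b * z = (s - z) / s" using s by (simp add: b field_simps)
    hence "F z / (1 - b * z) = F z / ((s - z) / s)" by simp
    also have "\<dots> = - s * (F z / (z - s))" using s by (cases "z = s") (auto simp: field_simps)
    finally show ?case using elim by simp
  qed
  ultimately show ?thesis by (intro exI) (rule Lim_transform_eventually)
qed

lemma vt_1_nonzero:
  assumes "norm q < 1" "q \<noteq> 0"
  shows "vt q 1 \<noteq> 0"
  using gauss_vt[OF assms] qp_q_q_nonzero[OF assms(1)] by auto

text \<open>\<open>ths q\<close> is invariant under z -> 1 / z, so its derivative at the fixed point
  1 equals its own negative.\<close>

lemma deriv_ths_1:
  assumes q: "norm q < 1"
  shows "(ths q has_field_derivative 0) (at 1)"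
proof -
  define D where "D = deriv (ths q) 1"
  have D: "(ths q has_field_derivative D) (at 1)" unfolding D_def by (rule th_DERIV(2)[OF q]) simp
  have "((\<lambda>z. ths q (1 / z)) has_field_derivative D * - 1) (at 1)"
    by (rule DERIV_chain2[of "ths q" D]) (use D in \<open>auto intro!: derivative_eq_intros\<close>)
  moreover have "(\<lambda>z. ths q (1 / z)) = ths q" by (simp add: ths_def fun_eq_iff mult_ac)
  ultimately have "(ths q has_field_derivative D * - 1) (at 1)" by (simp only:)
  from DERIV_unique[OF D this] have "D = 0" by simp
  thus ?thesis using D by simp
qed

locale app_param =
  fixes q a :: complex
  assumes q: "norm q < 1" "q \<noteq> 0" and a: "a \<noteq> 0"
    and th_a: "th q a \<noteq> 0" "th q (a\<^sup>2) \<noteq> 0" "th q (- a) \<noteq> 0"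
begin

text \<open>\<open>C\<close> cancels the linear inhomogeneous terms in \<open>W_qdiff\<close>.
  \<open>Kc\<close> normalizes the theta quotient so that its residue at z = a is that of the Appell
  sum there, and \<open>M\<close> is this quotient without its factor 1 / (1 - z / a), whence
  \<open>M a = 1\<close>.\<close>

definition "C = 2 * a * vt q (a\<^sup>2) / vt q 1"
definition "Kc = (qp q q)\<^sup>2 * th q a * th q (a\<^sup>2) / th q (- a)"
definition "M z = Kc * th q (- z) / (th q z * th q (a * z) * ths q (1 / a * z))"

lemma J: "qp q q \<noteq> 0"
  by (rule qp_q_q_nonzero[OF q(1)])

lemma th_inv_a: "th q (1 / a) = - th q a / a" "th q (1 / a\<^sup>2) = - th q (a\<^sup>2) / a\<^sup>2" "th q (- (1 / a)) = th q (- a) / a"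
  using th_inverse[OF q a] th_inverse[OF q, of "a\<^sup>2"] th_inverse[OF q, of "- a"] a by simp_all

lemma powi_ne_1:
  assumes "x \<noteq> 0" "th q x \<noteq> 0"
  shows "x * q powi n \<noteq> 1"
  using orbits_1D[OF q(2)] orbits_iff_th[OF q assms(1), of "{1}"] assms by simp

lemma differentiable_app_mult:
  assumes "y \<noteq> 0" "b \<noteq> 0" "x \<noteq> 0" "\<And>n. n \<in> A \<Longrightarrow> b * x * q powi n \<noteq> 1"
  shows "(\<lambda>z. app_on q y A (b * z)) field_differentiable (at x)"
proof -
  have "app_on q y A field_differentiable (at (b * x))"
    by (rule app_on_differentiable[OF q]) (use assms in auto)
  moreover have "(\<lambda>z. b * z) field_differentiable (at x)" by (intro derivative_intros)
  ultimately show ?thesis using field_differentiable_compose[of "\<lambda>z. b * z" x "app_on q y A"] by (simp add: o_def)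
qed

lemma differentiable_app_nz:
  assumes "y \<noteq> 0" "b \<noteq> 0" "x \<noteq> 0" "th q (b * x) \<noteq> 0"
  shows "(\<lambda>z. app q y (b * z)) field_differentiable (at x)"
  by (rule differentiable_app_mult[OF assms(1-3)], rule powi_ne_1) (use assms in auto)

lemma differentiable_app_pole:
  assumes "y \<noteq> 0" "b * x = 1"
  shows "(\<lambda>z. app_on q y (- {0}) (b * z)) field_differentiable (at x)"
proof (rule differentiable_app_mult)
  show "b * x * q powi n \<noteq> 1" if "n \<in> - {0}" for n
    using that power_int_eq_1_iff[OF q, of n] assms(2) by simp
qed (use assms in auto)

lemma th_mult_cont:
  assumes "b \<noteq> 0" "z \<noteq> 0"
  shows "(\<lambda>z. th q (b * z)) field_differentiable (at z)" "(\<lambda>z. ths q (b * z)) field_differentiable (at z)"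
  by (rule th_mult_field_differentiable[OF q(1) assms])+

lemma app_zero_term: "y \<noteq> 0 \<Longrightarrow> x \<noteq> 0 \<Longrightarrow> app q y x = 1 / (1 - x) + app_on q y (- {0}) x"
  using app_split[OF q, of y x 0] by (simp add: app_term_def)

lemma M_a: "M a = 1"
  using th_a J a by (simp add: M_def Kc_def ths_1 power2_eq_square)

text \<open>This value of \<open>C\<close> makes the poles at \<open>z = 1\<close> of the two sides of the three-term relation cancel.\<close>
lemma C_eq: "C = - Kc * th q (- 1) / ((qp q q)\<^sup>2 * th q a * th q (1 / a))"
proof -
  have q2: "norm (q\<^sup>2) < 1" "q\<^sup>2 \<noteq> 0" using q by (auto simp: norm_power power_less_one_iff)
  define J1 J2 where "J1 = qp q q" and "J2 = qp (q\<^sup>2) (q\<^sup>2)"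
  have Jnz: "J1 \<noteq> 0" "J2 \<noteq> 0" using J qp_q_q_nonzero[OF q2(1)] by (auto simp: J1_def J2_def)
  have t1: "th (q\<^sup>2) q * J2\<^sup>2 = J1\<^sup>2"
    using qp_split2[OF q(1), of q] q by (simp add: th_def J1_def J2_def power2_eq_square mult_ac)
  have t2: "J1\<^sup>2 * th q (- 1) = 2 * J2\<^sup>2"
  proof -
    have "qp (- 1) q = 2 * qp (- q) q" using qp_rec[OF q(1), of "- 1"] by simp
    moreover have "J1 * qp (- q) q = J2" unfolding J1_def J2_def by (rule qp_mult_minus[OF q(1)])
    moreover have "th q (- 1) = qp (- 1) q * qp (- q) q" by (simp add: th_def)
    ultimately show ?thesis by algebra
  qed
  have v1: "vt q 1 = J2 * th (q\<^sup>2) q" using jacobi_triple_vt[OF q, of 1] by (simp add: J2_def)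
  have va: "vt q (a\<^sup>2) = J2 * th (q\<^sup>2) (q * a\<^sup>2)" using jacobi_triple_vt[OF q, of "a\<^sup>2"] a by (simp add: J2_def)
  have t3: "th q (a\<^sup>2) = th q a * th q (- a) * th (q\<^sup>2) (q * a\<^sup>2)"
    using th_split2[OF q, of "a\<^sup>2"] th_mult_minus[OF q(1), of a] a by simp
  have nz: "th (q\<^sup>2) q \<noteq> 0" using t1 Jnz by auto
  have "C = 2 * a * th (q\<^sup>2) (q * a\<^sup>2) / th (q\<^sup>2) q" using Jnz by (simp add: C_def v1 va)
  also have "\<dots> = a * th (q\<^sup>2) (q * a\<^sup>2) * th q (- 1)"
  proof -
    have "J2\<^sup>2 * (th (q\<^sup>2) q * th q (- 1)) = J2\<^sup>2 * 2" using t1 t2 by algebra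
    hence "th (q\<^sup>2) q * th q (- 1) = 2" using Jnz by simp
    thus ?thesis using nz by (simp add: field_simps)
  qed
  also have "\<dots> = - Kc * th q (- 1) / ((qp q q)\<^sup>2 * th q a * th q (1 / a))"
    unfolding th_inv_a Kc_def t3 using J th_a a by simp
  finally show ?thesis .
qed

text \<open>The parameters q / a^2, q a^2 and q are matched to the arguments z / a, a z and z: with
  them all three sums acquire the same multiplier -z^2 under z -> q z.\<close>

definition "W z = app q (q / a\<^sup>2) (1 / a * z) + a\<^sup>2 * app q (q * a\<^sup>2) (a * z) - C * app q q z"

lemma W_qdiff:
  assumes z: "z \<noteq> 0" "th q z \<noteq> 0" "th q (a * z) \<noteq> 0" "th q (1 / a * z) \<noteq> 0"
  shows "W (q * z) = - z\<^sup>2 * W z"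
proof -
  have 1: "app q (q / a\<^sup>2) (q * (1 / a * z)) = - z\<^sup>2 * app q (q / a\<^sup>2) (1 / a * z) + vt q (q / a\<^sup>2) - a * z * vt q (a\<^sup>2)"
    using app_qdiff[OF q, of "q / a\<^sup>2" "1 / a * z"] powi_ne_1[OF _ z(4)] q a z vt_inverse[of q "a\<^sup>2"]
    by (simp add: field_simps power2_eq_square)
  have 2: "a\<^sup>2 * app q (q * a\<^sup>2) (q * (a * z)) = - z\<^sup>2 * (a\<^sup>2 * app q (q * a\<^sup>2) (a * z)) + a\<^sup>2 * vt q (q * a\<^sup>2) - a * z * vt q (a\<^sup>2)"
  proof -
    have e: "q / (q * a\<^sup>2) = 1 / a\<^sup>2" "q * a\<^sup>2 / q = a\<^sup>2" using q a by auto
    have gen: "a\<^sup>2 * (- (1 / a\<^sup>2) * (a * z)\<^sup>2 * X + V - 1 / a\<^sup>2 * (a * z) * U) = - z\<^sup>2 * (a\<^sup>2 * X) + a\<^sup>2 * V - a * z * U" for X V U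
      using a by (simp add: power2_eq_square) (simp add: algebra_simps)
    have "app q (q * a\<^sup>2) (q * (a * z)) = - (q / (q * a\<^sup>2)) * (a * z)\<^sup>2 * app q (q * a\<^sup>2) (a * z)
       + vt q (q * a\<^sup>2) - q / (q * a\<^sup>2) * (a * z) * vt q (q * a\<^sup>2 / q)"
      by (rule app_qdiff[OF q]) (use powi_ne_1[OF _ z(3)] q a z in auto)
    thus ?thesis unfolding e by (simp only: gen)
  qed
  have "z \<notin> orbits q {1}" using orbits_iff_th[OF q z(1), of "{1}"] z by simp
  hence 3: "app q q (q * z) = - z\<^sup>2 * app q q z - z * vt q 1" using app_q_qdiff[OF q z(1)] by simp
  have 4: "vt q (q / a\<^sup>2) = - a\<^sup>2 * vt q (q * a\<^sup>2)"
    using vt_shift[OF q(2), of "q * a\<^sup>2"] vt_inverse[of q "a\<^sup>2 / q"] q a by (simp add: power2_eq_square)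
  have 5: "C * vt q 1 = 2 * a * vt q (a\<^sup>2)" using vt_1_nonzero[OF q] by (simp add: C_def)
  have 6: "1 / a * (q * z) = q * (1 / a * z)" "a * (q * z) = q * (a * z)" by (simp_all add: mult_ac)
  show ?thesis unfolding W_def 6 1 2 3 4 using 5 by algebra
qed

lemma quot_qdiff:
  assumes z: "z \<noteq> 0"
  shows "Kc * th q (- (q * z)) / (th q (q * z) * th q (a * (q * z)) * th q (1 / a * (q * z))) =
    - z\<^sup>2 * (Kc * th q (- z) / (th q z * th q (a * z) * th q (1 / a * z)))"
proof -
  have 6: "1 / a * (q * z) = q * (1 / a * z)" "a * (q * z) = q * (a * z)" "- (q * z) = q * (- z)" by (simp_all add: mult_ac)
  have t: "th q (q * z) = - th q z / z" "th q (q * (a * z)) = - th q (a * z) / (a * z)"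
    "th q (q * (1 / a * z)) = - th q (1 / a * z) / (1 / a * z)" "th q (q * (- z)) = - th q (- z) / (- z)"
    by (rule th_mult_q[OF q]; use z a in simp)+
  have "Kc * (- N / (- z)) / ((- A / z) * (- B / (a * z)) * (- D / (1 / a * z))) = - z\<^sup>2 * (Kc * N / (A * B * D))" for N A B D
    using z a by (simp add: power2_eq_square mult_ac)
  thus ?thesis unfolding 6 t by blast
qed

text \<open>Both sides have the multiplier -z^2, so \<open>qdiff_meromorphic_zero\<close> leaves
  only the simple poles at 1, 1 / a and a. At each of them the numerator F of the combined polar
  part vanishes: at 1 by \<open>C_eq\<close>, at the other two by the choice of
  \<open>Kc\<close>.\<close>

theorem app_three_term:
  assumes z: "z \<noteq> 0" "th q z \<noteq> 0" "th q (a * z) \<noteq> 0" "th q (1 / a * z) \<noteq> 0"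
  shows "W z = Kc * th q (- z) / (th q z * th q (a * z) * th q (1 / a * z))"
proof -
  define S where "S = {1, 1 / a, a}"
  have S: "finite S" "0 \<notin> S" using a by (auto simp: S_def)
  define Q where "Q = (\<lambda>z. Kc * th q (- z) / (th q z * th q (a * z) * th q (1 / a * z)))"
  have orb: "x \<in> orbits q S \<longleftrightarrow> th q x = 0 \<or> th q (a * x) = 0 \<or> th q (1 / a * x) = 0" if "x \<noteq> 0" for x
    using orbits_iff_th[OF q that S(2)] by (simp add: S_def mult_ac)
  have qn: "q / a\<^sup>2 \<noteq> 0" "q * a\<^sup>2 \<noteq> 0" "1 / a \<noteq> 0" using q a by auto
  have "W z - Q z = 0"
  proof (rule qdiff_meromorphic_zero[OF q S, of "-1" 2 "\<lambda>z. W z - Q z"])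
    have "(\<lambda>z. W z - Q z) field_differentiable (at x)" if x: "x \<in> - {0} - orbits q S" for x
    proof -
      have nz: "x \<noteq> 0" "th q x \<noteq> 0" "th q (a * x) \<noteq> 0" "th q (1 / a * x) \<noteq> 0" using x orb[of x] by auto
      show ?thesis unfolding W_def Q_def
        using nz qn a q differentiable_app_nz[of q 1 x] th_mult_cont[of 1 x] th_mult_cont[of "-1" x]
        by (intro derivative_intros differentiable_app_nz th_mult_cont) auto
    qed
    thus "(\<lambda>z. W z - Q z) holomorphic_on - {0} - orbits q S"
      using field_differentiable_at_within holomorphic_on_def by blast
    show "W (q * x) - Q (q * x) = - 1 * x ^ 2 * (W x - Q x)" if x: "x \<noteq> 0" "x \<notin> orbits q S" for x
      using W_qdiff[of x] quot_qdiff[of x] x orb[of x] by (simp add: Q_def algebra_simps)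
    show "\<exists>l. (\<lambda>z. W z - Q z) \<midarrow>s\<rightarrow> l" if "s \<in> S" for s
    proof -
      consider "s = 1" | "s = 1 / a" | "s = a" using \<open>s \<in> S\<close> by (auto simp: S_def)
      thus ?thesis
      proof cases
        case 1
        define F where "F = (\<lambda>z. - C - Kc * th q (- 1 * z) / (ths q (1 * z) * th q (a * z) * th q (1 / a * z)))"
        define h where "h = (\<lambda>z. app q (q / a\<^sup>2) (1 / a * z) + a\<^sup>2 * app q (q * a\<^sup>2) (a * z) - C * app_on q q (- {0}) (1 * z))"
        show ?thesis
        proof (rule lim_simple_pole_cancel[of 1 s F h])
          show "F field_differentiable (at s)" unfolding F_def
            using 1 a th_a th_inv_a J
            by (intro derivative_intros th_mult_cont) (auto simp: ths_1)
          show "F s = 0" using 1 C_eq by (simp add: F_def ths_1)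
          have "h field_differentiable (at s)" unfolding h_def
            using 1 a q th_a th_inv_a
            by (intro derivative_intros differentiable_app_nz differentiable_app_pole) auto
          thus "isCont h s" by (rule field_differentiable_imp_continuous_at)
          have "eventually (\<lambda>z. z \<noteq> 0) (at s)" using 1 by (simp add: eventually_neq_at_within)
          thus "eventually (\<lambda>z. W z - Q z = F z / (1 - 1 * z) + h z) (at s)"
          proof eventually_elim
            case (elim z)
            have "Q z = Kc * th q (- 1 * z) / (ths q (1 * z) * th q (a * z) * th q (1 / a * z)) / (1 - 1 * z)"
              by (simp add: Q_def th_eq_ths[OF q(1), of z] mult_ac)
            moreover have "app q q z = 1 / (1 - 1 * z) + app_on q q (- {0}) (1 * z)"
              using app_zero_term[OF q(2) elim] by simp
            ultimately show ?case unfolding W_def F_def h_def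
              by (simp only: diff_divide_distrib) (simp add: algebra_simps)
          qed
        qed (use 1 in auto)
      next
        case 2
        define F where "F = (\<lambda>z. a\<^sup>2 - Kc * th q (- 1 * z) / (th q (1 * z) * ths q (a * z) * th q (1 / a * z)))"
        define h where "h = (\<lambda>z. app q (q / a\<^sup>2) (1 / a * z) + a\<^sup>2 * app_on q (q * a\<^sup>2) (- {0}) (a * z) - C * app q q (1 * z))"
        have as: "a * s = 1" "1 / a * s = 1 / a\<^sup>2" using 2 a by (auto simp: power2_eq_square)
        show ?thesis
        proof (rule lim_simple_pole_cancel[of a s F h])
          show "F field_differentiable (at s)" unfolding F_def
            using 2 a th_a th_inv_a J as
            by (intro derivative_intros th_mult_cont) (auto simp: ths_1)
          show "F s = 0"
          proof -
            have v: "th q (1 * s) = - th q a / a" "th q (- 1 * s) = th q (- a) / a"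
              using 2 th_inv_a by simp_all
            show ?thesis unfolding F_def as v th_inv_a(2) using a th_a J
              by (simp add: ths_1 Kc_def power2_eq_square)
          qed
          have "h field_differentiable (at s)" unfolding h_def
            using 2 a q th_a th_inv_a as
            by (intro derivative_intros differentiable_app_nz differentiable_app_pole) auto
          thus "isCont h s" by (rule field_differentiable_imp_continuous_at)
          have "eventually (\<lambda>z. z \<noteq> 0) (at s)" using 2 a by (simp add: eventually_neq_at_within)
          thus "eventually (\<lambda>z. W z - Q z = F z / (1 - a * z) + h z) (at s)"
          proof eventually_elim
            case (elim z)
            have "Q z = Kc * th q (- 1 * z) / (th q (1 * z) * ths q (a * z) * th q (1 / a * z)) / (1 - a * z)"
              by (simp add: Q_def th_eq_ths[OF q(1), of "a * z"] mult_ac)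
            moreover have "app q (q * a\<^sup>2) (a * z) = 1 / (1 - a * z) + app_on q (q * a\<^sup>2) (- {0}) (a * z)"
              using app_zero_term[of "q * a\<^sup>2" "a * z"] elim a q by simp
            ultimately show ?case unfolding W_def F_def h_def
              by (simp only: diff_divide_distrib) (simp add: algebra_simps)
          qed
        qed (use as in auto)
      next
        case 3
        define F where "F = (\<lambda>z. 1 - M (1 * z))"
        define h where "h = (\<lambda>z. app_on q (q / a\<^sup>2) (- {0}) (1 / a * z) + a\<^sup>2 * app q (q * a\<^sup>2) (a * z) - C * app q q (1 * z))"
        have as: "a * s = a\<^sup>2" "1 / a * s = 1" using 3 a by (auto simp: power2_eq_square)
        show ?thesis
        proof (rule lim_simple_pole_cancel[of "1 / a" s F h])
          have "(\<lambda>z. 1 - Kc * th q (- 1 * z) / (th q (1 * z) * th q (a * z) * ths q (1 / a * z))) field_differentiable (at s)"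
            using 3 a th_a th_inv_a J as
            by (intro derivative_intros th_mult_cont) (auto simp: ths_1)
          thus "F field_differentiable (at s)" by (simp add: F_def M_def[abs_def])
          show "F s = 0" using M_a 3 by (simp add: F_def)
          have "h field_differentiable (at s)" unfolding h_def
            using 3 a q th_a th_inv_a as
            by (intro derivative_intros differentiable_app_nz differentiable_app_pole) auto
          thus "isCont h s" by (rule field_differentiable_imp_continuous_at)
          have "eventually (\<lambda>z. z \<noteq> 0) (at s)" using 3 a by (simp add: eventually_neq_at_within)
          thus "eventually (\<lambda>z. W z - Q z = F z / (1 - 1 / a * z) + h z) (at s)"
          proof eventually_elim
            case (elim z)
            have "Q z = M (1 * z) / (1 - 1 / a * z)"
              unfolding Q_def M_def th_eq_ths[OF q(1), of "1 / a * z"] by (simp add: mult_ac)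
            moreover have "app q (q / a\<^sup>2) (1 / a * z) = 1 / (1 - 1 / a * z) + app_on q (q / a\<^sup>2) (- {0}) (1 / a * z)"
              using app_zero_term[of "q / a\<^sup>2" "1 / a * z"] elim a q by simp
            ultimately show ?case unfolding W_def F_def h_def
              by (simp only: diff_divide_distrib) (simp add: algebra_simps)
          qed
        qed (use as in auto)
      qed
    qed
    show "z \<notin> orbits q S" using orb[OF z(1)] z by simp
  qed (use z in auto)
  thus ?thesis by (simp add: Q_def)
qed

text \<open>Let z -> a in the three-term relation. The index 0 of the first sum contributes 1 / (1 -
  z / a), the right-hand side is M z / (1 - z / a) with M a = 1, and their difference is a
  difference quotient tending to -a M'(a) = -\<open>lam q a\<close>.\<close>

theorem app_three_term_limit:
  "app_on q (q / a\<^sup>2) (- {0}) 1 + a\<^sup>2 * app q (q * a\<^sup>2) (a\<^sup>2) - C * app q q a = - lam q a"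
proof -
  define h where "h = (\<lambda>z. app_on q (q / a\<^sup>2) (- {0}) (1 / a * z) + a\<^sup>2 * app q (q * a\<^sup>2) (a * z) - C * app q q (1 * z))"
  have aa: "a * a = a\<^sup>2" by (simp add: power2_eq_square)
  have "h field_differentiable (at a)" unfolding h_def
    using a q th_a aa
    by (intro derivative_intros differentiable_app_nz differentiable_app_pole) auto
  hence hl: "h \<midarrow>a\<rightarrow> h a" using field_differentiable_imp_continuous_at isCont_def by blast
  have D1: "((\<lambda>z. th q (- z)) has_field_derivative LL q (- a) * th q (- a) / a) (at a)"
  proof -
    have "((\<lambda>z. - z) has_field_derivative - 1) (at a)" by (auto intro!: derivative_eq_intros)
    from LL_th_chain[OF q(1) _ _ this] show ?thesis using a th_a by simp
  qed
  have D2: "(th q has_field_derivative LL q a * th q a / a) (at a)"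
    by (rule LL_th[OF q(1) a th_a(1)])
  have D3: "((\<lambda>z. th q (a * z)) has_field_derivative LL q (a\<^sup>2) * th q (a\<^sup>2) / a) (at a)"
  proof -
    have "((\<lambda>z. a * z) has_field_derivative a) (at a)" by (auto intro!: derivative_eq_intros)
    hence "((\<lambda>z. th q (a * z)) has_field_derivative LL q (a * a) * th q (a * a) / (a * a) * a) (at a)"
      by (rule LL_th_chain[OF q(1), rotated 2]) (use a th_a aa in auto)
    moreover have "LL q (a * a) * th q (a * a) / (a * a) * a = LL q (a\<^sup>2) * th q (a\<^sup>2) / a"
      using a by (simp add: power2_eq_square)
    ultimately show ?thesis by (simp only:)
  qed
  have D4: "((\<lambda>z. ths q (1 / a * z)) has_field_derivative 0 * (1 / a)) (at a)"
    by (rule DERIV_chain2[of "ths q" 0]) (use deriv_ths_1[OF q(1)] a in \<open>auto intro!: derivative_eq_intros\<close>)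
  have J2: "ths q (1 / a * a) = (qp q q)\<^sup>2" using a by (simp add: ths_1)
  have "(M has_field_derivative lam q a / a) (at a)"
  proof -
    define N D where "N = (\<lambda>z. Kc * th q (- z))" and "D = (\<lambda>z. th q z * th q (a * z) * ths q (1 / a * z))"
    have N: "(N has_field_derivative LL q (- a) / a * N a) (at a)"
    proof -
      have "(N has_field_derivative Kc * (LL q (- a) * th q (- a) / a)) (at a)"
        unfolding N_def by (rule DERIV_cmult[OF D1])
      moreover have "Kc * (LL q (- a) * th q (- a) / a) = LL q (- a) / a * N a" by (simp add: N_def)
      ultimately show ?thesis by (simp only:)
    qed
    have D: "(D has_field_derivative (LL q a + LL q (a\<^sup>2)) / a * D a) (at a)"
    proof -
      have "(D has_field_derivative ((LL q a * th q a / a) * th q (a * a) + (LL q (a\<^sup>2) * th q (a\<^sup>2) / a) * th q a)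
          * ths q (1 / a * a) + 0 * (1 / a) * (th q a * th q (a * a))) (at a)"
        unfolding D_def by (rule DERIV_mult[OF DERIV_mult[OF D2 D3] D4])
      moreover have "((LL q a * th q a / a) * th q (a * a) + (LL q (a\<^sup>2) * th q (a\<^sup>2) / a) * th q a)
          * ths q (1 / a * a) + 0 * (1 / a) * (th q a * th q (a * a)) = (LL q a + LL q (a\<^sup>2)) / a * D a"
        unfolding D_def aa by (simp add: add_divide_distrib algebra_simps)
      ultimately show ?thesis by (simp only:)
    qed
    have Da: "D a \<noteq> 0" using th_a J J2 by (simp add: D_def aa ths_1)
    have "N a / D a = 1" using M_a by (simp add: M_def N_def D_def)
    hence ND: "N a = D a" using Da by simp
    have "((\<lambda>z. N z / D z) has_field_derivative 
        (LL q (- a) / a * N a * D a - N a * ((LL q a + LL q (a\<^sup>2)) / a * D a)) / (D a * D a)) (at a)"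
      by (rule DERIV_divide[OF N D Da])
    also have "(LL q (- a) / a * N a * D a - N a * ((LL q a + LL q (a\<^sup>2)) / a * D a)) / (D a * D a) = lam q a / a"
      unfolding ND using Da a by (simp add: lam_def field_simps)
    also have "(\<lambda>z. N z / D z) = M" by (simp add: fun_eq_iff M_def N_def D_def)
    finally show ?thesis .
  qed
  hence "(\<lambda>z. (M z - M a) / (z - a)) \<midarrow>a\<rightarrow> lam q a / a" by (simp add: has_field_derivative_iff)
  hence "(\<lambda>z. - a * ((M z - M a) / (z - a))) \<midarrow>a\<rightarrow> - a * (lam q a / a)" by (rule tendsto_mult_left)
  moreover have "eventually (\<lambda>z. z \<notin> orbits q {1, 1 / a, a}) (at a)"
    by (rule orbits_sparse[OF q]) (use a in auto)
  hence "eventually (\<lambda>z. - a * ((M z - M a) / (z - a)) = h z) (at a)"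
    using eventually_neq_at_within[of 0 a UNIV] eventually_neq_at_within[of a a UNIV]
  proof eventually_elim
    case (elim z)
    have nz: "th q z \<noteq> 0" "th q (a * z) \<noteq> 0" "th q (1 / a * z) \<noteq> 0"
      using elim orbits_iff_th[OF q elim(2), of "{1, 1 / a, a}"] a by (auto simp: mult_ac)
    have az: "1 - 1 / a * z = - (z - a) / a" using a by (simp add: field_simps)
    have "W z = M z / (1 - 1 / a * z)"
      unfolding app_three_term[OF elim(2) nz] M_def th_eq_ths[OF q(1), of "1 / a * z"] by (simp add: mult_ac)
    moreover have "W z = 1 / (1 - 1 / a * z) + h z"
      using app_zero_term[of "q / a\<^sup>2" "1 / a * z"] elim a q by (simp add: W_def h_def)
    ultimately have "h z = M z / (1 - 1 / a * z) - 1 / (1 - 1 / a * z)" by (metis add_diff_cancel_left')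
    hence "h z = (M z - 1) / (1 - 1 / a * z)" by (simp only: diff_divide_distrib)
    also have "\<dots> = - a * ((M z - M a) / (z - a))" unfolding az M_a using a elim by (simp add: field_simps)
    finally show ?case by simp
  qed
  ultimately have "h \<midarrow>a\<rightarrow> - a * (lam q a / a)" by (rule Lim_transform_eventually)
  hence "h a = - a * (lam q a / a)" using hl LIM_unique by blast
  thus ?thesis using a by (simp add: h_def aa)
qed

end

section \<open>The rank generating function of overpartitions\<close>

lemma has_sum_times:
  fixes u :: "'a \<Rightarrow> complex" and v :: "'b \<Rightarrow> complex"
  assumes u: "(\<lambda>x. norm (u x)) summable_on A" "(u has_sum U) A"
    and v: "(\<lambda>x. norm (v x)) summable_on B" "(v has_sum V) B"
  shows "(\<lambda>p. norm (u (fst p) * v (snd p))) summable_on A \<times> B"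
    and "((\<lambda>p. u (fst p) * v (snd p)) has_sum (U * V)) (A \<times> B)"
proof -
  show abs: "(\<lambda>p. norm (u (fst p) * v (snd p))) summable_on A \<times> B"
  proof (rule summable_on_SigmaI)
    show "((\<lambda>y. norm (u (fst (x, y)) * v (snd (x, y)))) has_sum (norm (u x) * (\<Sum>\<^sub>\<infinity>y\<in>B. norm (v y)))) B" for x
      using has_sum_cmult_right[OF has_sum_infsum[OF v(1)], of "norm (u x)"] by (simp add: norm_mult)
    show "(\<lambda>x. norm (u x) * (\<Sum>\<^sub>\<infinity>y\<in>B. norm (v y))) summable_on A"
      by (intro summable_on_cmult_left u(1))
  qed auto
  show "((\<lambda>p. u (fst p) * v (snd p)) has_sum (U * V)) (A \<times> B)"
  proof (rule has_sum_SigmaI)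
    show "((\<lambda>y. u (fst (x, y)) * v (snd (x, y))) has_sum (u x * V)) B" for x
      by (simp add: has_sum_cmult_right v(2))
    show "((\<lambda>x. u x * V) has_sum (U * V)) A" by (intro has_sum_cmult_left u(2))
    show "(\<lambda>p. u (fst p) * v (snd p)) summable_on A \<times> B" using abs by (rule abs_summable_summable)
  qed
qed

definition op_le :: "nat \<Rightarrow> (nat multiset \<times> nat set) set" where
  "op_le n = {(M, S). set_mset M \<subseteq> {1..n} \<and> S \<subseteq> set_mset M}"

definition op_max :: "nat \<Rightarrow> (nat multiset \<times> nat set) set" where
  "op_max n = {(M, S). Suc n \<in># M \<and> set_mset M \<subseteq> {1..Suc n} \<and> S \<subseteq> set_mset M}"

definition op_weight :: "complex \<Rightarrow> complex \<Rightarrow> nat multiset \<times> nat set \<Rightarrow> complex" where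
  "op_weight b q p = b ^ size (fst p) * q ^ sum_mset (fst p)"

text \<open>Adjoins m copies of the part n + 1; the flag f records whether the first of them is
  overlined.\<close>

definition op_add :: "nat \<Rightarrow> (nat multiset \<times> nat set) \<times> (nat \<times> bool) \<Rightarrow> nat multiset \<times> nat set" where
  "op_add n = (\<lambda>((M, S), (m, f)). (M + replicate_mset m (Suc n), if f then insert (Suc n) S else S))"

lemma op_weight_add:
  "op_weight b q (op_add n p) = op_weight b q (fst p) * (b * q ^ Suc n) ^ fst (snd p)"
  by (cases p) (auto simp: op_add_def op_weight_def power_add power_mult_distrib sum_mset_replicate_mset
      simp flip: power_mult power_Suc simp: mult_ac)

text \<open>The inverse strips all parts n + 1 and records multiplicity and flag. \<open>K\<close>
  lists the admissible pairs; an overlined part must occur, hence the condition m > 0.\<close>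

lemma bij_betw_op_add:
  assumes K: "\<And>m f. (m, f) \<in> K \<Longrightarrow> f \<Longrightarrow> m > 0"
    and A: "A = {(M, S). set_mset M \<subseteq> {1..Suc n} \<and> S \<subseteq> set_mset M \<and> (count M (Suc n), Suc n \<in> S) \<in> K}"
  shows "bij_betw (op_add n) (op_le n \<times> K) A"
proof (rule bij_betwI[where g = "\<lambda>(M, S). ((filter_mset (\<lambda>x. x \<noteq> Suc n) M, S - {Suc n}), (count M (Suc n), Suc n \<in> S))"])
  show "op_add n \<in> op_le n \<times> K \<rightarrow> A"
  proof
    fix p assume "p \<in> op_le n \<times> K"
    then obtain M S m f where p: "p = ((M, S), (m, f))" "set_mset M \<subseteq> {1..n}" "S \<subseteq> set_mset M" "(m, f) \<in> K"
      by (auto simp: op_le_def)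
    have c: "count M (Suc n) = 0" "Suc n \<notin> S" using p by (auto simp: count_eq_zero_iff)
    have "f \<Longrightarrow> m > 0" using K p by blast
    thus "op_add n p \<in> A" using p c unfolding A
      by (auto simp: op_add_def split: if_splits)
  qed
  show "(\<lambda>(M, S). ((filter_mset (\<lambda>x. x \<noteq> Suc n) M, S - {Suc n}), (count M (Suc n), Suc n \<in> S))) \<in> A \<rightarrow> op_le n \<times> K"
    unfolding A by (auto simp: op_le_def le_Suc_eq subset_iff)
  fix p assume "p \<in> op_le n \<times> K"
  then obtain M S m f where p: "p = ((M, S), (m, f))" "set_mset M \<subseteq> {1..n}" "S \<subseteq> set_mset M" "(m, f) \<in> K"
    by (auto simp: op_le_def)
  have c: "count M (Suc n) = 0" "Suc n \<notin> S" using p by (auto simp: count_eq_zero_iff)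
  have "filter_mset (\<lambda>x. x \<noteq> Suc n) M = M" using p by (auto simp: filter_mset_eq_conv)
  thus "(\<lambda>(M, S). ((filter_mset (\<lambda>x. x \<noteq> Suc n) M, S - {Suc n}), (count M (Suc n), Suc n \<in> S))) (op_add n p) = p"
    using p(1) c by (auto simp: op_add_def)
next
  fix p assume "p \<in> A"
  then obtain M S where p: "p = (M, S)" "S \<subseteq> set_mset M" by (auto simp: A)
  have "filter_mset (\<lambda>x. x \<noteq> Suc n) M + replicate_mset (count M (Suc n)) (Suc n) = M"
    by (rule multiset_eqI) auto
  thus "op_add n ((\<lambda>(M, S). ((filter_mset (\<lambda>x. x \<noteq> Suc n) M, S - {Suc n}), (count M (Suc n), Suc n \<in> S))) p) = p"
    using p by (auto simp: op_add_def)
qed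

text \<open>A positive multiplicity counts twice, with and without overline, and multiplicity 0
  once. The first value forces the part to occur, the second does not.\<close>

lemma geometric_nat_bool:
  fixes x :: complex
  assumes "norm x < 1"
  shows "(\<lambda>k. norm (x ^ fst k)) summable_on (UNIV :: (nat \<times> bool) set)"
    and "((\<lambda>k. x ^ fst k) has_sum (2 * x / (1 - x))) ({1..} \<times> UNIV :: (nat \<times> bool) set)"
    and "((\<lambda>k. x ^ fst k) has_sum ((1 + x) / (1 - x))) ({1..} \<times> UNIV \<union> {(0, False)} :: (nat \<times> bool) set)"
proof -
  have x1: "x \<noteq> 1" using assms by auto
  have n: "(\<lambda>m. norm (x ^ m)) summable_on A" for A :: "nat set"
  proof -
    have "(\<lambda>m. norm x ^ m) summable_on (UNIV :: nat set)"
      using assms by (intro summable_nonneg_imp_summable_on summable_geometric) auto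
    thus ?thesis by (auto simp: norm_power intro: summable_on_subset_banach)
  qed
  have b: "(\<lambda>_. norm (1::complex)) summable_on (UNIV :: bool set)" "((\<lambda>_. 1) has_sum (2::complex)) (UNIV :: bool set)"
    using has_sum_finite[of "UNIV :: bool set" "\<lambda>_. 1 :: complex"] by (simp_all add: UNIV_bool)
  have "(\<lambda>m. x ^ m) sums (1 / (1 - x))" using assms by (rule geometric_sums)
  hence "((\<lambda>m. x ^ m) has_sum (1 / (1 - x))) UNIV"
    using assms by (intro norm_summable_imp_has_sum) (auto simp: norm_power)
  from has_sum_cmult_right[OF this, of x]
  have "((\<lambda>m. x ^ Suc m) has_sum (x * (1 / (1 - x)))) UNIV" by simp
  moreover have "bij_betw Suc UNIV {1..}" by (rule bij_betwI[of _ _ _ "\<lambda>n. n - 1"]) auto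
  ultimately have g: "((\<lambda>m. x ^ m) has_sum (x / (1 - x))) {1..}"
    using has_sum_reindex_bij_betw[of Suc UNIV "{1..}" "\<lambda>m. x ^ m" "x / (1 - x)"] by simp
  have "(\<lambda>p :: nat \<times> bool. norm (x ^ fst p * 1)) summable_on UNIV \<times> UNIV"
    by (rule has_sum_times(1)[OF n has_sum_infsum[OF abs_summable_summable[OF n]] b])
  thus "(\<lambda>k. norm (x ^ fst k)) summable_on (UNIV :: (nat \<times> bool) set)" by (simp only: mult_1_right UNIV_Times_UNIV)
  have "((\<lambda>p :: nat \<times> bool. x ^ fst p * 1) has_sum (x / (1 - x) * 2)) ({1..} \<times> UNIV)"
    using has_sum_times(2)[OF n g b] by simp
  thus *: "((\<lambda>k. x ^ fst k) has_sum (2 * x / (1 - x))) ({1..} \<times> UNIV :: (nat \<times> bool) set)"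
    by (simp add: mult.commute)
  have "((\<lambda>k. x ^ fst k) has_sum 1) ({(0, False)} :: (nat \<times> bool) set)"
    by (rule has_sum_finiteI) auto
  with * have "((\<lambda>k. x ^ fst k) has_sum (2 * x / (1 - x) + 1)) ({1..} \<times> UNIV \<union> {(0, False)} :: (nat \<times> bool) set)"
    by (rule has_sum_Un_disjoint) auto
  moreover have "2 * x / (1 - x) + 1 = (1 + x) / (1 - x)" using x1 by (simp add: field_simps)
  ultimately show "((\<lambda>k. x ^ fst k) has_sum ((1 + x) / (1 - x))) ({1..} \<times> UNIV \<union> {(0, False)} :: (nat \<times> bool) set)"
    by simp
qed

lemma op_extend:
  assumes x: "norm (b * q ^ Suc n) < 1"
    and P: "(\<lambda>p. norm (op_weight b q p)) summable_on op_le n" "(op_weight b q has_sum P) (op_le n)"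
    and bij: "bij_betw (op_add n) (op_le n \<times> K) A"
    and V: "((\<lambda>k. (b * q ^ Suc n) ^ fst k) has_sum V) K"
  shows "(\<lambda>p. norm (op_weight b q p)) summable_on A" "(op_weight b q has_sum (P * V)) A"
proof -
  have K: "(\<lambda>k. norm ((b * q ^ Suc n) ^ fst k)) summable_on K"
    by (rule summable_on_subset_banach[OF geometric_nat_bool(1)[OF x]]) auto
  note * = has_sum_times[OF P K V]
  have "(\<lambda>p. norm (op_weight b q (op_add n p))) summable_on op_le n \<times> K"
    unfolding op_weight_add by (rule *(1))
  thus "(\<lambda>p. norm (op_weight b q p)) summable_on A"
    using summable_on_reindex_bij_betw[OF bij, of "\<lambda>p. norm (op_weight b q p)"] by simp
  have "((\<lambda>p. op_weight b q (op_add n p)) has_sum (P * V)) (op_le n \<times> K)"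
    unfolding op_weight_add by (rule *(2))
  thus "(op_weight b q has_sum (P * V)) A"
    using has_sum_reindex_bij_betw[OF bij, of "op_weight b q"] by simp
qed

lemma op_le_has_sum:
  assumes q: "norm q < 1" and b: "norm b = 1"
  shows "(\<lambda>p. norm (op_weight b q p)) summable_on op_le n"
    and "(op_weight b q has_sum (\<Prod>k<n. (1 + b * q ^ Suc k) / (1 - b * q ^ Suc k))) (op_le n)"
proof (induction n)
  case 0
  have e: "op_le 0 = {({#}, {})}" by (auto simp: op_le_def)
  show "(\<lambda>p. norm (op_weight b q p)) summable_on op_le 0" unfolding e by simp
  show "(op_weight b q has_sum (\<Prod>k<0. (1 + b * q ^ Suc k) / (1 - b * q ^ Suc k))) (op_le 0)"
    unfolding e by (rule has_sum_finiteI) (auto simp: op_weight_def)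
next
  case (Suc n)
  have x: "norm (b * q ^ Suc n) < 1"
    using q b by (simp add: norm_mult norm_power power_less_one_iff del: power_Suc)
  have bij: "bij_betw (op_add n) (op_le n \<times> ({1..} \<times> UNIV \<union> {(0, False)})) (op_le (Suc n))"
  proof (rule bij_betw_op_add)
    show "op_le (Suc n) = {(M, S). set_mset M \<subseteq> {1..Suc n} \<and> S \<subseteq> set_mset M \<and>
      (count M (Suc n), Suc n \<in> S) \<in> {1..} \<times> UNIV \<union> {(0, False)}}"
      by (auto simp: op_le_def Suc_le_eq count_greater_zero_iff count_eq_zero_iff)
  qed auto
  note * = op_extend[OF x Suc.IH bij geometric_nat_bool(3)[OF x]]
  show "(\<lambda>p. norm (op_weight b q p)) summable_on op_le (Suc n)" by (rule *(1))
  show "(op_weight b q has_sum (\<Prod>k<Suc n. (1 + b * q ^ Suc k) / (1 - b * q ^ Suc k))) (op_le (Suc n))"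
    using *(2) by simp
qed

text \<open>The weight 1 / z for each part and z^(n+1) for the largest part combine to z to the
  power of the rank.\<close>

lemma op_max_has_sum:
  assumes q: "norm q < 1" and z: "norm z = 1"
  shows "(\<lambda>p. norm (op_weight (1 / z) q p)) summable_on op_max n"
    and "((\<lambda>p. z ^ Suc n * op_weight (1 / z) q p) has_sum (2 * q * (rc q z n * (z * q) ^ n))) (op_max n)"
proof -
  have b: "norm (1 / z) = 1" using z by (simp add: norm_divide)
  have z0: "z \<noteq> 0" using z by auto
  have x: "norm (1 / z * q ^ Suc n) < 1"
    using q z by (simp add: norm_divide norm_power power_less_one_iff del: power_Suc)
  have bij: "bij_betw (op_add n) (op_le n \<times> ({1..} \<times> UNIV)) (op_max n)"
  proof (rule bij_betw_op_add)
    show "op_max n = {(M, S). set_mset M \<subseteq> {1..Suc n} \<and> S \<subseteq> set_mset M \<and>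
      (count M (Suc n), Suc n \<in> S) \<in> {1..} \<times> UNIV}"
      by (auto simp: op_max_def Suc_le_eq count_greater_zero_iff)
  qed auto
  note * = op_extend[OF x op_le_has_sum[OF q b] bij geometric_nat_bool(2)[OF x]]
  show "(\<lambda>p. norm (op_weight (1 / z) q p)) summable_on op_max n" by (rule *(1))
  have "((\<lambda>p. z ^ Suc n * op_weight (1 / z) q p) has_sum
    (z ^ Suc n * ((\<Prod>k<n. (1 + 1 / z * q ^ Suc k) / (1 - 1 / z * q ^ Suc k)) * (2 * (1 / z * q ^ Suc n) / (1 - 1 / z * q ^ Suc n))))) (op_max n)"
    by (intro has_sum_cmult_right *(2))
  also have "z ^ Suc n * ((\<Prod>k<n. (1 + 1 / z * q ^ Suc k) / (1 - 1 / z * q ^ Suc k)) * (2 * (1 / z * q ^ Suc n) / (1 - 1 / z * q ^ Suc n)))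
     = 2 * q * (rc q z n * (z * q) ^ n)"
    using z0 by (simp add: rc_def prod_dividef power_mult_distrib mult_ac)
  finally show "((\<lambda>p. z ^ Suc n * op_weight (1 / z) q p) has_sum (2 * q * (rc q z n * (z * q) ^ n))) (op_max n)" .
qed

definition rank_weight :: "complex \<Rightarrow> complex \<Rightarrow> nat multiset \<times> nat set \<Rightarrow> complex" where
  "rank_weight z q p = z powi overpartition_rank p * q ^ sum_mset (fst p)"

lemma rank_weight_op_max:
  assumes "p \<in> op_max n" "z \<noteq> 0"
  shows "rank_weight z q p = z ^ Suc n * op_weight (1 / z) q p"
proof -
  have "Max (set_mset (fst p)) = Suc n"
    using assms(1) by (intro Max_eqI) (auto simp: op_max_def)
  moreover have "z powi (int (Suc n) - int (size (fst p))) = z powi int (Suc n) / z powi int (size (fst p))"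
    using assms(2) by (intro power_int_diff) auto
  ultimately have "z powi overpartition_rank p = z ^ Suc n / z ^ size (fst p)"
    unfolding overpartition_rank_def power_int_of_nat by simp
  thus ?thesis by (simp add: rank_weight_def op_weight_def power_divide)
qed

definition op_pos :: "nat \<Rightarrow> (nat multiset \<times> nat set) set" where
  "op_pos N = {p \<in> overpartitions N. fst p \<noteq> {#}}"

lemma finite_overpartitions: "finite (overpartitions N)"
proof -
  have "overpartitions N \<subseteq> (mset ` {xs. set xs \<subseteq> {..N} \<and> length xs \<le> N}) \<times> Pow {..N}"
  proof
    fix p assume "p \<in> overpartitions N"
    then obtain M S where p: "p = (M, S)" "0 \<notin># M" "sum_mset M = N" "S \<subseteq> set_mset M"
      by (auto simp: overpartitions_def)
    obtain xs where xs: "M = mset xs" by (metis ex_mset)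
    have le: "x \<le> N" if "x \<in> set xs" for x
      using p(3) that member_le_sum_list[of x xs] by (simp add: xs sum_mset_sum_list)
    have "length xs \<le> sum_list xs" if "0 \<notin> set xs" for xs :: "nat list"
      using that by (induction xs) auto
    hence "length xs \<le> N" using p(2,3) by (auto simp: xs sum_mset_sum_list)
    thus "p \<in> (mset ` {xs. set xs \<subseteq> {..N} \<and> length xs \<le> N}) \<times> Pow {..N}"
      using p le by (auto simp: xs)
  qed
  thus ?thesis by (rule finite_subset) (auto intro: finite_lists_length_le)
qed

text \<open>One absolutely summable family over the nonempty overpartitions is summed in two ways:
  by largest part, which gives \<open>rS\<close>, and by size, which gives the power series in
  q.\<close>

theorem rank_generating_function:
  assumes q: "norm q < 1" and z: "norm z = 1"
  shows "(\<lambda>N. (\<Sum>p\<in>op_pos N. z powi overpartition_rank p) * q ^ N) sums (2 * q * rS q z)"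
proof -
  have z0: "z \<noteq> 0" using z by auto
  define A where "A = {(M, S). M \<noteq> {#} \<and> 0 \<notin># M \<and> S \<subseteq> set_mset (M :: nat multiset)}"
  have bij1: "bij_betw snd (SIGMA n:UNIV. op_max n) A"
  proof (rule bij_betwI[where g = "\<lambda>p. (Max (set_mset (fst p)) - 1, p)"])
    show "snd \<in> (SIGMA n:UNIV. op_max n) \<rightarrow> A" by (auto simp: A_def op_max_def)
    show "(\<lambda>p. (Max (set_mset (fst p)) - 1, p)) \<in> A \<rightarrow> (SIGMA n:UNIV. op_max n)"
    proof
      fix p assume "p \<in> A"
      then obtain M S where p: "p = (M, S)" "M \<noteq> {#}" "0 \<notin># M" "S \<subseteq> set_mset M" by (auto simp: A_def)
      have m: "Max (set_mset M) \<in># M" using p by simp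
      hence "Max (set_mset M) \<noteq> 0" using p(3) by metis
      hence "Suc (Max (set_mset M) - 1) = Max (set_mset M)" by simp
      moreover have "set_mset M \<subseteq> {1..Max (set_mset M)}" using p(3) by (auto simp: Suc_le_eq intro!: gr0I)
      ultimately show "(Max (set_mset (fst p)) - 1, p) \<in> (SIGMA n:UNIV. op_max n)"
        using p m by (simp add: op_max_def)
    qed
    show "(Max (set_mset (fst (snd x))) - 1, snd x) = x" if "x \<in> (SIGMA n:UNIV. op_max n)" for x
    proof -
      obtain n M S where x: "x = (n, (M, S))" "(M, S) \<in> op_max n" using \<open>x \<in> _\<close> by auto
      hence "Max (set_mset M) = Suc n" by (intro Max_eqI) (auto simp: op_max_def)
      thus ?thesis using x by simp
    qed
  qed auto
  have bij2: "bij_betw snd (SIGMA N:UNIV. op_pos N) A"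
  proof (rule bij_betwI[where g = "\<lambda>p. (sum_mset (fst p), p)"])
  qed (auto simp: A_def op_pos_def overpartitions_def)
  have nzq: "qp (q / z) q \<noteq> 0" if qz: "norm q < 1" "norm z = 1" for q z
  proof
    assume "qp (q / z) q = 0"
    then obtain k where "q / z * q ^ k = 1" using qp_eq_0_iff[OF qz(1)] by blast
    hence "norm (q / z * q ^ k) = 1" by simp
    hence "norm q ^ Suc k = 1" using qz by (simp add: norm_mult norm_divide norm_power)
    thus False using qz power_less_one_iff[of "norm q" "Suc k"] by auto
  qed
  have sum_n: "((\<lambda>n. 2 * q * (rc q z n * (z * q) ^ n)) has_sum (2 * q * rS q z)) UNIV"
  proof -
    have zq: "norm (z * q) < 1" using q z by (simp add: norm_mult)
    show ?thesis unfolding rS_def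
      by (intro has_sum_cmult_right norm_summable_imp_has_sum[OF rc_summable[OF q nzq[OF q z] zq]]
          summable_sums summable_norm_cancel[OF rc_summable[OF q nzq[OF q z] zq]])
  qed
  have sm: "(\<lambda>p. norm (rank_weight z q p)) summable_on op_max n" for n
  proof (subst summable_on_cong)
    show "(\<lambda>p. norm (op_weight (1 / z) q p)) summable_on op_max n" by (rule op_max_has_sum(1)[OF q z])
  qed (auto simp: rank_weight_op_max[OF _ z0] norm_mult norm_power z)
  have abs: "(\<lambda>x. norm (rank_weight z q (snd x))) summable_on (SIGMA n:UNIV. op_max n)"
  proof (rule summable_on_SigmaI)
    show "((\<lambda>p. norm (rank_weight z q (snd (n, p)))) has_sum (\<Sum>\<^sub>\<infinity>p\<in>op_max n. norm (rank_weight z q p))) (op_max n)" for n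
      using sm by simp
  next
    \<comment> \<open>Since |z| = 1, the norms of the weights are the weights for z = 1 and |q|, so
      the inner sums of norms are known in closed form from \<open>op_max_has_sum\<close>.\<close>
    define Q where "Q = complex_of_real (norm q)"
    have Q: "norm Q < 1" "norm (1 :: complex) = 1" using q by (simp_all add: Q_def)
    have inner: "(\<Sum>\<^sub>\<infinity>p\<in>op_max n. norm (rank_weight z q p)) = norm (2 * Q * (rc Q 1 n * (1 * Q) ^ n))" for n
    proof -
      have "((\<lambda>p. complex_of_real (norm (rank_weight z q p))) has_sum
          complex_of_real (\<Sum>\<^sub>\<infinity>p\<in>op_max n. norm (rank_weight z q p))) (op_max n)"
        by (intro has_sum_of_real has_sum_infsum sm)
      moreover have "((\<lambda>p. complex_of_real (norm (rank_weight z q p))) has_sum (2 * Q * (rc Q 1 n * (1 * Q) ^ n))) (op_max n)"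
        using op_max_has_sum(2)[OF Q, of n]
      proof (rule has_sum_cong[THEN iffD1, rotated])
        fix p assume "p \<in> op_max n"
        show "1 ^ Suc n * op_weight (1 / 1) Q p = complex_of_real (norm (rank_weight z q p))"
          by (simp add: rank_weight_def norm_mult norm_power norm_power_int z op_weight_def Q_def)
      qed
      ultimately have e: "complex_of_real (\<Sum>\<^sub>\<infinity>p\<in>op_max n. norm (rank_weight z q p)) = 2 * Q * (rc Q 1 n * (1 * Q) ^ n)"
        by (rule has_sum_unique)
      have "(\<Sum>\<^sub>\<infinity>p\<in>op_max n. norm (rank_weight z q p)) \<ge> 0" by (intro infsum_nonneg) auto
      thus ?thesis unfolding e[symmetric] by simp
    qed
    have "summable (\<lambda>n. norm (2 * Q) * norm (rc Q 1 n * (1 * Q) ^ n))"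
      by (intro summable_mult rc_summable Q(1) nzq Q) (use Q in auto)
    hence "(\<lambda>n. norm (2 * Q * (rc Q 1 n * (1 * Q) ^ n))) summable_on UNIV"
      by (intro summable_nonneg_imp_summable_on) (simp_all add: norm_mult)
    thus "(\<lambda>n. \<Sum>\<^sub>\<infinity>p\<in>op_max n. norm (rank_weight z q p)) summable_on UNIV"
      by (simp add: inner)
  qed auto
  have "((\<lambda>x. rank_weight z q (snd x)) has_sum (2 * q * rS q z)) (SIGMA n:UNIV. op_max n)"
  proof (rule has_sum_SigmaI[OF _ sum_n])
    show "((\<lambda>p. rank_weight z q (snd (n, p))) has_sum (2 * q * (rc q z n * (z * q) ^ n))) (op_max n)" for n
      using op_max_has_sum(2)[OF q z, of n]
      by (rule has_sum_cong[THEN iffD1, rotated]) (simp add: rank_weight_op_max[OF _ z0])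
    show "(\<lambda>x. rank_weight z q (snd x)) summable_on (SIGMA n:UNIV. op_max n)"
      using abs by (rule abs_summable_summable)
  qed
  hence "(rank_weight z q has_sum (2 * q * rS q z)) A"
    using has_sum_reindex_bij_betw[OF bij1, of "rank_weight z q"] by simp
  hence "((\<lambda>x. rank_weight z q (snd x)) has_sum (2 * q * rS q z)) (SIGMA N:UNIV. op_pos N)"
    using has_sum_reindex_bij_betw[OF bij2, of "rank_weight z q"] by simp
  hence "((\<lambda>N. (\<Sum>p\<in>op_pos N. z powi overpartition_rank p) * q ^ N) has_sum (2 * q * rS q z)) UNIV"
  proof (rule has_sum_SigmaD)
    fix N :: nat
    have "finite (op_pos N)" using finite_overpartitions[of N] by (simp add: op_pos_def)
    moreover have "(\<Sum>p\<in>op_pos N. z powi overpartition_rank p) * q ^ N = (\<Sum>p\<in>op_pos N. rank_weight z q (snd (N, p)))"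
      unfolding sum_distrib_right
      by (intro sum.cong refl) (auto simp: rank_weight_def op_pos_def overpartitions_def)
    ultimately show "((\<lambda>p. rank_weight z q (snd (N, p))) has_sum ((\<Sum>p\<in>op_pos N. z powi overpartition_rank p) * q ^ N)) (op_pos N)"
      by (intro has_sum_finiteI) auto
  qed
  thus ?thesis by (rule has_sum_imp_sums)
qed

section \<open>Ranks modulo five\<close>

definition T_term :: "complex \<Rightarrow> nat \<Rightarrow> int \<Rightarrow> complex" where
  "T_term q j n = (-1) powi n * q powi (n\<^sup>2) * (q ^ j) powi n / (1 - (q powi n) ^ 5)"

definition T :: "complex \<Rightarrow> nat \<Rightarrow> complex" where
  "T q j = (\<Sum>\<^sub>\<infinity>n\<in>-{0}. T_term q j n)"

lemma T_summable:
  assumes q: "norm q < 1" "q \<noteq> 0"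
  shows "T_term q j summable_on -{0}"
proof -
  \<comment> \<open>This bounds all denominators from below; for n < 0 it uses 1 / |q| - 1 \<ge> 1 -
    |q|.\<close>
  define d where "d = 1 - norm q"
  have d: "d > 0" using q by (simp add: d_def)
  have den: "norm (1 - (q powi n) ^ 5) \<ge> d" if "n \<noteq> 0" for n
  proof (cases "n > 0")
    case True
    have "norm q powi (n * 5) \<le> norm q powi 1" using True q by (intro power_int_decreasing) auto
    hence "norm ((q powi n) ^ 5) \<le> norm q" by (simp add: norm_power norm_power_int power_int_mult)
    moreover have "1 \<le> norm (1 - (q powi n) ^ 5) + norm ((q powi n) ^ 5)"
      by (metis diff_add_cancel norm_one norm_triangle_ineq)
    ultimately show ?thesis by (simp add: d_def)
  next
    case False
    have "norm q powi (n * 5) \<ge> norm q powi (-1)" using False that q by (intro power_int_decreasing) auto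
    hence "norm ((q powi n) ^ 5) \<ge> 1 / norm q"
      by (simp add: norm_power norm_power_int power_int_mult power_int_minus inverse_eq_divide)
    moreover have "norm ((q powi n) ^ 5) \<le> norm (1 - (q powi n) ^ 5) + 1"
      by (metis diff_add_cancel norm_minus_commute norm_one norm_triangle_ineq)
    moreover have "1 / norm q - 1 \<ge> d"
    proof -
      have "1 / norm q - 1 - d = (1 - norm q)\<^sup>2 / norm q" using q by (simp add: d_def field_simps power2_eq_square)
      thus ?thesis by (metis divide_nonneg_nonneg norm_ge_zero zero_le_power2 diff_ge_0_iff_ge)
    qed
    ultimately show ?thesis by linarith
  qed
  have "(\<lambda>n. norm (T_term q j n)) summable_on -{0}"
  proof (rule summable_on_comparison_test)
    show "(\<lambda>n. 1 / d * norm ((-1) powi n * q powi (n\<^sup>2) * (q ^ j) powi n)) summable_on -{0}"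
      by (intro summable_on_cmult_right vt_summable_norm q) (use q in auto)
    fix n :: int assume n: "n \<in> -{0}"
    have "norm (T_term q j n) = norm ((-1) powi n * q powi (n\<^sup>2) * (q ^ j) powi n) / norm (1 - (q powi n) ^ 5)"
      by (simp add: T_term_def norm_divide)
    also have "\<dots> \<le> norm ((-1) powi n * q powi (n\<^sup>2) * (q ^ j) powi n) / d"
      using den[of n] n d by (intro divide_left_mono mult_pos_pos) auto
    finally show "norm (T_term q j n) \<le> 1 / d * norm ((-1) powi n * q powi (n\<^sup>2) * (q ^ j) powi n)" by simp
  qed auto
  thus ?thesis by (rule abs_summable_summable)
qed

lemma powi_fifth_ne_1:
  assumes "norm q < 1" "q \<noteq> 0" "n \<noteq> 0"
  shows "(q powi n) ^ 5 \<noteq> (1::complex)"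
proof -
  have "(q powi n) ^ 5 = q powi (n * 5)" by (simp add: power_int_mult)
  thus ?thesis using power_int_eq_1_iff[OF assms(1,2), of "n * 5"] assms(3) by simp
qed

lemma infsum_uminus_int: "(\<Sum>\<^sub>\<infinity>n\<in>-{0::int}. f (- n)) = (\<Sum>\<^sub>\<infinity>n\<in>-{0}. f n)"
  by (rule infsum_reindex_bij_betw) (rule bij_betwI[of _ _ _ "\<lambda>n. - n"], auto)

text \<open>The substitution n -> -n. Together with \<open>T_0_5\<close> it leaves
  \<open>T q 1\<close> and \<open>T q 2\<close> as the only sums to be determined.\<close>

lemma T_reflect:
  assumes q: "norm q < 1" "q \<noteq> 0" and j: "j \<le> 5"
  shows "T q (5 - j) = - T q j"
proof -
  have t: "T_term q (5 - j) (- n) = - T_term q j n" if n: "n \<noteq> 0" for n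
  proof -
    define X where "X = q powi n"
    have X: "X \<noteq> 0" "X ^ 5 \<noteq> 1" using q powi_fifth_ne_1[OF q n] by (auto simp: X_def)
    have 1: "(q ^ i) powi n = X ^ i" for i
      by (simp add: X_def power_int_power' power_int_power mult.commute)
    have 2: "(q ^ (5 - j)) powi (- n) = 1 / X ^ (5 - j)" "q powi (- n) = 1 / X"
      by (simp_all add: power_int_minus 1 inverse_eq_divide X_def[symmetric])
    have 3: "1 / X ^ (5 - j) / (1 - (1 / X) ^ 5) = - (X ^ j / (1 - X ^ 5))"
    proof -
      have "X ^ 5 = X ^ (5 - j) * X ^ j" using j by (simp flip: power_add)
      have e: "1 - (1 / X) ^ 5 = - (1 - X ^ 5) / X ^ 5" using X by (simp add: field_simps)
      have "1 / A / (- D / Y) = - (Y / A / D)" for A D Y :: complex by simp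
      hence "1 / X ^ (5 - j) / (1 - (1 / X) ^ 5) = - (X ^ 5 / X ^ (5 - j) / (1 - X ^ 5))" unfolding e .
      also have "X ^ 5 / X ^ (5 - j) = X ^ j" using X \<open>X ^ 5 = X ^ (5 - j) * X ^ j\<close> by simp
      finally show ?thesis .
    qed
    have 4: "(-1 :: complex) powi (- n) = (-1) powi n" by (simp add: power_int_minus)
    have "T_term q (5 - j) (- n) = (-1) powi n * q powi (n\<^sup>2) * (1 / X ^ (5 - j) / (1 - (1 / X) ^ 5))"
      unfolding T_term_def 2 4 power2_minus by simp
    also have "\<dots> = - T_term q j n" unfolding 3 T_term_def 1 X_def[symmetric] by simp
    finally show ?thesis .
  qed
  have "T q (5 - j) = (\<Sum>\<^sub>\<infinity>n\<in>-{0}. T_term q (5 - j) (- n))" unfolding T_def by (rule infsum_uminus_int[symmetric])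
  also have "\<dots> = (\<Sum>\<^sub>\<infinity>n\<in>-{0}. - T_term q j n)" by (rule infsum_cong) (use t in auto)
  also have "\<dots> = - T q j" unfolding T_def by (rule infsum_uminus)
  finally show ?thesis .
qed

lemma vt_1_split:
  assumes q: "norm q < 1" "q \<noteq> 0"
  shows "(\<Sum>\<^sub>\<infinity>n\<in>-{0::int}. (-1) powi n * q powi (n\<^sup>2)) = vt q 1 - 1"
proof -
  have s: "(\<lambda>n::int. (-1) powi n * q powi (n\<^sup>2)) summable_on A" for A using vt_summable[OF q, of 1 A] by simp
  have "vt q 1 = (\<Sum>\<^sub>\<infinity>n\<in>{0} \<union> -{0::int}. (-1) powi n * q powi (n\<^sup>2))"
    unfolding vt_def by (simp add: Un_commute)
  also have "\<dots> = infsum (\<lambda>n::int. (-1) powi n * q powi (n\<^sup>2)) {0} + (\<Sum>\<^sub>\<infinity>n\<in>-{0::int}. (-1) powi n * q powi (n\<^sup>2))"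
    by (rule infsum_Un_disjoint) (use s in auto)
  finally show ?thesis by simp
qed

lemma T_0_5:
  assumes q: "norm q < 1" "q \<noteq> 0"
  shows "2 * T q 5 = 1 - vt q 1"
proof -
  have "(\<Sum>\<^sub>\<infinity>n\<in>-{0}. T_term q 0 n + (-1) * T_term q 5 n) = T q 0 + (\<Sum>\<^sub>\<infinity>n\<in>-{0}. (-1) * T_term q 5 n)"
    unfolding T_def by (intro infsum_add summable_on_cmult_right T_summable q)
  also have "(\<Sum>\<^sub>\<infinity>n\<in>-{0}. (-1) * T_term q 5 n) = (-1) * T q 5"
    unfolding T_def by (rule infsum_cmult_right')
  finally have "T q 0 - T q 5 = (\<Sum>\<^sub>\<infinity>n\<in>-{0}. T_term q 0 n + - T_term q 5 n)" by simp
  also have "\<dots> = (\<Sum>\<^sub>\<infinity>n\<in>-{0::int}. (-1) powi n * q powi (n\<^sup>2))"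
  proof (rule infsum_cong)
    fix n :: int assume "n \<in> -{0}"
    hence n: "(q powi n) ^ 5 \<noteq> 1" using powi_fifth_ne_1[OF q] by auto
    have 1: "(q ^ i) powi n = (q powi n) ^ i" for i
      by (simp add: power_int_power' power_int_power mult.commute)
    show "T_term q 0 n + - T_term q 5 n = (-1) powi n * q powi (n\<^sup>2)"
      unfolding T_term_def 1 using n by (simp add: divide_simps) (simp add: algebra_simps)
  qed
  also have "\<dots> = vt q 1 - 1" by (rule vt_1_split[OF q])
  finally have "T q 0 - T q 5 = vt q 1 - 1" .
  moreover have "T q 0 = - T q 5" using T_reflect[OF q, of 5] by simp
  ultimately show ?thesis by algebra
qed

lemma root_of_unity_norm: "z ^ 5 = 1 \<Longrightarrow> norm (z :: complex) = 1"
  by (metis norm_one norm_power norm_ge_zero power_eq_1_iff zero_less_numeral power_eq_imp_eq_base one_power2 power_one zero_le_one)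

text \<open>For z^5 = 1 and X = q^n, the geometric sum turns z X / (1 - z X) into (z X + z^2 X^2 +
  z^3 X^3 + z^4 X^4 + X^5) / (1 - X^5), so the Appell sum becomes a combination of the sums
  \<open>T q j\<close>.\<close>

lemma vt_rank_function:
  assumes q: "norm q < 1" "q \<noteq> 0" and z: "z ^ 5 = 1" "z \<noteq> 1"
  shows "vt q 1 * (1 + 2 * q * rS q z) = 1 + 2 * (2 - (z + z ^ 4)) * T q 1 + 2 * (3 * (z + z ^ 4) - 1) * T q 2"
proof -
  have nz: "norm z = 1" by (rule root_of_unity_norm[OF z(1)])
  have z0: "z \<noteq> 0" using nz by auto
  have orb: "z \<notin> orbits q {1}"
  proof
    assume "z \<in> orbits q {1}"
    then obtain k where k: "z = q powi k" using orbits_1_iff by blast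
    hence "norm q powi k = norm q powi 0" using nz by (simp add: norm_power_int)
    hence "k = 0" using power_int_unit_inj[of "norm q" k 0] q by simp
    thus False using k z by simp
  qed
  have zp: "z * q powi n \<noteq> 1" for n by (rule orbits_1D[OF q(2) orb])
  have "z \<in> ball 0 (1 / norm q) - {0} - orbits q {1}" using nz z0 orb q by (simp add: field_simps)
  note main = rank_function_eq[OF q this]
  have "app_on q q (-{0}) z * z = (\<Sum>\<^sub>\<infinity>n\<in>-{0}. z * T_term q 1 n + z ^ 2 * T_term q 2 n + z ^ 3 * T_term q 3 n + z ^ 4 * T_term q 4 n + T_term q 5 n)"
    unfolding app_on_def infsum_cmult_left'[symmetric]
  proof (rule infsum_cong)
    fix n :: int assume "n \<in> -{0}"
    hence n: "(q powi n) ^ 5 \<noteq> 1" using powi_fifth_ne_1[OF q] by auto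
    have 1: "(q ^ i) powi n = (q powi n) ^ i" for i
      by (simp add: power_int_power' power_int_power mult.commute)
    define X where "X = q powi n"
    define A where "A = (-1) powi n * q powi (n\<^sup>2)"
    have X: "X ^ 5 \<noteq> 1" "1 - z * X \<noteq> 0" using n zp[of n] by (auto simp: X_def)
    have "(1 - X ^ 5) = (1 - z * X) * (1 + z * X + z ^ 2 * X ^ 2 + z ^ 3 * X ^ 3 + z ^ 4 * X ^ 4)"
      using z(1) by algebra
    hence "z * X * (1 - X ^ 5) = (1 - z * X) * (z * X + z ^ 2 * X ^ 2 + z ^ 3 * X ^ 3 + z ^ 4 * X ^ 4 + X ^ 5)"
      using z(1) by algebra
    hence "z * X / (1 - z * X) = (z * X + z ^ 2 * X ^ 2 + z ^ 3 * X ^ 3 + z ^ 4 * X ^ 4 + X ^ 5) / (1 - X ^ 5)"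
      using X by (simp add: frac_eq_eq mult_ac)
    hence "A * (z * X / (1 - z * X)) = A * ((z * X + z ^ 2 * X ^ 2 + z ^ 3 * X ^ 3 + z ^ 4 * X ^ 4 + X ^ 5) / (1 - X ^ 5))"
      by simp
    thus "app_term q q n z * z = z * T_term q 1 n + z ^ 2 * T_term q 2 n + z ^ 3 * T_term q 3 n + z ^ 4 * T_term q 4 n + T_term q 5 n"
      unfolding app_term_def T_term_def 1 X_def[symmetric] A_def[symmetric]
      by (simp add: add_divide_distrib distrib_left mult_ac)
  qed
  also have "\<dots> = z * T q 1 + z ^ 2 * T q 2 + z ^ 3 * T q 3 + z ^ 4 * T q 4 + T q 5"
    unfolding T_def
    by (subst infsum_add infsum_cmult_right'; (intro summable_on_add summable_on_cmult_right T_summable q)?)+ simp?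
  finally have e1: "app_on q q (-{0}) z * z = z * T q 1 + z ^ 2 * T q 2 + z ^ 3 * T q 3 + z ^ 4 * T q 4 + T q 5" .
  have e2: "app q q z = 1 / (1 - z) + app_on q q (-{0}) z"
    using app_split[OF q q(2) z0, of 0] by (simp add: app_term_def)
  have e3: "(1 - z) * app q q z = 1 + (1 - z) * app_on q q (-{0}) z" unfolding e2 using z by (simp add: distrib_left)
  have t: "T q 4 = - T q 1" "T q 3 = - T q 2" "2 * T q 5 = 1 - vt q 1"
    using T_reflect[OF q, of 1] T_reflect[OF q, of 2] T_0_5[OF q] by simp_all
  \<comment> \<open>The rank identity carries a factor 1 + z, to be cancelled.\<close>
  have "z + 1 \<noteq> 0"
  proof
    assume "z + 1 = 0"
    hence "z = -1" by (simp add: eq_neg_iff_add_eq_0)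
    thus False using z by simp
  qed
  moreover have "(z + 1) * (vt q 1 * (1 + 2 * q * rS q z)) = (z + 1) * (1 + 2 * (2 - (z + z ^ 4)) * T q 1 + 2 * (3 * (z + z ^ 4) - 1) * T q 2)"
  proof -
    have s: "1 + z + z ^ 2 + z ^ 3 + z ^ 4 = 0"
    proof -
      have "(z - 1) * (1 + z + z ^ 2 + z ^ 3 + z ^ 4) = 0" using z(1) by algebra
      thus ?thesis using z(2) by simp
    qed
    have "(z + 1) * (vt q 1 * (1 + 2 * q * rS q z)) = (1 - z) * vt q 1 + 2 * z * (1 + (1 - z) * app_on q q (-{0}) z)"
      using main e3 by algebra
    also have "\<dots> = 1 + z + 2 * (1 - z) * (z * T q 1 + z ^ 2 * T q 2 - z ^ 3 * T q 2 - z ^ 4 * T q 1)"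
      using e1 t by algebra
    also have "\<dots> = (z + 1) * (1 + 2 * (2 - (z + z ^ 4)) * T q 1 + 2 * (3 * (z + z ^ 4) - 1) * T q 2)"
      using s z(1) by algebra
    finally show ?thesis .
  qed
  ultimately show ?thesis by simp
qed

definition rank_count :: "int \<Rightarrow> nat \<Rightarrow> complex" where
  "rank_count s N = of_nat (Nbar s 5 N)"

text \<open>Fourier inversion on the residues modulo 5: averaging over the powers of w selects the
  ranks congruent to s.\<close>

lemma Nbar_fourier:
  assumes w: "w ^ 5 = 1" "w \<noteq> (1::complex)"
  shows "5 * rank_count s N = (\<Sum>k<5. (1 / w ^ k) powi s * (\<Sum>p\<in>op_pos N. (w ^ k) powi overpartition_rank p))"
proof -
  have fin: "finite (op_pos N)" using finite_overpartitions[of N] by (simp add: op_pos_def)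
  have w0: "w \<noteq> 0" using w by auto
  have per: "w powi (m + 5 * n) = w powi m" for m n
    using w0 w(1) by (simp add: power_int_add power_int_mult)
  have orth: "(\<Sum>k<5. (w ^ k) powi m) = (if [m = 0] (mod 5) then 5 else 0)" for m :: int
  proof -
    define u where "u = w powi m"
    have u: "(w ^ k) powi m = u ^ k" for k by (simp add: u_def power_int_power' power_int_power mult.commute)
    have u5: "u ^ 5 = 1" using per[of 0 m] by (simp add: u_def mult.commute flip: power_int_mult) (simp add: power_int_mult mult.commute)?
    show ?thesis
    proof (cases "[m = 0] (mod 5)")
      case True
      then obtain n where "m = 5 * n" by (auto simp: cong_0_iff)
      hence "u = 1" using per[of 0 n] by (simp add: u_def)
      thus ?thesis using True u by simp
    next
      case False
      have "u \<noteq> 1"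
      \<comment> \<open>If w^m = 1 with m prime to 5, an inverse of m modulo 5 would give w =
        1.\<close>
      proof
        assume u1: "u = 1"
        have "prime (5::int)" by simp
        from prime_imp_coprime[OF this, of m] have "coprime m 5"
          using False by (simp add: cong_0_iff coprime_commute)
        then obtain a where "[m * a = 1] (mod 5)" using cong_solve_coprime_int by blast
        then obtain k where "1 = m * a + 5 * k" by (auto simp: cong_iff_lin mult.commute)
        then obtain b where "m * a = 1 + 5 * b" using that[of "- k"] by simp
        hence "w powi (m * a) = w" using per[of 1 b] by simp
        moreover have "w powi (m * a) = 1" using u1 by (simp add: power_int_mult u_def)
        ultimately show False using w by simp
      qed
      moreover have "(u - 1) * (\<Sum>k<5. u ^ k) = 0"
        using u5 by (simp add: power_diff_1_eq[symmetric])
      ultimately show ?thesis using False u by simp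
    qed
  qed
  have "(\<Sum>k<5. (1 / w ^ k) powi s * (\<Sum>p\<in>op_pos N. (w ^ k) powi overpartition_rank p)) =
      (\<Sum>p\<in>op_pos N. \<Sum>k<5. (w ^ k) powi (overpartition_rank p - s))"
    unfolding sum_distrib_left
    by (subst sum.swap) (intro sum.cong refl, use w0 in \<open>simp add: power_int_diff power_int_divide_distrib\<close>)
  also have "\<dots> = (\<Sum>p\<in>op_pos N. if [overpartition_rank p = s] (mod 5) then 5 else 0)"
    unfolding orth by (intro sum.cong refl) (simp add: cong_diff_iff_cong_0)
  also have "\<dots> = 5 * of_nat (card {p \<in> op_pos N. [overpartition_rank p = s] (mod 5)})"
    using fin by (simp add: sum.If_cases Int_def)
  also have "{p \<in> op_pos N. [overpartition_rank p = s] (mod 5)} =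
     {p \<in> overpartitions N. fst p \<noteq> {#} \<and> [overpartition_rank p = s] (mod int 5)}"
    by (auto simp: op_pos_def)
  finally show ?thesis by (simp add: rank_count_def Nbar_def)
qed

lemma rank_diff_sums:
  assumes q: "norm q < 1" "q \<noteq> 0"
  shows "(\<lambda>N. (rank_count 1 N - rank_count 2 N) * q ^ N) sums ((- 2 * T q 1 + 6 * T q 2) / vt q 1)"
    and "(\<lambda>N. (rank_count 0 N - rank_count 2 N) * q ^ N) sums ((1 - vt q 1 + 4 * T q 1 - 2 * T q 2) / vt q 1)"
proof -
  define w where "w = cis (2 * pi / 5)"
  have "w ^ 5 = cis (real 5 * (2 * pi / 5))" unfolding w_def by (rule Complex.DeMoivre)
  hence w5: "w ^ 5 = 1" by simp
  have w1: "w \<noteq> 1"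
  proof
    assume "w = 1"
    hence "cos (2 * pi / 5) = 1" by (simp add: w_def complex_eq_iff)
    moreover have "cos (2 * pi / 5) < cos 0" by (rule cos_monotone_0_pi) auto
    ultimately show False by simp
  qed
  have w0: "w \<noteq> 0" using w5 by auto
  have s: "1 + w + w ^ 2 + w ^ 3 + w ^ 4 = 0"
  proof -
    have "(w - 1) * (1 + w + w ^ 2 + w ^ 3 + w ^ 4) = 0" using w5 by algebra
    thus ?thesis using w1 by simp
  qed
  have wk: "w ^ 2 \<noteq> 1" "w ^ 3 \<noteq> 1" "w ^ 4 \<noteq> 1"
    using w5 w1 by algebra+
  define g where "g = (\<lambda>k N. \<Sum>p\<in>op_pos N. (w ^ k) powi overpartition_rank p)"
  have g: "(\<lambda>N. g k N * q ^ N) sums (2 * q * rS q (w ^ k))" for k unfolding g_def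
    by (rule rank_generating_function[OF q(1)]) (simp add: w_def norm_power)
  have v: "vt q 1 \<noteq> 0" by (rule vt_1_nonzero[OF q])
  \<comment> \<open>The transform at a root z depends on z + 1 / z only. Hence just two values
    occur, at w + w^4 and w^2 + w^3, and the trivial root drops out of the differences.\<close>
  define H where "H = (\<lambda>c. (1 + 2 * (2 - c) * T q 1 + 2 * (3 * c - 1) * T q 2) / vt q 1 - 1)"
  have Hz: "2 * q * rS q z = H (z + z ^ 4)" if "z ^ 5 = 1" "z \<noteq> 1" for z
    using vt_rank_function[OF q that] v by (simp add: H_def field_simps)
  have pw: "(w ^ 2) ^ 5 = 1" "(w ^ 3) ^ 5 = 1" "(w ^ 4) ^ 5 = 1" "(w ^ 2) ^ 4 = w ^ 3" "(w ^ 3) ^ 4 = w ^ 2" "(w ^ 4) ^ 4 = w"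
    using w5 by algebra+
  have Hs: "(\<lambda>N. g 1 N * q ^ N) sums H (w + w ^ 4)" "(\<lambda>N. g 2 N * q ^ N) sums H (w ^ 2 + w ^ 3)"
    "(\<lambda>N. g 3 N * q ^ N) sums H (w ^ 3 + w ^ 2)" "(\<lambda>N. g 4 N * q ^ N) sums H (w ^ 4 + w)"
    using g[of 1] g[of 2] g[of 3] g[of 4] Hz[OF w5 w1] Hz[OF pw(1) wk(1)] Hz[OF pw(2) wk(2)] Hz[OF pw(3) wk(3)]
    unfolding pw by simp_all
  hence Hs: "(\<lambda>N. g 1 N * q ^ N) sums H (w + w ^ 4)" "(\<lambda>N. g 2 N * q ^ N) sums H (w ^ 2 + w ^ 3)"
    "(\<lambda>N. g 3 N * q ^ N) sums H (w ^ 2 + w ^ 3)" "(\<lambda>N. g 4 N * q ^ N) sums H (w + w ^ 4)"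
    by (simp_all only: add.commute)
  have "w ^ 1 * w ^ 4 = 1" "w ^ 2 * w ^ 3 = 1" using w5 by algebra+
  hence inv: "1 / w ^ 1 = w ^ 4" "1 / w ^ 2 = w ^ 3" "1 / w ^ 3 = w ^ 2" "1 / w ^ 4 = w ^ 1" "1 / w ^ 0 = 1"
    using w0 by (simp_all add: divide_eq_eq mult.commute)
  have sum5: "(\<Sum>k<5. f k) = f 0 + f 1 + f 2 + f 3 + f 4" for f :: "nat \<Rightarrow> complex"
    by (simp add: eval_nat_numeral)
  have sq: "(w ^ 4) ^ 2 = w ^ 3" "(w ^ 3) ^ 2 = w" "(w ^ 2) ^ 2 = w ^ 4" "(w ^ 1) ^ 2 = w ^ 2"
    using w5 by algebra+
  have p2: "x powi 2 = x ^ 2" for x :: complex using power_int_of_nat[of x 2] by simp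
  have c: "5 * rank_count 0 N = g 0 N + g 1 N + g 2 N + g 3 N + g 4 N"
    "5 * rank_count 1 N = g 0 N + w ^ 4 * g 1 N + w ^ 3 * g 2 N + w ^ 2 * g 3 N + w * g 4 N"
    "5 * rank_count 2 N = g 0 N + w ^ 3 * g 1 N + w * g 2 N + w ^ 4 * g 3 N + w ^ 2 * g 4 N" for N
    using Nbar_fourier[OF w5 w1, of 0 N, folded g_def, unfolded sum5 inv]
      Nbar_fourier[OF w5 w1, of 1 N, folded g_def, unfolded sum5 inv]
      Nbar_fourier[OF w5 w1, of 2 N, folded g_def, unfolded sum5 inv p2 sq]
    unfolding g_def by simp_all
  have "5 * ((r1 - r2) * Q) = (w ^ 4 - w ^ 3) * (G1 * Q) + (w ^ 3 - w) * (G2 * Q) + (w ^ 2 - w ^ 4) * (G3 * Q) + (w - w ^ 2) * (G4 * Q)"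
    if "5 * r1 = G0 + w ^ 4 * G1 + w ^ 3 * G2 + w ^ 2 * G3 + w * G4" "5 * r2 = G0 + w ^ 3 * G1 + w * G2 + w ^ 4 * G3 + w ^ 2 * G4"
    for r1 r2 Q G0 G1 G2 G3 G4 using that by algebra
  hence d1: "5 * ((rank_count 1 N - rank_count 2 N) * q ^ N) = (w ^ 4 - w ^ 3) * (g 1 N * q ^ N) + (w ^ 3 - w) * (g 2 N * q ^ N)
      + (w ^ 2 - w ^ 4) * (g 3 N * q ^ N) + (w - w ^ 2) * (g 4 N * q ^ N)" for N
    using c(2,3)[of N] by blast
  have "5 * ((r1 - r2) * Q) = (1 - w ^ 3) * (G1 * Q) + (1 - w) * (G2 * Q) + (1 - w ^ 4) * (G3 * Q) + (1 - w ^ 2) * (G4 * Q)"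
    if "5 * r1 = G0 + G1 + G2 + G3 + G4" "5 * r2 = G0 + w ^ 3 * G1 + w * G2 + w ^ 4 * G3 + w ^ 2 * G4"
    for r1 r2 Q G0 G1 G2 G3 G4 using that by algebra
  hence d0: "5 * ((rank_count 0 N - rank_count 2 N) * q ^ N) = (1 - w ^ 3) * (g 1 N * q ^ N) + (1 - w) * (g 2 N * q ^ N)
      + (1 - w ^ 4) * (g 3 N * q ^ N) + (1 - w ^ 2) * (g 4 N * q ^ N)" for N
    using c(1,3)[of N] by blast
  have "(\<lambda>N. 5 * ((rank_count 1 N - rank_count 2 N) * q ^ N)) sums ((w ^ 4 - w ^ 3) * H (w + w ^ 4) + (w ^ 3 - w) * H (w ^ 2 + w ^ 3)
      + (w ^ 2 - w ^ 4) * H (w ^ 2 + w ^ 3) + (w - w ^ 2) * H (w + w ^ 4))"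
    unfolding d1 by (intro sums_add sums_mult Hs)
  from sums_mult[OF this, of "1 / 5"]
  have S1: "(\<lambda>N. (rank_count 1 N - rank_count 2 N) * q ^ N) sums (1 / 5 * ((w ^ 4 - w ^ 3) * H (w + w ^ 4) + (w ^ 3 - w) * H (w ^ 2 + w ^ 3)
      + (w ^ 2 - w ^ 4) * H (w ^ 2 + w ^ 3) + (w - w ^ 2) * H (w + w ^ 4)))" by simp
  have "(\<lambda>N. 5 * ((rank_count 0 N - rank_count 2 N) * q ^ N)) sums ((1 - w ^ 3) * H (w + w ^ 4) + (1 - w) * H (w ^ 2 + w ^ 3)
      + (1 - w ^ 4) * H (w ^ 2 + w ^ 3) + (1 - w ^ 2) * H (w + w ^ 4))"
    unfolding d0 by (intro sums_add sums_mult Hs)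
  from sums_mult[OF this, of "1 / 5"]
  have S0: "(\<lambda>N. (rank_count 0 N - rank_count 2 N) * q ^ N) sums (1 / 5 * ((1 - w ^ 3) * H (w + w ^ 4) + (1 - w) * H (w ^ 2 + w ^ 3)
      + (1 - w ^ 4) * H (w ^ 2 + w ^ 3) + (1 - w ^ 2) * H (w + w ^ 4)))" by simp
  define iv t1 t2 where "iv = 1 / vt q 1" and "t1 = T q 1" and "t2 = T q 2"
  have Hc: "H c = (1 + 2 * (2 - c) * t1 + 2 * (3 * c - 1) * t2) * iv - 1" for c
    by (simp add: H_def iv_def t1_def t2_def)
  have e1: "(w ^ 4 - w ^ 3) * H (w + w ^ 4) + (w ^ 3 - w) * H (w ^ 2 + w ^ 3)
      + (w ^ 2 - w ^ 4) * H (w ^ 2 + w ^ 3) + (w - w ^ 2) * H (w + w ^ 4) = 5 * ((- 2 * t1 + 6 * t2) * iv)"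
    unfolding Hc using s w5 by algebra
  have f1: "1 / 5 * (5 * ((- 2 * t1 + 6 * t2) * iv)) = (- 2 * T q 1 + 6 * T q 2) / vt q 1"
  proof -
    have "1 / 5 * (5 * (u * (1 / v))) = u / v" for u v :: complex by simp
    thus ?thesis unfolding iv_def t1_def t2_def .
  qed
  show "(\<lambda>N. (rank_count 1 N - rank_count 2 N) * q ^ N) sums ((- 2 * T q 1 + 6 * T q 2) / vt q 1)"
    using S1 unfolding e1 f1 .
  have e0: "(1 - w ^ 3) * H (w + w ^ 4) + (1 - w) * H (w ^ 2 + w ^ 3)
      + (1 - w ^ 4) * H (w ^ 2 + w ^ 3) + (1 - w ^ 2) * H (w + w ^ 4) = 5 * ((1 + 4 * t1 - 2 * t2) * iv - 1)"
    unfolding Hc using s w5 by algebra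
  have f0: "1 / 5 * (5 * ((1 + 4 * t1 - 2 * t2) * iv - 1)) = (1 - vt q 1 + 4 * T q 1 - 2 * T q 2) / vt q 1"
  proof -
    have "1 / 5 * (5 * (u * (1 / y) - 1)) = (u - y) / y" if "y \<noteq> 0" for u y :: complex
      using that by (simp add: diff_divide_distrib)
    from this[OF v] have "1 / 5 * (5 * ((1 + 4 * t1 - 2 * t2) * iv - 1)) = (1 + 4 * t1 - 2 * t2 - vt q 1) / vt q 1"
      unfolding iv_def .
    also have "1 + 4 * t1 - 2 * t2 - vt q 1 = 1 - vt q 1 + 4 * T q 1 - 2 * T q 2" by (simp add: t1_def t2_def)
    finally show ?thesis .
  qed
  show "(\<lambda>N. (rank_count 0 N - rank_count 2 N) * q ^ N) sums ((1 - vt q 1 + 4 * T q 1 - 2 * T q 2) / vt q 1)"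
    using S0 unfolding e0 f0 .
qed

section \<open>Dissection by residues modulo five\<close>

lemma infsum_mod5:
  fixes f :: "int \<Rightarrow> complex"
  assumes f: "f summable_on UNIV"
  shows "infsum f UNIV = (\<Sum>\<^sub>\<infinity>m. f (5 * m)) + (\<Sum>\<^sub>\<infinity>m. f (5 * m + 1)) + (\<Sum>\<^sub>\<infinity>m. f (5 * m - 1))
    + (\<Sum>\<^sub>\<infinity>m. f (5 * m + 2)) + (\<Sum>\<^sub>\<infinity>m. f (5 * m - 2))"
proof -
  define R where "R = {0, 1, -1, 2, -2 :: int}"
  have bij: "bij_betw (\<lambda>p. 5 * snd p + fst p) (R \<times> UNIV) UNIV"
  proof (rule bij_betwI[where g = "\<lambda>n. ((n + 2) mod 5 - 2, (n + 2) div 5)"])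
    show "(\<lambda>n. ((n + 2) mod 5 - 2, (n + 2) div 5)) \<in> UNIV \<rightarrow> R \<times> UNIV"
    proof
      fix n :: int
      have "(n + 2) mod 5 \<in> {0..4}" by simp
      hence "(n + 2) mod 5 \<in> {0, 1, 2, 3, 4}" by auto
      thus "((n + 2) mod 5 - 2, (n + 2) div 5) \<in> R \<times> UNIV" by (auto simp: R_def)
    qed
    show "((5 * snd x + fst x + 2) mod 5 - 2, (5 * snd x + fst x + 2) div 5) = x" if "x \<in> R \<times> UNIV" for x
      using that by (cases x) (auto simp: R_def)
  qed (auto simp: algebra_simps)
  have "((\<lambda>p. f (5 * snd p + fst p)) has_sum infsum f UNIV) (R \<times> UNIV)"
    using has_sum_reindex_bij_betw[OF bij, of f "infsum f UNIV"] has_sum_infsum[OF f] by simp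
  hence "((\<lambda>r. \<Sum>\<^sub>\<infinity>m. f (5 * m + r)) has_sum infsum f UNIV) R"
  proof (rule has_sum_SigmaD)
    fix r
    have "f summable_on range (\<lambda>m. 5 * m + r)" by (rule summable_on_subset_banach[OF f]) auto
    moreover have "inj (\<lambda>m. 5 * m + r)" by (auto simp: inj_on_def)
    ultimately have "(\<lambda>m. f (5 * m + r)) summable_on UNIV" by (simp add: summable_on_reindex o_def)
    thus "((\<lambda>m. f (5 * snd (r, m) + fst (r, m))) has_sum (\<Sum>\<^sub>\<infinity>m. f (5 * m + r))) UNIV" by simp
  qed
  moreover have "((\<lambda>r. \<Sum>\<^sub>\<infinity>m. f (5 * m + r)) has_sum (\<Sum>r\<in>R. \<Sum>\<^sub>\<infinity>m. f (5 * m + r))) R"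
    by (rule has_sum_finite) (simp add: R_def)
  ultimately have "infsum f UNIV = (\<Sum>r\<in>R. \<Sum>\<^sub>\<infinity>m. f (5 * m + r))" by (rule has_sum_unique)
  thus ?thesis by (simp add: R_def add_ac)
qed

lemma minus_one_powi_5: "(-1 :: complex) powi (5 * m + r) = (-1) powi r * (-1) powi m"
  by (cases "even m"; cases "even r") (auto simp: power_int_minus_left)

text \<open>For n = 5 m + r the exponent n^2 + j n equals r^2 + j r + 25 m^2 + 5 (2 r + j) m. This
  gives base x^25, parameter q^(2 r + j) and argument q^r, where q = x^5.\<close>

lemma T_term_mod5:
  assumes x: "x \<noteq> 0"
  shows "T_term x j (5 * m + r) = ((-1) powi r * x powi (r\<^sup>2 + int j * r)) *
    app_term ((x ^ 5) ^ 5) ((x ^ 5) powi (2 * r + int j)) m ((x ^ 5) powi r)"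
proof -
  have p: "(x ^ k) powi n = x powi (int k * n)" for k n by (simp add: power_int_mult)
  have 1: "x powi ((5 * m + r)\<^sup>2) * (x ^ j) powi (5 * m + r) =
      x powi (r\<^sup>2 + int j * r) * (((x ^ 5) ^ 5) powi (m\<^sup>2) * ((x ^ 5) powi (2 * r + int j)) powi m)"
  proof -
    have "(5 * m + r)\<^sup>2 + int j * (5 * m + r) = r\<^sup>2 + int j * r + (25 * m\<^sup>2 + 5 * (2 * r + int j) * m)"
      by (simp add: power2_eq_square algebra_simps)
    hence "x powi ((5 * m + r)\<^sup>2) * x powi (int j * (5 * m + r)) = x powi (r\<^sup>2 + int j * r) * (x powi (25 * m\<^sup>2) * x powi (5 * (2 * r + int j) * m))"
      using x by (simp only: power_int_add[symmetric] simp_thms)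
    moreover have "((x ^ 5) ^ 5) powi (m\<^sup>2) = x powi (25 * m\<^sup>2)" by (simp add: p flip: power_mult)
    moreover have "((x ^ 5) powi (2 * r + int j)) powi m = x powi (5 * (2 * r + int j) * m)"
      by (simp add: p power_int_mult)
    ultimately show ?thesis by (simp only: p)
  qed
  have 2: "(x powi (5 * m + r)) ^ 5 = (x ^ 5) powi r * ((x ^ 5) ^ 5) powi m"
  proof -
    have "(x powi (5 * m + r)) ^ 5 = x powi ((5 * m + r) * 5)" unfolding power_int_mult by simp
    also have "(5 * m + r) * 5 = 5 * r + 25 * m" by simp
    also have "x powi \<dots> = x powi (5 * r) * x powi (25 * m)" using x by (intro power_int_add) auto
    also have "\<dots> = (x ^ 5) powi r * ((x ^ 5) ^ 5) powi m" by (simp add: p flip: power_mult)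
    finally show ?thesis .
  qed
  have gen: "a * b * X * Y / D = a * c * (b * U * V / D)" if "X * Y = c * (U * V)" for a b c X Y U V D :: complex
    using that by (metis (no_types, opaque_lifting) mult.assoc mult.commute times_divide_eq_right)
  show ?thesis unfolding T_term_def app_term_def minus_one_powi_5 2 by (rule gen[OF 1])
qed

text \<open>The residues 0, 1, -1, 2, -2 are treated separately. For residue 0 the argument is the
  pole 1, and the omitted index n = 0 becomes the omitted index m = 0.\<close>

lemma T_split:
  assumes x: "norm x < 1" "x \<noteq> 0"
  defines "A \<equiv> (\<lambda>i k. app ((x ^ 5) ^ 5) ((x ^ 5) powi i) ((x ^ 5) powi k))"
  shows "T x j = app_on ((x ^ 5) ^ 5) ((x ^ 5) ^ j) (-{0}) 1 - x powi (1 + int j) * A (2 + int j) 1 - x powi (1 - int j) * A (int j - 2) (-1)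
     + x powi (4 + 2 * int j) * A (4 + int j) 2 + x powi (4 - 2 * int j) * A (int j - 4) (-2)"
proof -
  define F where "F = (\<lambda>n. if n = 0 then 0 else T_term x j n)"
  have sF: "F summable_on UNIV"
    using T_summable[OF x, of j] by (rule summable_on_cong_neutral[THEN iffD1, rotated -1]) (auto simp: F_def)
  have TF: "T x j = infsum F UNIV"
    unfolding T_def by (rule infsum_cong_neutral) (auto simp: F_def)
  have B0: "(\<Sum>\<^sub>\<infinity>m. F (5 * m)) = app_on ((x ^ 5) ^ 5) ((x ^ 5) ^ j) (-{0}) 1"
    unfolding app_on_def
  proof (rule infsum_cong_neutral)
    fix m :: int assume "m \<in> UNIV \<inter> - {0}"
    thus "F (5 * m) = app_term ((x ^ 5) ^ 5) ((x ^ 5) ^ j) m 1"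
      using T_term_mod5[OF x(2), of j m 0] by (simp add: F_def)
  qed (auto simp: F_def)
  have B: "(\<Sum>\<^sub>\<infinity>m. F (5 * m + r)) = ((-1) powi r * x powi (r\<^sup>2 + int j * r)) * A (2 * r + int j) r" if "\<not> 5 dvd r" for r
  proof -
    have "5 * m + r \<noteq> 0" for m
    proof
      assume "5 * m + r = 0"
      hence "r = 5 * (- m)" by simp
      thus False using that dvd_triv_left by metis
    qed
    hence "F (5 * m + r) = ((-1) powi r * x powi (r\<^sup>2 + int j * r)) *
        app_term ((x ^ 5) ^ 5) ((x ^ 5) powi (2 * r + int j)) m ((x ^ 5) powi r)" for m
      using T_term_mod5[OF x(2), of j m r] by (simp add: F_def)
    thus ?thesis unfolding A_def app_on_def by (simp only: infsum_cmult_right')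
  qed
  have B1: "(\<Sum>\<^sub>\<infinity>m. F (5 * m + 1)) = - (x powi (1 + int j) * A (2 + int j) 1)"
    using B[of 1] by simp
  have B2: "(\<Sum>\<^sub>\<infinity>m. F (5 * m - 1)) = - (x powi (1 - int j) * A (int j - 2) (-1))"
    using B[of "-1"] by simp
  have B3: "(\<Sum>\<^sub>\<infinity>m. F (5 * m + 2)) = x powi (4 + 2 * int j) * A (4 + int j) 2"
    using B[of 2] by (simp add: mult.commute)
  have B4: "(\<Sum>\<^sub>\<infinity>m. F (5 * m - 2)) = x powi (4 - 2 * int j) * A (int j - 4) (-2)"
    using B[of "-2"] by (simp add: mult.commute)
  show ?thesis unfolding TF infsum_mod5[OF sF] B0 B1 B2 B3 B4 by simp
qed

lemma vt_split:
  assumes x: "norm x < 1" "x \<noteq> 0"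
  defines "Q \<equiv> (x ^ 5) ^ 5"
  shows "vt x 1 = vt Q 1 - 2 * x * vt Q ((x ^ 5)\<^sup>2) + 2 * x ^ 4 * vt Q ((x ^ 5) ^ 4)"
proof -
  define F where "F = (\<lambda>n::int. (-1) powi n * x powi (n\<^sup>2))"
  have sF: "F summable_on UNIV" using vt_summable[OF x, of 1 UNIV] by (simp add: F_def)
  have vF: "vt x 1 = infsum F UNIV" by (simp add: vt_def F_def)
  have p: "(x ^ k) powi n = x powi (int k * n)" for k n by (simp add: power_int_mult)
  have B: "(\<Sum>\<^sub>\<infinity>m. F (5 * m + r)) = ((-1) powi r * x powi (r\<^sup>2)) * vt Q ((x ^ 5) powi (2 * r))" for r
  proof -
    have "F (5 * m + r) = ((-1) powi r * x powi (r\<^sup>2)) * ((-1) powi m * Q powi (m\<^sup>2) * ((x ^ 5) powi (2 * r)) powi m)" for m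
    proof -
      have "(5 * m + r)\<^sup>2 = r\<^sup>2 + (25 * m\<^sup>2 + 5 * (2 * r) * m)"
        by (simp add: power2_eq_square algebra_simps)
      hence "x powi ((5 * m + r)\<^sup>2) = x powi (r\<^sup>2) * (x powi (25 * m\<^sup>2) * x powi (5 * (2 * r) * m))"
        using x by (simp only: power_int_add[symmetric] simp_thms)
      moreover have "Q powi (m\<^sup>2) = x powi (25 * m\<^sup>2)" by (simp add: Q_def p flip: power_mult)
      moreover have "((x ^ 5) powi (2 * r)) powi m = x powi (5 * (2 * r) * m)"
        by (simp only: p power_int_mult[symmetric] of_nat_numeral mult.assoc)
      ultimately have 1: "x powi ((5 * m + r)\<^sup>2) = x powi (r\<^sup>2) * (Q powi (m\<^sup>2) * ((x ^ 5) powi (2 * r)) powi m)" by simp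
      show ?thesis unfolding F_def minus_one_powi_5 1 by (simp only: ac_simps)
    qed
    thus ?thesis unfolding vt_def by (simp only: infsum_cmult_right')
  qed
  have v: "vt Q ((x ^ 5) powi (- k)) = vt Q ((x ^ 5) powi k)" for k
    using vt_inverse[of Q "(x ^ 5) powi k"] by (simp add: power_int_minus inverse_eq_divide)
  have n: "(x ^ 5) powi 2 = (x ^ 5)\<^sup>2" "(x ^ 5) powi 4 = (x ^ 5) ^ 4" "x powi 4 = x ^ 4"
    using power_int_of_nat[of "x ^ 5" 2] power_int_of_nat[of "x ^ 5" 4] power_int_of_nat[of x 4] by simp_all
  have B0: "(\<Sum>\<^sub>\<infinity>m. F (5 * m)) = vt Q 1" using B[of 0] by simp
  have B1: "(\<Sum>\<^sub>\<infinity>m. F (5 * m + 1)) = - (x * vt Q ((x ^ 5)\<^sup>2))" using B[of 1] n by simp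
  have B2: "(\<Sum>\<^sub>\<infinity>m. F (5 * m - 1)) = - (x * vt Q ((x ^ 5)\<^sup>2))" using B[of "-1"] v[of 2] n by simp
  have B3: "(\<Sum>\<^sub>\<infinity>m. F (5 * m + 2)) = x ^ 4 * vt Q ((x ^ 5) ^ 4)" using B[of 2] n by simp
  have B4: "(\<Sum>\<^sub>\<infinity>m. F (5 * m - 2)) = x ^ 4 * vt Q ((x ^ 5) ^ 4)" using B[of "-2"] v[of 4] n by simp
  show ?thesis unfolding vF infsum_mod5[OF sF] B0 B1 B2 B3 B4 by simp
qed

text \<open>Replaces \<open>app_inverse\<close> at the pole 1, where the singular index is dropped
  on both sides.\<close>

lemma app_on_reflect_1:
  assumes q: "norm q < 1" "q \<noteq> 0" and y: "y \<noteq> 0"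
  shows "app_on q y (-{0}) 1 = - app_on q (q / y) (-{0}) 1"
proof -
  have t: "app_term q y (- n) 1 = - app_term q (q / y) n 1" if n: "n \<noteq> 0" for n
  proof -
    define X where "X = q powi n"
    have X: "X \<noteq> 0" "X \<noteq> 1" using q power_int_eq_1_iff[OF q, of n] n by (auto simp: X_def)
    have 0: "(-1 :: complex) powi (- n) = (-1) powi n" by (cases "even n") simp_all
    have 1: "(q / y) powi n = X / y powi n"
      "y powi (- n) = 1 / y powi n" "q powi (- n) = 1 / X"
      by (simp_all add: power_int_minus power_int_divide_distrib X_def inverse_eq_divide)
    have gen: "c * s * (1 / Y) / (1 - 1 * (1 / X)) = - (c * s * (X / Y) / (1 - 1 * X))" for c s Y
    proof -
      have e: "1 - 1 * (1 / X) = - (1 - X) / X" using X by (simp add: field_simps)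
      show ?thesis unfolding e using X by (simp add: divide_simps) (simp add: algebra_simps)
    qed
    show ?thesis unfolding app_term_def 0 1 power2_minus X_def[symmetric] by (rule gen)
  qed
  have "app_on q y (-{0}) 1 = (\<Sum>\<^sub>\<infinity>n\<in>-{0}. app_term q y (- n) 1)" unfolding app_on_def by (rule infsum_uminus_int[symmetric])
  also have "\<dots> = (\<Sum>\<^sub>\<infinity>n\<in>-{0}. - app_term q (q / y) n 1)" by (rule infsum_cong) (use t in auto)
  also have "\<dots> = - app_on q (q / y) (-{0}) 1" unfolding app_on_def by (rule infsum_uminus)
  finally show ?thesis .
qed

section \<open>Appell sums at base q^5 and their relations\<close>

context
  fixes q :: complex
  assumes q: "norm q < 1" "q \<noteq> 0"
begin

definition AA :: "int \<Rightarrow> int \<Rightarrow> complex" where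
  "AA i k = app (q ^ 5) (q powi i) (q powi k)"

lemma Q5: "norm (q ^ 5) < 1" "q ^ 5 \<noteq> 0"
  using q by (auto simp: norm_power power_less_one_iff)

lemma q5_powi: "q ^ 5 / q powi i = q powi (5 - i)" "q ^ 5 * q powi k = q powi (k + 5)" "q powi i / (q ^ 5)\<^sup>2 = q powi (i - 10)"
proof -
  have 1: "q powi 5 = q ^ 5" "q powi 10 = q ^ 10" using power_int_of_nat[of q 5] power_int_of_nat[of q 10] by simp_all
  show "q ^ 5 / q powi i = q powi (5 - i)" "q ^ 5 * q powi k = q powi (k + 5)" "q powi i / (q ^ 5)\<^sup>2 = q powi (i - 10)"
    using q by (simp_all add: power_int_diff power_int_add 1 flip: power_mult)
qed

lemma AA_inverse: "\<not> 5 dvd k \<Longrightarrow> AA i k = - (q powi (- k)) * AA (5 - i) (- k)"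
proof -
  assume k: "\<not> 5 dvd k"
  have ne: "q powi k * (q ^ 5) powi n \<noteq> 1" for n
  proof
    assume "q powi k * (q ^ 5) powi n = 1"
    hence "q powi (k + 5 * n) = 1" using q by (simp add: power_int_add power_int_mult)
    hence "k = 5 * (- n)" using power_int_eq_1_iff[OF q] by auto
    thus False using k dvd_triv_left by metis
  qed
  have "app (q ^ 5) (q powi i) (q powi k) = - (1 / q powi k) * app (q ^ 5) (q ^ 5 / q powi i) (1 / q powi k)"
    by (rule app_inverse) (use q ne in auto)
  thus ?thesis unfolding AA_def q5_powi by (simp add: power_int_minus inverse_eq_divide)
qed

lemma AA_shift: "AA i (k + 5) = - (q powi (5 - i)) * AA (i - 10) k"
  using app_mult_q[of "q ^ 5" "q powi i" "q powi k"] q unfolding AA_def q5_powi by simp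

lemma th5_ne:
  assumes "\<not> 5 dvd k"
  shows "th (q ^ 5) (q ^ k) \<noteq> 0" "th (q ^ 5) (- (q ^ k)) \<noteq> 0"
proof -
  show "th (q ^ 5) (q ^ k) \<noteq> 0" by (rule th_power_nonzero[OF q _ assms]) simp
  have "\<not> 10 dvd 2 * k" using assms by presburger
  hence "th (q ^ 10) (q ^ (2 * k)) \<noteq> 0" by (intro th_power_nonzero[OF q]) auto
  moreover have "th (q ^ 5) (q ^ k) * th (q ^ 5) (- (q ^ k)) = th (q ^ 10) (q ^ (2 * k))"
    using th_mult_minus[OF Q5(1), of "q ^ k"] by (simp add: mult.commute[of _ 2] flip: power_mult)
  ultimately show "th (q ^ 5) (- (q ^ k)) \<noteq> 0" by auto
qed

lemma app_param_q: "app_param (q ^ 5) q" "app_param (q ^ 5) (q\<^sup>2)"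
  using Q5 q th5_ne[of 1] th5_ne[of 2] th5_ne[of 4] by unfold_locales (auto simp flip: power_mult)

lemma th5_th10:
  "th (q ^ 5) q = th10 q 1 * th10 q 4" "th (q ^ 5) (q\<^sup>2) = th10 q 2 * th10 q 3"
  "th (q ^ 5) (q ^ 3) = th10 q 2 * th10 q 3" "th (q ^ 5) (q ^ 4) = th10 q 1 * th10 q 4"
  "th (q ^ 5) (- q) = th10 q 2 / (th10 q 1 * th10 q 4)" "th (q ^ 5) (- (q\<^sup>2)) = th10 q 4 / (th10 q 2 * th10 q 3)"
  "(qp (q ^ 5) (q ^ 5))\<^sup>2 = th10 q 5 * (qp (q ^ 10) (q ^ 10))\<^sup>2"
proof -
  have s: "th (q ^ 5) (q ^ k) = th10 q k * th10 q (5 + k)" for k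
    using th_split2[OF Q5, of "q ^ k"] q by (simp add: th10_def power_add flip: power_mult)
  note t = th_ten[OF q]
  show 1: "th (q ^ 5) q = th10 q 1 * th10 q 4" and 2: "th (q ^ 5) (q\<^sup>2) = th10 q 2 * th10 q 3"
    using s[of 1] s[of 2] t by simp_all
  show "th (q ^ 5) (q ^ 3) = th10 q 2 * th10 q 3" "th (q ^ 5) (q ^ 4) = th10 q 1 * th10 q 4"
    using s[of 3] s[of 4] t by simp_all
  have m: "th (q ^ 5) (q ^ k) * th (q ^ 5) (- (q ^ k)) = th10 q (2 * k)" for k
    using th_mult_minus[OF Q5(1), of "q ^ k"] by (simp add: th10_def mult.commute[of _ 2] flip: power_mult)
  show "th (q ^ 5) (- q) = th10 q 2 / (th10 q 1 * th10 q 4)"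
  proof -
    have "th10 q 1 * th10 q 4 * th (q ^ 5) (- q) = th10 q 2"
      using m[of 1] by (simp only: power_one_right 1 mult_1_right)
    thus ?thesis using th10_nonzero[OF q] by (simp add: nonzero_eq_divide_eq mult.commute)
  qed
  show "th (q ^ 5) (- (q\<^sup>2)) = th10 q 4 / (th10 q 2 * th10 q 3)"
    using m[of 2] 2 th10_nonzero[OF q] by (simp add: field_simps)
  have "qp (q ^ 5) (q ^ 5) = qp (q ^ 5) (q ^ 10) * qp (q ^ 10) (q ^ 10)"
    using qp_split2[OF Q5(1), of "q ^ 5"] by (simp flip: power_mult power_add)
  moreover have "th10 q 5 = (qp (q ^ 5) (q ^ 10))\<^sup>2"
  proof -
    have "q ^ 10 / q ^ 5 = q ^ 5" using q by (simp flip: power_diff)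
    thus ?thesis by (simp add: th10_def th_def power2_eq_square)
  qed
  ultimately show "(qp (q ^ 5) (q ^ 5))\<^sup>2 = th10 q 5 * (qp (q ^ 10) (q ^ 10))\<^sup>2"
    by (simp add: power_mult_distrib)
qed

lemma vt5:
  "vt (q ^ 5) 1 = qp (q ^ 10) (q ^ 10) * th10 q 5" "vt (q ^ 5) (q\<^sup>2) = qp (q ^ 10) (q ^ 10) * th10 q 3"
  "vt (q ^ 5) (q ^ 4) = qp (q ^ 10) (q ^ 10) * th10 q 1"
proof -
  have e: "(q ^ 5)\<^sup>2 = q ^ 10" "q ^ 5 * q\<^sup>2 = q ^ 7" "q ^ 5 * q ^ 4 = q ^ 9" by (simp_all flip: power_mult power_add)
  show "vt (q ^ 5) 1 = qp (q ^ 10) (q ^ 10) * th10 q 5"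
    using jacobi_triple_vt[OF Q5, of 1] by (simp add: th10_def e)
  have "vt (q ^ 5) (q\<^sup>2) = qp (q ^ 10) (q ^ 10) * th10 q 7" "vt (q ^ 5) (q ^ 4) = qp (q ^ 10) (q ^ 10) * th10 q 9"
    using jacobi_triple_vt[OF Q5, of "q\<^sup>2"] jacobi_triple_vt[OF Q5, of "q ^ 4"] q unfolding th10_def e by simp_all
  thus "vt (q ^ 5) (q\<^sup>2) = qp (q ^ 10) (q ^ 10) * th10 q 3" "vt (q ^ 5) (q ^ 4) = qp (q ^ 10) (q ^ 10) * th10 q 1"
    using th_ten[OF q] by simp_all
qed

text \<open>The first two are the limiting three-term relation for a = q and a = q^2; the third and
  fourth are the relation itself at a = q^2, z = q and at a = q, z = q^2. Inversion and shift then
  produce the combinations occurring in \<open>T_split\<close>: the first and third for j = 2, the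
  others for j = 1.\<close>

lemma AA_relations:
  defines "c1 \<equiv> 2 * q * vt (q ^ 5) (q\<^sup>2) / vt (q ^ 5) 1" and "c2 \<equiv> 2 * q\<^sup>2 * vt (q ^ 5) (q ^ 4) / vt (q ^ 5) 1"
    and "j \<equiv> th10 q" and "J \<equiv> qp (q ^ 10) (q ^ 10)"
  shows "app_on (q ^ 5) (q\<^sup>2) (-{0}) 1 + AA (-2) (-2) = lam (q ^ 5) q - c1 * AA 5 1"
    and "app_on (q ^ 5) q (-{0}) 1 - AA (-1) (-1) = c2 * AA 5 2 - lam (q ^ 5) (q\<^sup>2)"
    and "- q * AA 4 1 + q\<^sup>2 * AA 6 2 = - q * (J\<^sup>2 * j 5 * (j 2)\<^sup>2 * j 3 / ((j 1)\<^sup>2 * (j 4) ^ 3)) + c2 * AA 5 1"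
    and "AA 3 1 - AA (-3) (-2) = J\<^sup>2 * j 5 * j 1 * (j 4)\<^sup>2 / ((j 2) ^ 3 * (j 3)\<^sup>2) + c1 * AA 5 2"
proof -
  interpret A1: app_param "q ^ 5" q by (rule app_param_q)
  interpret A2: app_param "q ^ 5" "q\<^sup>2" by (rule app_param_q)
  have C: "A1.C = c1" "A2.C = c2" by (simp_all add: A1.C_def A2.C_def c1_def c2_def flip: power_mult)
  have p: "q powi 1 = q" "q powi 2 = q\<^sup>2" "q powi 3 = q ^ 3" "q powi 4 = q ^ 4" "q powi 5 = q ^ 5" "q powi 6 = q ^ 6" "q powi 7 = q ^ 7" "q powi 9 = q ^ 9"
    "q powi (-1) = 1 / q" "q powi (-2) = 1 / q\<^sup>2" "q powi (-4) = 1 / q ^ 4"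
    using power_int_of_nat[of q 2] power_int_of_nat[of q 3] power_int_of_nat[of q 4] power_int_of_nat[of q 5]
      power_int_of_nat[of q 6] power_int_of_nat[of q 7] power_int_of_nat[of q 9]
      power_int_minus[of q 1] power_int_minus[of q 2] power_int_minus[of q 4] by (simp_all add: inverse_eq_divide)
  have e: "q ^ 5 / q\<^sup>2 = q ^ 3" "q ^ 5 * q\<^sup>2 = q ^ 7" "q ^ 5 / (q\<^sup>2)\<^sup>2 = q" "q ^ 5 * (q\<^sup>2)\<^sup>2 = q ^ 9" "(q\<^sup>2)\<^sup>2 = q ^ 4"
    "1 / q * q\<^sup>2 = q" "q * q\<^sup>2 = q ^ 3" "1 / q\<^sup>2 * q = 1 / q" "q\<^sup>2 * q = q ^ 3" "q ^ 5 / q ^ 4 = q"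
    using q by (simp_all add: field_simps flip: power_mult power_add power_Suc power_Suc2) (simp_all add: power2_eq_square power3_eq_cube eval_nat_numeral)
  have nz: "th10 q 1 \<noteq> 0" "th10 q 2 \<noteq> 0" "th10 q 3 \<noteq> 0" "th10 q 4 \<noteq> 0" "th10 q 5 \<noteq> 0" by (rule th10_nonzero[OF q])+
  have AA_app: "AA i k = app (q ^ 5) (q powi i) (q powi k)" for i k by (simp add: AA_def)
  have "app_on (q ^ 5) (q ^ 3) (- {0}) 1 + q\<^sup>2 * AA 7 2 - c1 * AA 5 1 = - lam (q ^ 5) q"
    using A1.app_three_term_limit unfolding C e AA_app p by simp
  moreover have "app_on (q ^ 5) (q\<^sup>2) (-{0}) 1 = - app_on (q ^ 5) (q ^ 3) (- {0}) 1"
    using app_on_reflect_1[OF Q5, of "q\<^sup>2"] q e by simp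
  moreover have "AA (-2) (-2) = - q\<^sup>2 * AA 7 2" using AA_inverse[of "-2" "-2"] p by simp
  ultimately show "app_on (q ^ 5) (q\<^sup>2) (-{0}) 1 + AA (-2) (-2) = lam (q ^ 5) q - c1 * AA 5 1" by algebra
  have "app_on (q ^ 5) q (- {0}) 1 + q ^ 4 * AA 9 4 - c2 * AA 5 2 = - lam (q ^ 5) (q\<^sup>2)"
    using A2.app_three_term_limit unfolding C e AA_app p by simp
  moreover have "q ^ 4 * AA 9 4 = - AA (-1) (-1)" using AA_shift[of 9 "-1"] p q by simp
  ultimately show "app_on (q ^ 5) q (-{0}) 1 - AA (-1) (-1) = c2 * AA 5 2 - lam (q ^ 5) (q\<^sup>2)" by algebra
  have inv: "th (q ^ 5) (1 / q) = - th (q ^ 5) q / q" by (rule th_inverse[OF Q5 q(2)])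
  have ne: "th (q ^ 5) q \<noteq> 0" "th (q ^ 5) (q\<^sup>2) \<noteq> 0" "th (q ^ 5) (q ^ 3) \<noteq> 0" "th (q ^ 5) (1 / q) \<noteq> 0"
    unfolding inv using th5_ne[of 1] th5_ne[of 2] th5_ne[of 3] q by simp_all
  have "A2.W q = A2.Kc * th (q ^ 5) (- q) / (th (q ^ 5) q * th (q ^ 5) (q\<^sup>2 * q) * th (q ^ 5) (1 / q\<^sup>2 * q))"
    by (rule A2.app_three_term) (use q ne in \<open>simp_all only: e not_False_eq_True\<close>)
  also have "\<dots> = - q * (J\<^sup>2 * j 5 * (j 2)\<^sup>2 * j 3 / ((j 1)\<^sup>2 * (j 4) ^ 3))"
    unfolding A2.Kc_def e inv th5_th10 j_def J_def using nz q
    by (simp add: divide_simps power2_eq_square power3_eq_cube)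
  finally have "AA 1 (-1) + q ^ 4 * AA 9 3 - c2 * AA 5 1 = - q * (J\<^sup>2 * j 5 * (j 2)\<^sup>2 * j 3 / ((j 1)\<^sup>2 * (j 4) ^ 3))"
    unfolding A2.W_def C e AA_app p by simp
  moreover have "AA 1 (-1) = - q * AA 4 1" using AA_inverse[of "-1" 1] p by simp
  moreover have "q ^ 4 * AA 9 3 = - AA (-1) (-2)" using AA_shift[of 9 "-2"] p q by simp
  moreover have "AA (-1) (-2) = - q\<^sup>2 * AA 6 2" using AA_inverse[of "-2" "-1"] p by simp
  ultimately show "- q * AA 4 1 + q\<^sup>2 * AA 6 2 = - q * (J\<^sup>2 * j 5 * (j 2)\<^sup>2 * j 3 / ((j 1)\<^sup>2 * (j 4) ^ 3)) + c2 * AA 5 1"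
    by algebra
  have "A1.W (q\<^sup>2) = A1.Kc * th (q ^ 5) (- (q\<^sup>2)) / (th (q ^ 5) (q\<^sup>2) * th (q ^ 5) (q * q\<^sup>2) * th (q ^ 5) (1 / q * q\<^sup>2))"
    by (rule A1.app_three_term) (use q ne in \<open>simp_all only: e not_False_eq_True\<close>, use q in simp)
  also have "\<dots> = J\<^sup>2 * j 5 * j 1 * (j 4)\<^sup>2 / ((j 2) ^ 3 * (j 3)\<^sup>2)"
    unfolding A1.Kc_def e inv th5_th10 j_def J_def using nz q
    by (simp add: divide_simps power2_eq_square power3_eq_cube)
  finally have "AA 3 1 + q\<^sup>2 * AA 7 3 - c1 * AA 5 2 = J\<^sup>2 * j 5 * j 1 * (j 4)\<^sup>2 / ((j 2) ^ 3 * (j 3)\<^sup>2)"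
    unfolding A1.W_def C e AA_app p by simp
  moreover have "q\<^sup>2 * AA 7 3 = - AA (-3) (-2)" using AA_shift[of 7 "-2"] p q by simp
  ultimately show "AA 3 1 - AA (-3) (-2) = J\<^sup>2 * j 5 * j 1 * (j 4)\<^sup>2 / ((j 2) ^ 3 * (j 3)\<^sup>2) + c1 * AA 5 2"
    by algebra
qed

end

text \<open>With \<open>x\<^sup>5 = q\<close>, this sorts a product with the dissected theta series by the exponent of \<open>x\<close> modulo 5.\<close>
lemma mod5_product:
  fixes x :: complex
  shows "(a0 - 2 * x * a1 + 2 * x ^ 4 * a4) * (e0 + e1 * x + e2 * x\<^sup>2 + e3 * x ^ 3 + e4 * x ^ 4)
    = (a0 * e0 + x ^ 5 * (2 * a4 * e1 - 2 * a1 * e4)) + (a0 * e1 - 2 * a1 * e0 + 2 * x ^ 5 * a4 * e2) * x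
      + (a0 * e2 - 2 * a1 * e1 + 2 * x ^ 5 * a4 * e3) * x\<^sup>2 + (a0 * e3 - 2 * a1 * e2 + 2 * x ^ 5 * a4 * e4) * x ^ 3
      + (a0 * e4 - 2 * a1 * e3 + 2 * a4 * e0) * x ^ 4"
  by algebra

text \<open>All relations come from the two identities \<open>W1\<close> and \<open>W2\<close> of
  \<open>ten_theta\<close>, divided by monomials in the thetas. The factors J j5, J j3, J j1 are the
  coefficients of the dissected denominator series; the last two lines rewrite the right-hand sides
  of the three-term relations.\<close>

lemma theta_quotient_relations:
  fixes j1 j2 j3 j4 j5 J q :: complex
  assumes nz: "j1 \<noteq> 0" "j2 \<noteq> 0" "j3 \<noteq> 0" "j4 \<noteq> 0"
    and W1: "j5 * j2\<^sup>2 * j3 = j1 * j3 * j4\<^sup>2 + q * j1\<^sup>2 * j2 * j4"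
    and W2: "j2 * j3\<^sup>2 * j4 = j1 * j5 * j4\<^sup>2 + q * j1 * j2\<^sup>2 * j3"
  defines "K \<equiv> J * j5 * j4 / (j2\<^sup>2 * j3\<^sup>2)" and "L \<equiv> q * J / (j3 * j4)" and "X \<equiv> J * j4 / (j2\<^sup>2 * j3)"
    and "Y \<equiv> J * j2 / (j4\<^sup>2 * j1)" and "Z \<equiv> J / (j1 * j4)" and "W \<equiv> J / (j2 * j3)"
  shows "J * j5 * X = J * j3 * K" "J * j3 * L = q * (J * j1) * Z" "J * j5 * Y = J * j1 * (K + 2 * L)"
    "J * j3 * W = J * j1 * (K + L)" "J * j5 * Z = J * j3 * X + q * (J * j1) * W"
    "J * j5 * W = J * j3 * Z - q * (J * j1) * Y"
    "J\<^sup>2 * j5 * j2\<^sup>2 * j3 / (j1\<^sup>2 * j4 ^ 3) = J * j3 * Z + q * (J * j1) * Y"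
    "J\<^sup>2 * j5 * j1 * j4\<^sup>2 / (j2 ^ 3 * j3\<^sup>2) = J * j3 * X - q * (J * j1) * W"
proof -
  \<comment> \<open>With the inverses as variables subject to ii, every claim is a polynomial
    consequence of \<open>A\<close> and \<open>B\<close>, within reach of
    \<open>algebra\<close>.\<close>
  define i1 i2 i3 i4 where i: "i1 = inverse j1" "i2 = inverse j2" "i3 = inverse j3" "i4 = inverse j4"
  have ii: "j1 * i1 = 1" "j2 * i2 = 1" "j3 * i3 = 1" "j4 * i4 = 1" using nz by (simp_all add: i)
  have d: "K = J * j5 * j4 * i2\<^sup>2 * i3\<^sup>2" "L = q * J * i3 * i4" "X = J * j4 * i2\<^sup>2 * i3"
    "Y = J * j2 * i4\<^sup>2 * i1" "Z = J * i1 * i4" "W = J * i2 * i3"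
    "J\<^sup>2 * j5 * j2\<^sup>2 * j3 / (j1\<^sup>2 * j4 ^ 3) = J\<^sup>2 * j5 * j2\<^sup>2 * j3 * i1\<^sup>2 * i4 ^ 3"
    "J\<^sup>2 * j5 * j1 * j4\<^sup>2 / (j2 ^ 3 * j3\<^sup>2) = J\<^sup>2 * j5 * j1 * j4\<^sup>2 * i2 ^ 3 * i3\<^sup>2"
    by (simp_all add: K_def L_def X_def Y_def Z_def W_def i divide_inverse power_inverse mult_ac)
  have A: "j5 * i1 * i4 = j4 * i2\<^sup>2 + q * j1 * i2 * i3"
    using W1 ii by algebra
  have B: "j3 * i1 * i4 = j5 * i2 * i3 + q * j2 * i4\<^sup>2"
    using W2 ii by algebra
  show "J * j5 * X = J * j3 * K" "J * j3 * L = q * (J * j1) * Z" unfolding d using ii by algebra+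
  show "J * j5 * Z = J * j3 * X + q * (J * j1) * W" unfolding d using A ii by algebra
  show "J * j5 * W = J * j3 * Z - q * (J * j1) * Y" unfolding d using B ii by algebra
  have A': "j5 * i4 = j4 * i2\<^sup>2 * j1 + q * j1\<^sup>2 * i2 * i3" using A ii by algebra
  have B': "j3 * i4 = j1 * (j5 * i2 * i3 + q * j2 * i4\<^sup>2)" using B ii by algebra
  show "J * j3 * W = J * j1 * (K + L)"
  proof -
    have "j3 * (i2 * i3) = j1 * (j5 * j4 * i2\<^sup>2 * i3\<^sup>2 + q * i3 * i4)" using B' ii by algebra
    thus ?thesis unfolding d by algebra
  qed
  show "J * j5 * Y = J * j1 * (K + 2 * L)"
  proof -
    have 1: "j5 * i1 * i4 * (j2 * i4) = i2 + q * j1 * i3 * i4" using A ii by algebra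
    have 2: "i2 = j1 * (j5 * j4 * i2\<^sup>2 * i3\<^sup>2 + q * i3 * i4)" using B' ii by algebra
    have "j5 * (j2 * i4\<^sup>2 * i1) = j1 * (j5 * j4 * i2\<^sup>2 * i3\<^sup>2 + 2 * (q * i3 * i4))" using 1 2 by algebra
    thus ?thesis unfolding d by algebra
  qed
  show "J\<^sup>2 * j5 * j2\<^sup>2 * j3 / (j1\<^sup>2 * j4 ^ 3) = J * j3 * Z + q * (J * j1) * Y"
  proof -
    have "j5 * j2\<^sup>2 * j3 * i1\<^sup>2 * i4 ^ 3 = (j1 * j3 * j4\<^sup>2 + q * j1\<^sup>2 * j2 * j4) * i1\<^sup>2 * i4 ^ 3" by (simp only: W1)
    also have "\<dots> = j3 * i1 * i4 + q * j2 * i4\<^sup>2" using ii by algebra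
    finally show ?thesis unfolding d using ii by algebra
  qed
  show "J\<^sup>2 * j5 * j1 * j4\<^sup>2 / (j2 ^ 3 * j3\<^sup>2) = J * j3 * X - q * (J * j1) * W"
  proof -
    have "j1 * j5 * j4\<^sup>2 = j2 * j3\<^sup>2 * j4 - q * j1 * j2\<^sup>2 * j3" using W2 by algebra
    hence "j5 * j1 * j4\<^sup>2 * i2 ^ 3 * i3\<^sup>2 = (j2 * j3\<^sup>2 * j4 - q * j1 * j2\<^sup>2 * j3) * i2 ^ 3 * i3\<^sup>2" by algebra
    also have "\<dots> = j4 * i2\<^sup>2 - q * j1 * i2 * i3" using ii by algebra
    finally show ?thesis unfolding d using ii by algebra
  qed
qed

lemma rank_dissection:
  fixes x :: complex
  assumes x: "norm x < 1" "x \<noteq> 0"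
  defines "q \<equiv> x ^ 5"
  defines "j \<equiv> th10 q" and "J \<equiv> qp (q ^ 10) (q ^ 10)"
  defines "U \<equiv> (\<lambda>c. AA q 5 c / (J * j 5))"
  shows "(- 2 * T x 1 + 6 * T x 2) / vt x 1 = 2 * (q * J / (j 3 * j 4)) + (- 2 * q * U 2) * x + 2 * (J / (j 1 * j 4)) * x\<^sup>2
      + (- 2 * (J / (j 2 * j 3))) * x ^ 3 + (6 * U 1 - 4 * (J * j 2 / ((j 4)\<^sup>2 * j 1))) * x ^ 4" (is ?A)
    and "(1 - vt x 1 + 4 * T x 1 - 2 * T x 2) / vt x 1 = (- 1 + J * j 5 * j 4 / ((j 2)\<^sup>2 * (j 3)\<^sup>2))
      + (2 * (J * j 4 / ((j 2)\<^sup>2 * j 3)) + 4 * q * U 2) * x + 2 * (J / (j 2 * j 3)) * x ^ 3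
      + (2 * (J * j 2 / ((j 4)\<^sup>2 * j 1)) - 2 * U 1) * x ^ 4" (is ?B)
proof -
  have q: "norm q < 1" "q \<noteq> 0" using x by (auto simp: q_def norm_power power_less_one_iff)
  have J: "J \<noteq> 0" using qp_q_q_nonzero[of "q ^ 10"] q by (auto simp: J_def norm_power power_less_one_iff)
  have nz: "j 1 \<noteq> 0" "j 2 \<noteq> 0" "j 3 \<noteq> 0" "j 4 \<noteq> 0" "j 5 \<noteq> 0" unfolding j_def by (rule th10_nonzero[OF q])+
  define K L X Y Z W where d: "K = J * j 5 * j 4 / ((j 2)\<^sup>2 * (j 3)\<^sup>2)" "L = q * J / (j 3 * j 4)"
    "X = J * j 4 / ((j 2)\<^sup>2 * j 3)" "Y = J * j 2 / ((j 4)\<^sup>2 * j 1)" "Z = J / (j 1 * j 4)" "W = J / (j 2 * j 3)"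
  define a0 a1 a4 where a: "a0 = J * j 5" "a1 = J * j 3" "a4 = J * j 1"
  define V1 V2 where V: "V1 = J\<^sup>2 * j 5 * (j 2)\<^sup>2 * j 3 / ((j 1)\<^sup>2 * (j 4) ^ 3)" "V2 = J\<^sup>2 * j 5 * j 1 * (j 4)\<^sup>2 / ((j 2) ^ 3 * (j 3)\<^sup>2)"
  define m1 m2 where m: "m1 = lam (q ^ 5) q" "m2 = lam (q ^ 5) (q\<^sup>2)"
  note rel = theta_quotient_relations[OF nz(1-4) ten_theta[OF q, folded j_def], of J, folded d a V]
  have cl: "a0 * (K + 4 * L) + 4 * q * a4 * X + 12 * q * a1 * Y = 1 + 10 * m1"
    "a0 * (3 * K + 2 * L) + 12 * q * a4 * X - 4 * q * a1 * Y = 3 - 10 * m2"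
  proof -
    have "a0 * K = J\<^sup>2 * j 4 * (j 5)\<^sup>2 / ((j 2)\<^sup>2 * (j 3)\<^sup>2)" "a0 * L = q * J\<^sup>2 * j 5 / (j 3 * j 4)"
      "q * a4 * X = q * J\<^sup>2 * j 1 * j 4 / ((j 2)\<^sup>2 * j 3)" "q * a1 * Y = q * J\<^sup>2 * j 2 * j 3 / (j 1 * (j 4)\<^sup>2)"
      by (simp_all add: a d power2_eq_square mult_ac)
    note cp = class_zero_products[OF q, folded j_def J_def m, folded this]
    show "a0 * (K + 4 * L) + 4 * q * a4 * X + 12 * q * a1 * Y = 1 + 10 * m1" using cp(1) by algebra
    show "a0 * (3 * K + 2 * L) + 12 * q * a4 * X - 4 * q * a1 * Y = 3 - 10 * m2" using cp(2) by algebra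
  qed
  have a0: "a0 \<noteq> 0" using J nz by (simp add: a)
  have AAq: "AA q i k = app (q ^ 5) (q powi i) (q powi k)" for i k by (rule AA_def[OF q])
  have UU: "AA q 5 c = a0 * U c" for c using a0 by (simp add: U_def a)
  have v5: "vt (q ^ 5) 1 = a0" "vt (q ^ 5) (q\<^sup>2) = a1" "vt (q ^ 5) (q ^ 4) = a4"
    unfolding a J_def j_def by (rule vt5[OF q])+
  have vt: "vt x 1 = a0 - 2 * x * a1 + 2 * x ^ 4 * a4"
    using vt_split[OF x] unfolding q_def[symmetric] v5 by simp
  have c: "2 * q * a1 / a0 * (a0 * u) = 2 * q * a1 * u" "2 * q\<^sup>2 * a4 / a0 * (a0 * u) = 2 * q\<^sup>2 * a4 * u" for u
    using a0 by simp_all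
  note R = AA_relations[OF q, folded j_def J_def, folded V m, unfolded v5 UU c]
  \<comment> \<open>In T x 2 only the exponents 0, 3 and 4 of x modulo 5 occur, in T x 1 only 0, 1
    and 2; the other coefficients in the products below must therefore vanish.\<close>
  have T2: "T x 2 = (m1 - 2 * q * a1 * U 1) + (- V1 + 2 * q * a4 * U 1) * x ^ 3 + a0 * U 1 * x ^ 4"
  proof -
    have t: "T x 2 = app_on (q ^ 5) (q\<^sup>2) (-{0}) 1 - x ^ 3 * AA q 4 1 - inverse x * AA q 0 (-1) + x ^ 8 * AA q 6 2 + AA q (-2) (-2)"
      using T_split[OF x, of 2] unfolding q_def[symmetric] AAq[symmetric] by simp
    have 1: "AA q 0 (-1) = - q * (a0 * U 1)" using AA_inverse[OF q, of "-1" 0] by (simp add: UU)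
    have 2: "inverse x * q = x ^ 4" using x by (simp add: q_def field_simps eval_nat_numeral)
    have 3: "x ^ 8 = x ^ 3 * q" by (simp add: q_def flip: power_add)
    have "q * (- AA q 4 1 + q * AA q 6 2) = q * (- V1 + 2 * q * a4 * U 1)" using R(3) by algebra
    hence 4: "- AA q 4 1 + q * AA q 6 2 = - V1 + 2 * q * a4 * U 1" using q by simp
    have "T x 2 = (app_on (q ^ 5) (q\<^sup>2) (-{0}) 1 + AA q (-2) (-2)) + (- AA q 4 1 + q * AA q 6 2) * x ^ 3 + a0 * U 1 * (inverse x * q)"
      unfolding t 1 3 by (simp add: algebra_simps)
    thus ?thesis unfolding 2 4 R(1) .
  qed
  have T1: "T x 1 = (2 * q\<^sup>2 * a4 * U 2 - m2) + q * a0 * U 2 * x + (- V2 - 2 * q * a1 * U 2) * x\<^sup>2"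
  proof -
    have t: "T x 1 = app_on (q ^ 5) q (-{0}) 1 - x\<^sup>2 * AA q 3 1 - AA q (-1) (-1) + x ^ 6 * AA q 5 2 + x\<^sup>2 * AA q (-3) (-2)"
      using T_split[OF x, of 1] unfolding q_def[symmetric] AAq[symmetric] by simp
    have 3: "x ^ 6 = x * q" by (simp add: q_def flip: power_Suc)
    have "T x 1 = (app_on (q ^ 5) q (-{0}) 1 - AA q (-1) (-1)) + q * a0 * U 2 * x + - (AA q 3 1 - AA q (-3) (-2)) * x\<^sup>2"
      unfolding t UU 3 by (simp add: algebra_simps)
    thus ?thesis unfolding R(2) R(4) by (simp add: algebra_simps)
  qed
  \<comment> \<open>With A the first claimed right-hand side and B the second plus 1, ES = 2 A + B
    and EP = A + 3 B. The unknown \<open>U 2\<close> cancels from ES and \<open>U 1\<close> from EP,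
    as the factors \<open>T x 2\<close> and \<open>T x 1\<close> demand.\<close>
  define ES where "ES = (K + 4 * L) + 2 * X * x + 4 * Z * x\<^sup>2 + (- 2 * W) * x ^ 3 + (- 6 * Y + 10 * U 1) * x ^ 4"
  define EP where "EP = (3 * K + 2 * L) + (6 * X + 10 * q * U 2) * x + 2 * Z * x\<^sup>2 + 4 * W * x ^ 3 + 2 * Y * x ^ 4"
  have S: "vt x 1 * ES = 1 + 10 * T x 2"
  proof -
    \<comment> \<open>The numbered facts compare coefficients of x^0, ..., x^4 by
      \<open>mod5_product\<close>; class 0 uses \<open>class_zero_products\<close>, the others the
      theta quotient relations.\<close>
    have 0: "a0 * (K + 4 * L) + q * (2 * a4 * (2 * X) - 2 * a1 * (- 6 * Y + 10 * U 1)) = 1 + 10 * (m1 - 2 * q * a1 * U 1)"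
      using cl(1) by algebra
    have 1: "a0 * (2 * X) - 2 * a1 * (K + 4 * L) + 2 * q * a4 * (4 * Z) = 0" using rel(1,2) by algebra
    have 2: "a0 * (4 * Z) - 2 * a1 * (2 * X) + 2 * q * a4 * (- 2 * W) = 0" using rel(5) by algebra
    have 3: "a0 * (- 2 * W) - 2 * a1 * (4 * Z) + 2 * q * a4 * (- 6 * Y + 10 * U 1) = 10 * (- V1 + 2 * q * a4 * U 1)"
      using rel(6,7) by algebra
    have 4: "a0 * (- 6 * Y + 10 * U 1) - 2 * a1 * (- 2 * W) + 2 * a4 * (K + 4 * L) = 10 * (a0 * U 1)"
      using rel(3,4) by algebra
    show ?thesis unfolding vt ES_def mod5_product q_def[symmetric] 0 1 2 3 4 T2 by (simp add: algebra_simps)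
  qed
  have P: "vt x 1 * EP = 3 + 10 * T x 1"
  proof -
    have 0: "a0 * (3 * K + 2 * L) + q * (2 * a4 * (6 * X + 10 * q * U 2) - 2 * a1 * (2 * Y)) = 3 + 10 * (2 * q\<^sup>2 * a4 * U 2 - m2)"
      using cl(2) by algebra
    have 1: "a0 * (6 * X + 10 * q * U 2) - 2 * a1 * (3 * K + 2 * L) + 2 * q * a4 * (2 * Z) = 10 * (q * a0 * U 2)" using rel(1,2) by algebra
    have 2: "a0 * (2 * Z) - 2 * a1 * (6 * X + 10 * q * U 2) + 2 * q * a4 * (4 * W) = 10 * (- V2 - 2 * q * a1 * U 2)" using rel(5,8) by algebra
    have 3: "a0 * (4 * W) - 2 * a1 * (2 * Z) + 2 * q * a4 * (2 * Y) = 0"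
      using rel(6) by algebra
    have 4: "a0 * (2 * Y) - 2 * a1 * (4 * W) + 2 * a4 * (3 * K + 2 * L) = 0"
      using rel(3,4) by algebra
    show ?thesis unfolding vt EP_def mod5_product q_def[symmetric] 0 1 2 3 4 T1 by (simp add: algebra_simps)
  qed
  have v0: "vt x 1 \<noteq> 0" by (rule vt_1_nonzero[OF x])
  \<comment> \<open>The constants 1 and 3 cancel in 3 s - p and leave 5 in 2 p - s, which accounts
    for the summand 1 in the second numerator.\<close>
  have gen: "(- 2 * t1 + 6 * t2) / v = (3 * s - p) / 5" "(1 - v + 4 * t1 - 2 * t2) / v = - 1 + (2 * p - s) / 5"
    if "v * s = 1 + 10 * t2" "v * p = 3 + 10 * t1" "v \<noteq> 0" for v s p t1 t2 :: complex
  proof -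
    have sp: "s = (1 + 10 * t2) / v" "p = (3 + 10 * t1) / v" using that by (simp_all add: nonzero_eq_divide_eq mult.commute)
    thus "(- 2 * t1 + 6 * t2) / v = (3 * s - p) / 5" "(1 - v + 4 * t1 - 2 * t2) / v = - 1 + (2 * p - s) / 5"
      unfolding sp using that(3) by (simp_all add: field_simps)
  qed
  have "(3 * ES - EP) / 5 = 2 * L + (- 2 * q * U 2) * x + 2 * Z * x\<^sup>2 + (- 2 * W) * x ^ 3 + (6 * U 1 - 4 * Y) * x ^ 4"
    unfolding ES_def EP_def by (simp add: field_simps)
  thus ?A unfolding gen(1)[OF S P v0] d .
  have "- 1 + (2 * EP - ES) / 5 = (- 1 + K) + (2 * X + 4 * q * U 2) * x + 2 * W * x ^ 3 + (2 * Y - 2 * U 1) * x ^ 4"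
    unfolding ES_def EP_def by (simp add: field_simps)
  thus ?B unfolding gen(2)[OF S P v0] d .
qed

section \<open>Residue classes and the coefficients at the origin\<close>

text \<open>Regrouping the series by residue shows that the sum of (S d - R d) x^d vanishes at all
  five fifth roots of q. A polynomial of degree at most 4 with five zeros is zero.\<close>

lemma residue_separation:
  fixes D :: "nat \<Rightarrow> complex" and R :: "nat \<Rightarrow> complex"
  assumes D: "\<And>y. norm y < 1 \<Longrightarrow> y \<noteq> 0 \<Longrightarrow> summable (\<lambda>N. D N * y ^ N)"
    and q: "norm q < 1" "q \<noteq> 0"
    and R: "\<And>x. x ^ 5 = q \<Longrightarrow> (\<lambda>N. D N * x ^ N) sums (\<Sum>d<5. R d * x ^ d)"
    and d: "d < 5"
  shows "(\<lambda>n. D (5 * n + d) * q ^ n) sums R d"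
proof -
  define S where "S = (\<lambda>d. \<Sum>n. D (5 * n + d) * q ^ n)"
  have roots: "finite {x. x ^ 5 = q}" "card {x. x ^ 5 = q} = 5"
    using card_nth_roots[of q 5] finite_nth_roots[of 5 q] q by auto
  have nx: "norm x < 1" "x \<noteq> 0" if "x ^ 5 = q" for x
  proof -
    show "x \<noteq> 0" using that q by auto
    have "norm x ^ 5 < 1" using q that by (simp flip: norm_power)
    thus "norm x < 1" by (simp add: power_less_one_iff)
  qed
  have sub: "summable (\<lambda>n. D (5 * n + d) * q ^ n)" for d
  proof -
    obtain x where x: "x ^ 5 = q" using roots(2) by force
    \<comment> \<open>Convergence at r > |x| makes the series absolutely convergent at x, so its
      subseries converge.\<close>
    obtain r where r: "norm x < r" "r < 1" using dense[OF nx(1)[OF x]] by blast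
    have r0: "0 < r" using r(1) norm_ge_zero[of x] by linarith
    have "summable (\<lambda>N. D N * of_real r ^ N)" by (rule D) (use r r0 in auto)
    hence "summable (\<lambda>N. norm (D N * x ^ N))" by (rule powser_insidea) (use r r0 in auto)
    hence "summable ((\<lambda>N. norm (D N * x ^ N)) \<circ> (\<lambda>n. 5 * n + d))"
      by (rule summable_reindex) (auto simp: inj_on_def)
    hence "summable (\<lambda>n. D (5 * n + d) * x ^ (5 * n + d))" by (auto simp: o_def intro: summable_norm_cancel)
    moreover have "D (5 * n + d) * x ^ (5 * n + d) = x ^ d * (D (5 * n + d) * q ^ n)" for n
      by (simp add: power_add power_mult x)
    ultimately have "summable (\<lambda>n. x ^ d * (D (5 * n + d) * q ^ n))" by simp
    thus ?thesis using nx(2)[OF x] by simp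
  qed
  have eq: "(\<Sum>d<5. (S d - R d) * x ^ d) = 0" if x: "x ^ 5 = q" for x
  proof -
    have "(\<lambda>n. \<Sum>i\<in>{n * 5..<n * 5 + 5}. D i * x ^ i) sums (\<Sum>d<5. R d * x ^ d)"
      by (rule sums_group[OF R[OF x]]) simp
    moreover have "(\<Sum>i\<in>{n * 5..<n * 5 + 5}. D i * x ^ i) = (\<Sum>d<5. D (5 * n + d) * q ^ n * x ^ d)" for n
    proof -
      have "(\<Sum>i\<in>{n * 5..<n * 5 + 5}. D i * x ^ i) = (\<Sum>d<5. D (5 * n + d) * x ^ (5 * n + d))"
        by (rule sum.reindex_bij_witness[of _ "\<lambda>d. 5 * n + d" "\<lambda>i. i - 5 * n"]) auto
      thus ?thesis by (simp add: power_add power_mult x mult.assoc)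
    qed
    ultimately have "(\<lambda>n. \<Sum>d<5. D (5 * n + d) * q ^ n * x ^ d) sums (\<Sum>d<5. R d * x ^ d)" by simp
    moreover have "(\<lambda>n. \<Sum>d<5. D (5 * n + d) * q ^ n * x ^ d) sums (\<Sum>d<5. S d * x ^ d)"
      unfolding S_def by (intro sums_sum sums_mult2 summable_sums sub)
    ultimately have "(\<Sum>d<5. R d * x ^ d) = (\<Sum>d<5. S d * x ^ d)" by (rule sums_unique2)
    thus ?thesis by (simp add: left_diff_distrib sum_subtractf)
  qed
  define p where "p = (\<Sum>d<5. monom (S d - R d) d)"
  have deg: "degree p \<le> 4"
    unfolding p_def by (rule degree_sum_le) (auto intro: order.trans[OF degree_monom_le])
  have "p = 0"
  proof (rule ccontr)
    assume "p \<noteq> 0"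
    have "{x. x ^ 5 = q} \<subseteq> {x. poly p x = 0}"
      using eq by (auto simp: p_def poly_sum poly_monom)
    hence "card {x. x ^ 5 = q} \<le> card {x. poly p x = 0}"
      by (rule card_mono[OF poly_roots_finite[OF \<open>p \<noteq> 0\<close>]])
    also have "\<dots> \<le> degree p" by (rule card_poly_roots_bound[OF \<open>p \<noteq> 0\<close>])
    finally show False using roots deg by simp
  qed
  moreover have "coeff p d = S d - R d"
    unfolding p_def using d by (simp add: coeff_sum)
  ultimately have "S d = R d" by simp
  thus ?thesis using summable_sums[OF sub[of d]] by (simp add: S_def)
qed

section \<open>Bilateral sums and overpartitions of small numbers\<close>

lemma bilateral_sum_eq:
  assumes "q \<noteq> 0"
  shows "bilateral_sum c q = app (q ^ 5) (q ^ 5) (q powi c)"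
proof -
  have "bilateral_term c q n = app_term (q ^ 5) (q ^ 5) n (q powi c)" for n
  proof -
    have "(q ^ 5) powi k = q powi (5 * k)" for k by (simp add: power_int_mult)
    thus ?thesis using assms by (simp add: bilateral_term_def app_term_def power_int_add mult.commute)
  qed
  thus ?thesis by (simp add: bilateral_sum_def app_on_def)
qed

lemma bilateral_sum_0:
  assumes "0 < c" "c < 5"
  shows "bilateral_sum c 0 = 1"
proof -
  have "bilateral_sum c 0 = (\<Sum>\<^sub>\<infinity>n\<in>{0::int}. (1::complex))"
    unfolding bilateral_sum_def by (rule infsum_cong_neutral) (auto simp: bilateral_term_0[OF assms])
  thus ?thesis by simp
qed

text \<open>Any subset of the distinct parts may be overlined, so each partition is weighted by a
  power of 2.\<close>

lemma Nbar_partitions: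
  "Nbar s m n = (\<Sum>M | 0 \<notin># M \<and> sum_mset M = n \<and> M \<noteq> {#} \<and>
     [int (Max (set_mset M)) - int (size M) = s] (mod int m). 2 ^ card (set_mset M))"
proof -
  define A where "A = {M. 0 \<notin># M \<and> sum_mset M = n \<and> M \<noteq> {#} \<and>
     [int (Max (set_mset M)) - int (size M) = s] (mod int m)}"
  have "A \<subseteq> fst ` overpartitions n"
  proof
    fix M assume "M \<in> A"
    hence "(M, {}) \<in> overpartitions n" by (simp add: A_def overpartitions_def)
    thus "M \<in> fst ` overpartitions n" by force
  qed
  hence "finite A" by (rule finite_subset) (simp add: finite_overpartitions)
  moreover have "{p \<in> overpartitions n. fst p \<noteq> {#} \<and> [overpartition_rank p = s] (mod int m)}
      = (SIGMA M:A. Pow (set_mset M))"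
    by (auto simp: A_def overpartitions_def overpartition_rank_def)
  ultimately show ?thesis unfolding Nbar_def A_def[symmetric] by (simp add: card_SigmaI card_Pow)
qed

text \<open>Choosing some part k of a nonempty partition gives the recursion. The union is not
  disjoint, which is harmless for an enumeration as a set.\<close>

lemma partitions_rec:
  assumes "n > (0::nat)"
  shows "{M. 0 \<notin># M \<and> sum_mset M = n} = (\<Union>k\<in>{1..n}. add_mset k ` {M. 0 \<notin># M \<and> sum_mset M = n - k})"
proof
  show "{M. 0 \<notin># M \<and> sum_mset M = n} \<subseteq> (\<Union>k\<in>{1..n}. add_mset k ` {M. 0 \<notin># M \<and> sum_mset M = n - k})"
  proof
    fix M :: "nat multiset" assume M: "M \<in> {M. 0 \<notin># M \<and> sum_mset M = n}"
    hence "M \<noteq> {#}" using assms by auto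
    then obtain k M' where k: "M = add_mset k M'" by (meson multiset_cases)
    hence "k \<in> {1..n}" "M' \<in> {M. 0 \<notin># M \<and> sum_mset M = n - k}" using M by auto
    thus "M \<in> (\<Union>k\<in>{1..n}. add_mset k ` {M. 0 \<notin># M \<and> sum_mset M = n - k})" using k by blast
  qed
qed auto

lemma small_partitions:
  "{M. 0 \<notin># M \<and> sum_mset M = (0::nat)} = {{#}}"
  "{M. 0 \<notin># M \<and> sum_mset M = (1::nat)} = {{#1#}}"
  "{M. 0 \<notin># M \<and> sum_mset M = (2::nat)} = {{#2#}, {#1, 1#}}"
  "{M. 0 \<notin># M \<and> sum_mset M = (3::nat)} = {{#3#}, {#1, 2#}, {#1, 1, 1#}}"
  "{M. 0 \<notin># M \<and> sum_mset M = (4::nat)} = {{#4#}, {#1, 3#}, {#2, 2#}, {#1, 1, 2#}, {#1, 1, 1, 1#}}"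
proof -
  define P where "P = (\<lambda>n. {M. 0 \<notin># M \<and> sum_mset M = (n::nat)})"
  have rec: "P n = (\<Union>k\<in>{1..n}. add_mset k ` P (n - k))" if "n > 0" for n
    unfolding P_def by (rule partitions_rec[OF that])
  have I: "{1..1} = {1::nat}" "{1..2} = {1, 2::nat}" "{1..3} = {1, 2, 3::nat}" "{1..4} = {1, 2, 3, 4::nat}"
    by auto
  have 0: "P 0 = {{#}}"
  proof -
    have "M = {#}" if "0 \<notin># M" "sum_mset M = 0" for M :: "nat multiset"
      using that by (cases M) auto
    thus ?thesis by (auto simp: P_def)
  qed
  have 1: "P 1 = {{#1#}}" using rec[of 1] unfolding I by (simp add: 0 del: One_nat_def)
  have one: "P (Suc 0) = {{#1#}}" using 1 by (simp only: One_nat_def)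
  have 2: "P 2 = {{#2#}, {#1, 1#}}" using rec[of 2] unfolding I
    by (simp add: 0 1 one insert_commute del: One_nat_def)
  have 3: "P 3 = {{#3#}, {#1, 2#}, {#1, 1, 1#}}" using rec[of 3] unfolding I
    by (simp add: 0 1 one 2 add_mset_commute insert_commute del: One_nat_def)
  have 4: "P 4 = {{#4#}, {#1, 3#}, {#2, 2#}, {#1, 1, 2#}, {#1, 1, 1, 1#}}" using rec[of 4] unfolding I
    by (simp add: 0 1 one 2 3 add_mset_commute insert_commute del: One_nat_def)
  show "{M. 0 \<notin># M \<and> sum_mset M = (0::nat)} = {{#}}" "{M. 0 \<notin># M \<and> sum_mset M = (1::nat)} = {{#1#}}"
    "{M. 0 \<notin># M \<and> sum_mset M = (2::nat)} = {{#2#}, {#1, 1#}}"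
    "{M. 0 \<notin># M \<and> sum_mset M = (3::nat)} = {{#3#}, {#1, 2#}, {#1, 1, 1#}}"
    "{M. 0 \<notin># M \<and> sum_mset M = (4::nat)} = {{#4#}, {#1, 3#}, {#2, 2#}, {#1, 1, 2#}, {#1, 1, 1, 1#}}"
    using 0 1 2 3 4 unfolding P_def by this
qed

lemma Nbar_small:
  "Nbar s 5 0 = 0"
  "Nbar s 5 1 = (if s mod 5 = 0 then 2 else 0)"
  "Nbar s 5 2 = (if s mod 5 = 1 then 2 else 0) + (if s mod 5 = 4 then 2 else 0)"
  "Nbar s 5 3 = (if s mod 5 = 2 then 2 else 0) + (if s mod 5 = 0 then 4 else 0) + (if s mod 5 = 3 then 2 else 0)"
  "Nbar s 5 4 = (if s mod 5 = 3 then 2 else 0) + (if s mod 5 = 1 then 4 else 0) + (if s mod 5 = 0 then 2 else 0)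
     + (if s mod 5 = 4 then 4 else 0) + (if s mod 5 = 2 then 2 else 0)"
proof -
  have N: "Nbar s 5 n = (\<Sum>M\<in>P. if M \<noteq> {#} \<and> [int (Max (set_mset M)) - int (size M) = s] (mod 5) then 2 ^ card (set_mset M) else 0)"
    if P: "{M. 0 \<notin># M \<and> sum_mset M = n} = P" "finite P" for n P
    unfolding sum.inter_filter[OF P(2), symmetric] unfolding P(1)[symmetric] Nbar_partitions by (rule sum.cong) auto
  \<comment> \<open>The multiplicities of the parts 1 and 2 already distinguish the partitions
    within each list.\<close>
  have ne: "{#2#} \<noteq> {#1, 1 :: nat#}" "{#3#} \<noteq> {#1, 2 :: nat#}" "{#3#} \<noteq> {#1, 1, 1 :: nat#}" "{#1, 2#} \<noteq> {#1, 1, 1 :: nat#}"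
    "{#4#} \<noteq> {#1, 3 :: nat#}" "{#4#} \<noteq> {#2, 2 :: nat#}" "{#4#} \<noteq> {#1, 1, 2 :: nat#}" "{#4#} \<noteq> {#1, 1, 1, 1 :: nat#}"
    "{#1, 3#} \<noteq> {#2, 2 :: nat#}" "{#1, 3#} \<noteq> {#1, 1, 2 :: nat#}" "{#1, 3#} \<noteq> {#1, 1, 1, 1 :: nat#}"
    "{#2, 2#} \<noteq> {#1, 1, 2 :: nat#}" "{#2, 2#} \<noteq> {#1, 1, 1, 1 :: nat#}" "{#1, 1, 2#} \<noteq> {#1, 1, 1, 1 :: nat#}"
    by (auto dest!: arg_cong[where f = "\<lambda>M. (count M 1, count M 2)"])
  have c: "[i = s] (mod 5) \<longleftrightarrow> s mod 5 = i mod 5" for i by (auto simp: cong_def)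
  show "Nbar s 5 0 = 0"
    unfolding N[OF small_partitions(1) finite.intros(2)[OF finite.emptyI]] by simp
  show "Nbar s 5 1 = (if s mod 5 = 0 then 2 else 0)"
    by (subst N[OF small_partitions(2)]) (simp_all add: c)
  show "Nbar s 5 2 = (if s mod 5 = 1 then 2 else 0) + (if s mod 5 = 4 then 2 else 0)"
    by (subst N[OF small_partitions(3)]) (simp_all add: c ne del: One_nat_def)
  show "Nbar s 5 3 = (if s mod 5 = 2 then 2 else 0) + (if s mod 5 = 0 then 4 else 0) + (if s mod 5 = 3 then 2 else 0)"
    by (subst N[OF small_partitions(4)]) (simp_all add: c ne del: One_nat_def)
  show "Nbar s 5 4 = (if s mod 5 = 3 then 2 else 0) + (if s mod 5 = 1 then 4 else 0) + (if s mod 5 = 0 then 2 else 0)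
     + (if s mod 5 = 4 then 4 else 0) + (if s mod 5 = 2 then 2 else 0)"
    by (subst N[OF small_partitions(5)]) (simp_all add: c ne del: One_nat_def)
qed

lemma R_term_at_0: "R_term s t d 0 sums (of_nat (Nbar s 5 d) - of_nat (Nbar t 5 d))"
proof -
  have "R_term s t d 0 sums (\<Sum>n\<in>{0}. R_term s t d 0 n)"
    by (rule sums_finite) (auto simp: R_term_def)
  thus ?thesis by (simp add: R_term_def)
qed

section \<open>The ten series in terms of theta quotients and Pochhammer symbols\<close>

lemma R_term_sums:
  fixes q :: complex
  assumes q: "norm q < 1" "q \<noteq> 0"
  defines "j \<equiv> th10 q" and "J \<equiv> qp (q ^ 10) (q ^ 10)"
  defines "U \<equiv> (\<lambda>c. AA q 5 c / (J * j 5))"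
  shows "R_term 1 2 0 q sums (2 * (q * J / (j 3 * j 4)))"
    and "R_term 1 2 1 q sums (- 2 * q * U 2)"
    and "R_term 1 2 2 q sums (2 * (J / (j 1 * j 4)))"
    and "R_term 1 2 3 q sums (- 2 * (J / (j 2 * j 3)))"
    and "R_term 1 2 4 q sums (6 * U 1 - 4 * (J * j 2 / ((j 4)\<^sup>2 * j 1)))"
    and "R_term 0 2 0 q sums (- 1 + J * j 5 * j 4 / ((j 2)\<^sup>2 * (j 3)\<^sup>2))"
    and "R_term 0 2 1 q sums (2 * (J * j 4 / ((j 2)\<^sup>2 * j 3)) + 4 * q * U 2)"
    and "R_term 0 2 2 q sums 0"
    and "R_term 0 2 3 q sums (2 * (J / (j 2 * j 3)))"
    and "R_term 0 2 4 q sums (2 * (J * j 2 / ((j 4)\<^sup>2 * j 1)) - 2 * U 1)"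
proof -
  have x: "norm x < 1" "x \<noteq> 0" if "x ^ 5 = q" for x
  proof -
    show "x \<noteq> 0" using that q by auto
    have "norm x ^ 5 < 1" using q that by (simp flip: norm_power)
    thus "norm x < 1" by (simp add: power_less_one_iff)
  qed
  have s5: "(\<Sum>d<5. f d) = f 0 + f 1 + f 2 + f 3 + f 4" for f :: "nat \<Rightarrow> complex"
    by (simp add: eval_nat_numeral)
  have R: "R_term s t d q = (\<lambda>n. (rank_count s (5 * n + d) - rank_count t (5 * n + d)) * q ^ n)" for s t d
    by (simp add: R_term_def rank_count_def fun_eq_iff)
  define f where "f = (\<lambda>d. [2 * (q * J / (j 3 * j 4)), - 2 * q * U 2, 2 * (J / (j 1 * j 4)), - 2 * (J / (j 2 * j 3)),
    6 * U 1 - 4 * (J * j 2 / ((j 4)\<^sup>2 * j 1))] ! d)"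
  have f: "R_term 1 2 d q sums f d" if "d < 5" for d
    unfolding R
  proof (rule residue_separation[OF _ q _ that])
    show "summable (\<lambda>N. (rank_count 1 N - rank_count 2 N) * y ^ N)" if "norm y < 1" "y \<noteq> 0" for y
      using rank_diff_sums(1)[OF that] by (rule sums_summable)
    show "(\<lambda>N. (rank_count 1 N - rank_count 2 N) * x ^ N) sums (\<Sum>d<5. f d * x ^ d)" if "x ^ 5 = q" for x
      using rank_diff_sums(1)[OF x[OF that]]
      unfolding rank_dissection(1)[OF x[OF that]] that j_def[symmetric] J_def[symmetric] s5 U_def[symmetric]
      by (simp add: f_def U_def)
  qed
  define g where "g = (\<lambda>d. [- 1 + J * j 5 * j 4 / ((j 2)\<^sup>2 * (j 3)\<^sup>2), 2 * (J * j 4 / ((j 2)\<^sup>2 * j 3)) + 4 * q * U 2, 0,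
    2 * (J / (j 2 * j 3)), 2 * (J * j 2 / ((j 4)\<^sup>2 * j 1)) - 2 * U 1] ! d)"
  have g: "R_term 0 2 d q sums g d" if "d < 5" for d
    unfolding R
  proof (rule residue_separation[OF _ q _ that])
    show "summable (\<lambda>N. (rank_count 0 N - rank_count 2 N) * y ^ N)" if "norm y < 1" "y \<noteq> 0" for y
      using rank_diff_sums(2)[OF that] by (rule sums_summable)
    show "(\<lambda>N. (rank_count 0 N - rank_count 2 N) * x ^ N) sums (\<Sum>d<5. g d * x ^ d)" if "x ^ 5 = q" for x
      using rank_diff_sums(2)[OF x[OF that]]
      unfolding rank_dissection(2)[OF x[OF that]] that j_def[symmetric] J_def[symmetric] s5
      by (simp add: g_def U_def)
  qed
  show "R_term 1 2 0 q sums (2 * (q * J / (j 3 * j 4)))" using f[of 0] by (simp add: f_def)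
  show "R_term 1 2 1 q sums (- 2 * q * U 2)" using f[of 1] by (simp add: f_def)
  show "R_term 1 2 2 q sums (2 * (J / (j 1 * j 4)))" using f[of 2] by (simp add: f_def)
  show "R_term 1 2 3 q sums (- 2 * (J / (j 2 * j 3)))" using f[of 3] by (simp add: f_def)
  show "R_term 1 2 4 q sums (6 * U 1 - 4 * (J * j 2 / ((j 4)\<^sup>2 * j 1)))" using f[of 4] by (simp add: f_def)
  show "R_term 0 2 0 q sums (- 1 + J * j 5 * j 4 / ((j 2)\<^sup>2 * (j 3)\<^sup>2))" using g[of 0] by (simp add: g_def)
  show "R_term 0 2 1 q sums (2 * (J * j 4 / ((j 2)\<^sup>2 * j 3)) + 4 * q * U 2)" using g[of 1] by (simp add: g_def)
  show "R_term 0 2 2 q sums 0" using g[of 2] by (simp add: g_def)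
  show "R_term 0 2 3 q sums (2 * (J / (j 2 * j 3)))" using g[of 3] by (simp add: g_def)
  show "R_term 0 2 4 q sums (2 * (J * j 2 / ((j 4)\<^sup>2 * j 1)) - 2 * U 1)" using g[of 4] by (simp add: g_def)
qed

lemma qpoch_theta_quotients:
  fixes q :: complex
  assumes q: "norm q < 1" "q \<noteq> 0"
  defines "j \<equiv> th10 q" and "J \<equiv> qp (q ^ 10) (q ^ 10)"
  shows "qpoch [q ^ 10] (q ^ 10) = J"
    and "qpoch [q ^ 3, q ^ 4, q ^ 6, q ^ 7] (q ^ 10) = j 3 * j 4"
    and "qpoch [q\<^sup>2, q ^ 8, q ^ 10] (q ^ 10) = J * j 2" "qpoch [q ^ 4, q ^ 6, q ^ 10] (q ^ 10) = J * j 4"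
    and "qpoch [q, q ^ 9] (q ^ 10) = j 1" "qpoch [q\<^sup>2, q ^ 8] (q ^ 10) = j 2"
    and "qpoch [q ^ 3, q ^ 7] (q ^ 10) = j 3" "qpoch [q ^ 4, q ^ 6] (q ^ 10) = j 4"
    and "qpoch [q, q ^ 4] (q ^ 5) = j 1 * j 4" "qpoch [q\<^sup>2, q ^ 3] (q ^ 5) = j 2 * j 3"
    and "qpoch [-(q\<^sup>2), -(q ^ 3)] (q ^ 5) = j 4 / (j 2 * j 3)"
    and "J * j 5 * qpoch [-(q ^ 5)] (q ^ 5) = qpoch [q ^ 5] (q ^ 5)" "qpoch [q ^ 5] (q ^ 5) \<noteq> 0"
proof -
  have n: "norm (q ^ 5) < 1" "norm (q ^ 10) < 1" "q ^ 5 \<noteq> 0" using q by (auto simp: norm_power power_less_one_iff)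
  have e: "q ^ 10 / q = q ^ 9" "q ^ 10 / q\<^sup>2 = q ^ 8" "q ^ 10 / q ^ 3 = q ^ 7" "q ^ 10 / q ^ 4 = q ^ 6"
    "q ^ 5 / q = q ^ 4" "q ^ 5 / q\<^sup>2 = q ^ 3" "q ^ 5 / - (q\<^sup>2) = - (q ^ 3)"
    using q by (simp_all add: field_simps flip: power_add power_Suc power_Suc2)
  have jj: "j 1 = qp q (q ^ 10) * qp (q ^ 9) (q ^ 10)" "j 2 = qp (q\<^sup>2) (q ^ 10) * qp (q ^ 8) (q ^ 10)"
    "j 3 = qp (q ^ 3) (q ^ 10) * qp (q ^ 7) (q ^ 10)" "j 4 = qp (q ^ 4) (q ^ 10) * qp (q ^ 6) (q ^ 10)"
    by (simp_all only: j_def th10_def th_def power_one_right e)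
  note t = th5_th10[OF q, folded j_def, unfolded th_def e]
  show "qpoch [q ^ 10] (q ^ 10) = J"
    "qpoch [q ^ 3, q ^ 4, q ^ 6, q ^ 7] (q ^ 10) = j 3 * j 4"
    "qpoch [q\<^sup>2, q ^ 8, q ^ 10] (q ^ 10) = J * j 2" "qpoch [q ^ 4, q ^ 6, q ^ 10] (q ^ 10) = J * j 4"
    "qpoch [q, q ^ 9] (q ^ 10) = j 1" "qpoch [q\<^sup>2, q ^ 8] (q ^ 10) = j 2"
    "qpoch [q ^ 3, q ^ 7] (q ^ 10) = j 3" "qpoch [q ^ 4, q ^ 6] (q ^ 10) = j 4"
    unfolding qpoch_eq[OF n(2)] jj by (simp_all add: J_def mult_ac)
  show "qpoch [q, q ^ 4] (q ^ 5) = j 1 * j 4" "qpoch [q\<^sup>2, q ^ 3] (q ^ 5) = j 2 * j 3"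
    "qpoch [-(q\<^sup>2), -(q ^ 3)] (q ^ 5) = j 4 / (j 2 * j 3)"
    unfolding qpoch_eq[OF n(1)] using t(1,2,6) by simp_all
  \<comment> \<open>Gauss's identity at base q^5, with its theta series evaluated by
    \<open>vt5\<close>.\<close>
  show "J * j 5 * qpoch [-(q ^ 5)] (q ^ 5) = qpoch [q ^ 5] (q ^ 5)"
    unfolding qpoch_eq[OF n(1)] using gauss_vt[OF n(1,3)] vt5(1)[OF q] by (simp add: J_def j_def)
  show "qpoch [q ^ 5] (q ^ 5) \<noteq> 0" unfolding qpoch_eq[OF n(1)] using qp_q_q_nonzero[OF n(1)] by simp
qed

theorem theorem1p2:
  fixes q :: complex
  assumes "norm q < 1"
  shows
    "R_term 1 2 0 q sums
       (2 * q * qpoch [q^10] (q^10) / qpoch [q^3, q^4, q^6, q^7] (q^10)) \<and>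
     R_term 1 2 1 q sums
       (-2 * q * qpoch [-(q^5)] (q^5) / qpoch [q^5] (q^5) * bilateral_sum 2 q) \<and>
     R_term 1 2 2 q sums
       (2 * qpoch [q^10] (q^10) / qpoch [q, q^4] (q^5)) \<and>
     R_term 1 2 3 q sums
       (-2 * qpoch [q^10] (q^10) / qpoch [q^2, q^3] (q^5)) \<and>
     R_term 1 2 4 q sums
       (6 * qpoch [-(q^5)] (q^5) / qpoch [q^5] (q^5) * bilateral_sum 1 q
        - 4 * qpoch [q^2, q^8, q^10] (q^10)
            / ((qpoch [q^4, q^6] (q^10))^2 * qpoch [q, q^9] (q^10))) \<and>
     R_term 0 2 0 q sums
       (-1 + qpoch [-(q^2), -(q^3)] (q^5) * qpoch [q^5] (q^5)
            / (qpoch [q^2, q^3] (q^5) * qpoch [-(q^5)] (q^5))) \<and>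
     R_term 0 2 1 q sums
       (2 * qpoch [q^4, q^6, q^10] (q^10)
            / ((qpoch [q^2, q^8] (q^10))^2 * qpoch [q^3, q^7] (q^10))
        + 4 * q * qpoch [-(q^5)] (q^5) / qpoch [q^5] (q^5) * bilateral_sum 2 q) \<and>
     R_term 0 2 2 q sums 0 \<and>
     R_term 0 2 3 q sums
       (2 * qpoch [q^10] (q^10) / qpoch [q^2, q^3] (q^5)) \<and>
     R_term 0 2 4 q sums
       (2 * qpoch [q^2, q^8, q^10] (q^10)
            / ((qpoch [q^4, q^6] (q^10))^2 * qpoch [q, q^9] (q^10))
        - 2 * qpoch [-(q^5)] (q^5) / qpoch [q^5] (q^5) * bilateral_sum 1 q)"
proof (cases "q = 0")
  case True
  \<comment> \<open>At q = 0 each series reduces to its term n = 0, where 0^0 = 1, so the claim is a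
    count of overpartitions of d.\<close>
  have "R_term s t d 0 sums v" if "v = of_nat (Nbar s 5 d) - of_nat (Nbar t 5 d)" for s t d v
    using R_term_at_0 unfolding that .
  note at0 = this
  have [simp]: "Nbar s 5 (Suc 0) = (if s mod 5 = 0 then 2 else 0)" for s using Nbar_small(2)[of s] by simp
  show ?thesis unfolding True
    by (intro conjI at0) (simp_all add: Nbar_small qpoch_def bilateral_sum_0)
next
  case False
  note q = assms False
  define A B where AB: "A = qpoch [-(q ^ 5)] (q ^ 5)" "B = qpoch [q ^ 5] (q ^ 5)"
  define J where "J = qp (q ^ 10) (q ^ 10)"
  define a0 where "a0 = J * th10 q 5"
  note p = qpoch_theta_quotients[OF q, folded J_def AB a0_def]
  have A: "A \<noteq> 0" and a0: "a0 \<noteq> 0" using p(12,13) by auto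
  have b: "bilateral_sum 1 q = AA q 5 1" "bilateral_sum 2 q = AA q 5 2"
    unfolding AA_def[OF q] using bilateral_sum_eq[OF q(2)] power_int_of_nat[of q 5] by simp_all
  \<comment> \<open>By Gauss's identity a0 A = B, the prefactor A / B of the bilateral sums is the
    denominator 1 / a0 in the definition of \<open>U\<close>.\<close>
  have gA: "c * A / B * F = c * (F / a0)" for c F
    unfolding p(12)[symmetric] using A a0 by simp
  have gB: "x * B / (y * A) = a0 * x / y" for x y
    unfolding p(12)[symmetric] using A a0 by simp
  show ?thesis
    unfolding AB[symmetric] p(1-11) b gA gB
    using R_term_sums[OF q, folded J_def a0_def]
    by (simp add: mult_ac power2_eq_square)
qed

end
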